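(* Let $d \ge 1$ and let $f$ be a probability density on $\mathbb{R}^d$ with $\int f^5 < \infty$. Let $(r_n)$ be a sequence of positive reals with $r_n \to 0$ and $\lim_{n\to\infty} n^{3/2} r_n^d = \infty$. For each $n$, let $X_1,\ldots,X_n$ be i.i.d. with density $f$ and let $G_n$ be the random geometric graph on vertex set $[n]=\{1,\ldots,n\}$ in which $\{i,j\}$ ($i\neq j$) is an edge iff $\|X_i - X_j\| \le r_n$ (Euclidean norm). Then there exists an estimator $\Delta_n$ of $d$, computed from the adjacency matrix of $G_n$ alone (without knowledge of $d$, $f$, $r_n$ or the $X_i$), such that $\Delta_n \to d$ in probability as $n \to \infty$. *)

theory Defs
  imports "HOL-Probability.Probability"
begin

text \<open>Points of R^d are represented as functions nat => real (coordinates 0..d-1),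
  extensional outside {..<d}; Lebesgue measure on R^d is the product of d copies of lborel.\<close>

definition lebesgue_pow :: "nat \<Rightarrow> (nat \<Rightarrow> real) measure" where
  "lebesgue_pow d = PiM {..<d} (\<lambda>_. lborel)"

definition eucl_dist :: "nat \<Rightarrow> (nat \<Rightarrow> real) \<Rightarrow> (nat \<Rightarrow> real) \<Rightarrow> real" where
  "eucl_dist d x y = sqrt (\<Sum>k<d. (x k - y k)^2)"

definition rgg_adj :: "nat \<Rightarrow> real \<Rightarrow> nat \<Rightarrow> (nat \<Rightarrow> nat \<Rightarrow> real) \<Rightarrow> nat \<Rightarrow> nat \<Rightarrow> bool" where
  "rgg_adj d rad n w = (\<lambda>i j. i < n \<and> j < n \<and> i \<noteq> j \<and> eucl_dist d (w i) (w j) \<le> rad)"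

definition sample_space :: "nat \<Rightarrow> ((nat \<Rightarrow> real) \<Rightarrow> real) \<Rightarrow> nat \<Rightarrow> (nat \<Rightarrow> nat \<Rightarrow> real) measure" where
  "sample_space d f n = PiM {..<n} (\<lambda>_. density (lebesgue_pow d) (\<lambda>x. ennreal (f x)))"

end

theory Submission
  imports Defs
begin

text \<open>The estimator inverts the global clustering coefficient: the number of triangles divided by the
  number of wedges (paths with two edges) concentrates at a constant that depends on the dimension only.

  For a kernel supported on triples of diameter of order r, translation continuity of f^3 in L^1 shows
  that the probability that a random triple is a wedge or a triangle is r^(2d) times the integral of f^3
  times the volume of the corresponding set of pairs (u, v), so the unknown f and r cancel in the ratio.
  Conditioning on the longest side, the limiting ratio is 3/2 times the fraction of the unit ball that lies
  within distance 1 of a boundary point. Slicing orthogonally to that point turns the fraction into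
  N / (N + D), where N and D are the integrals of (1 - t^2)^((d - 1) / 2) over [1/2, 1] and [0, 1/2].
  Since 1 - t^2 is at most 3/4 on the first interval and at least 3/4 on the second, N / D is strictly
  decreasing in d, and thresholds halfway between consecutive values separate the dimensions.

  Concentration is Chebyshev's inequality for the sum, over triples, of triangle minus c times wedge.
  Pairs of triples with m = 3, 4, 5 vertices in their union contribute at most a constant times
  n^m r^((m - 1) d), by the bound on the fifth moment; this is negligible against the squared mean, of
  order n^6 r^(4d), exactly because n^(3/2) r^d tends to infinity.\<close>

section \<open>Lebesgue measure on powers of the line\<close>

text \<open>The random ratio itself is never analysed. Whether it exceeds a constant c is the sign
  of T - c * W, with T triangles and W wedges; its mean per triple is of exact order q^2, where q =
  r^d, with the sign of \<open>clustering d - c\<close>, provided that c differs from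
  \<open>clustering d\<close>. So the estimator can fail only if such a sum has the wrong sign for
  one of the thresholds next to d. Disjoint triples are independent and their contribution cancels
  against the squared mean. An overlapping pair lies within 2 * r of a shared vertex, so every
  overlap pattern is covered by one star with at most four leaves. Its probability is an integral of
  f times the fourth power of a local average of f, which is where the fifth moment comes from.
  Divided by n^6 q^4, the three overlap sizes leave 1 / (n^3 q^2), 1 / (n^2 q) and 1 / n; the first
  is the inverse square of n^(3/2) q. On the geometric side, rotation invariance is needed only for
  a reflection exchanging two vectors of equal norm, and polar coordinates are replaced by the
  symmetry between u and v for pairs in a ball.\<close>

interpretation lb: product_sigma_finite "\<lambda>_::nat. lborel :: real measure" ..

lemma sets_lebesgue_pow [measurable_cong]:
  "sets (lebesgue_pow d) = sets (Pi\<^sub>M {..<d} (\<lambda>_. borel))"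
  unfolding lebesgue_pow_def by (rule sets_PiM_cong) auto

lemma space_lebesgue_pow: "space (lebesgue_pow d) = ({..<d} \<rightarrow>\<^sub>E UNIV)"
  unfolding lebesgue_pow_def space_PiM by simp

lemma sigma_finite_lebesgue_pow: "sigma_finite_measure (lebesgue_pow d)"
  unfolding lebesgue_pow_def by (rule lb.sigma_finite) simp

interpretation lp: sigma_finite_measure "lebesgue_pow d" for d
  by (rule sigma_finite_lebesgue_pow)

interpretation lp2: pair_sigma_finite "lebesgue_pow d" "lebesgue_pow e" for d e ..

lemma emeasure_lebesgue_pow_box:
  assumes "\<And>k. k < d \<Longrightarrow> A k \<in> sets borel"
  shows "emeasure (lebesgue_pow d) (Pi\<^sub>E {..<d} A) = (\<Prod>k<d. emeasure lborel (A k))"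
  unfolding lebesgue_pow_def using assms by (intro lb.emeasure_PiM) auto

lemma component_lebesgue_pow:
  "k < d \<Longrightarrow> (\<lambda>x. x k) \<in> borel_measurable (lebesgue_pow d)"
  by measurable

text \<open>One family for translations (c = 1), point reflections (c = -1) and dilations (u = 0).
  Restriction to \<open>{..<d}\<close> makes the result extensional, so it lies in the space for
  arbitrary \<open>u\<close> and \<open>x\<close>.\<close>

definition aff :: "nat \<Rightarrow> real \<Rightarrow> (nat \<Rightarrow> real) \<Rightarrow> (nat \<Rightarrow> real) \<Rightarrow> nat \<Rightarrow> real" where
  "aff d c u x = (\<lambda>k\<in>{..<d}. u k + c * x k)"

lemma aff_apply [simp]: "k < d \<Longrightarrow> aff d c u x k = u k + c * x k"
  by (simp add: aff_def)

lemma aff_in_space [simp]: "aff d c u x \<in> space (lebesgue_pow d)"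
  by (simp add: space_lebesgue_pow aff_def)

lemma space_lebesgue_pow_eqI:
  assumes "x \<in> space (lebesgue_pow d)" "y \<in> space (lebesgue_pow d)" "\<And>k. k < d \<Longrightarrow> x k = y k"
  shows "x = y"
  using assms unfolding space_lebesgue_pow by (intro PiE_ext) auto

lemma measurable_affI [measurable (raw)]:
  assumes [measurable]: "U \<in> measurable N (lebesgue_pow d)" "X \<in> measurable N (lebesgue_pow d)"
  shows "(\<lambda>w. aff d c (U w) (X w)) \<in> measurable N (lebesgue_pow d)"
proof -
  have "(\<lambda>w. aff d c (U w) (X w)) \<in> measurable N (Pi\<^sub>M {..<d} (\<lambda>_. borel))"
    unfolding aff_def
  proof (rule measurable_restrict)
    fix k assume "k \<in> {..<d}"
    then have k: "k < d" by simp
    have "(\<lambda>w. U w k) \<in> borel_measurable N" "(\<lambda>w. X w k) \<in> borel_measurable N"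
      using measurable_compose[OF assms(1) component_lebesgue_pow[OF k]]
        measurable_compose[OF assms(2) component_lebesgue_pow[OF k]] by auto
    then show "(\<lambda>w. U w k + c * X w k) \<in> measurable N borel"
      by measurable
  qed
  then show ?thesis
    by (simp add: measurable_cong_sets[OF refl sets_lebesgue_pow])
qed

lemma measurable_aff [measurable]: "aff d c u \<in> measurable (lebesgue_pow d) (lebesgue_pow d)"
proof -
  have "aff d c u \<in> measurable (lebesgue_pow d) (Pi\<^sub>M {..<d} (\<lambda>_. borel))"
    unfolding aff_def by (rule measurable_restrict) measurable
  then show ?thesis
    by (simp add: measurable_cong_sets[OF refl sets_lebesgue_pow])
qed

text \<open>A product measure is determined by its values on boxes. There the one-dimensional
  scaling law of \<open>lborel\<close> applies in each coordinate, and the d factors |c| multiply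
  up.\<close>

lemma lebesgue_pow_affine:
  assumes c: "c \<noteq> 0"
  shows "density (distr (lebesgue_pow d) (lebesgue_pow d) (aff d c u)) (\<lambda>_. ennreal (\<bar>c\<bar> ^ d)) = lebesgue_pow d"
proof -
  let ?P = "density (distr (lebesgue_pow d) (lebesgue_pow d) (aff d c u)) (\<lambda>_. ennreal (\<bar>c\<bar> ^ d))"
  have "?P = Pi\<^sub>M {..<d} (\<lambda>_. lborel)"
  proof (rule lb.PiM_eqI)
    show "sets ?P = sets (Pi\<^sub>M {..<d} (\<lambda>_. lborel))" by (simp add: lebesgue_pow_def)
    fix A :: "nat \<Rightarrow> real set" assume "\<And>i. i \<in> {..<d} \<Longrightarrow> A i \<in> sets lborel"
    then have A: "\<And>i. i < d \<Longrightarrow> A i \<in> sets borel" by simp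
    have box: "Pi\<^sub>E {..<d} A \<in> sets (lebesgue_pow d)"
      unfolding sets_lebesgue_pow using A by (intro sets_PiM_I_finite) auto
    let ?B = "\<lambda>k. (\<lambda>x. u k + c * x) -` A k"
    have B: "?B k \<in> sets borel" if "k < d" for k
      using measurable_sets_borel[of "\<lambda>x. u k + c * x" borel] A that by simp
    have one: "emeasure lborel (A k) = ennreal \<bar>c\<bar> * emeasure lborel (?B k)" if "k < d" for k
    proof -
      have "emeasure lborel (A k) = emeasure (density (distr lborel borel (\<lambda>x. u k + c * x)) (\<lambda>_. ennreal \<bar>c\<bar>)) (A k)"
        using lborel_real_affine[OF c, of "u k"] by simp
      also have "\<dots> = ennreal \<bar>c\<bar> * emeasure lborel (?B k)"
        using A[OF that] by (simp add: emeasure_density_const emeasure_distr)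
      finally show ?thesis .
    qed
    have vim: "aff d c u -` Pi\<^sub>E {..<d} A \<inter> space (lebesgue_pow d) = Pi\<^sub>E {..<d} ?B"
      unfolding space_lebesgue_pow aff_def
      by (auto simp: PiE_iff extensional_def)
    have "emeasure ?P (Pi\<^sub>E {..<d} A) = ennreal (\<bar>c\<bar> ^ d) * emeasure (lebesgue_pow d) (Pi\<^sub>E {..<d} ?B)"
      using box by (simp add: emeasure_density_const emeasure_distr vim)
    also have "\<dots> = (\<Prod>k<d. ennreal \<bar>c\<bar> * emeasure lborel (?B k))"
      by (subst emeasure_lebesgue_pow_box[OF B]) (simp_all add: prod.distrib ennreal_power)
    also have "\<dots> = (\<Prod>i<d. emeasure lborel (A i))"
      by (rule prod.cong) (simp_all add: one)
    finally show "emeasure ?P (Pi\<^sub>E {..<d} A) = (\<Prod>i\<in>{..<d}. emeasure lborel (A i))" .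
  qed simp
  then show ?thesis by (simp add: lebesgue_pow_def)
qed

lemma nn_integral_affine:
  assumes [measurable]: "F \<in> borel_measurable (lebesgue_pow d)" and c: "c \<noteq> 0"
  shows "(\<integral>\<^sup>+x. F x \<partial>lebesgue_pow d) = ennreal (\<bar>c\<bar> ^ d) * (\<integral>\<^sup>+x. F (aff d c u x) \<partial>lebesgue_pow d)"
proof -
  have "(\<integral>\<^sup>+x. F x \<partial>lebesgue_pow d) = (\<integral>\<^sup>+x. F x \<partial>density (distr (lebesgue_pow d) (lebesgue_pow d) (aff d c u)) (\<lambda>_. ennreal (\<bar>c\<bar> ^ d)))"
    by (simp only: lebesgue_pow_affine[OF c])
  also have "\<dots> = ennreal (\<bar>c\<bar> ^ d) * (\<integral>\<^sup>+x. F (aff d c u x) \<partial>lebesgue_pow d)"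
    by (simp add: nn_integral_density nn_integral_distr nn_integral_cmult)
  finally show ?thesis .
qed

lemma nn_integral_translate:
  assumes "F \<in> borel_measurable (lebesgue_pow d)"
  shows "(\<integral>\<^sup>+x. F (aff d 1 u x) \<partial>lebesgue_pow d) = (\<integral>\<^sup>+x. F x \<partial>lebesgue_pow d)"
  using nn_integral_affine[OF assms, of 1 u] by simp

lemma nn_integral_reflect:
  assumes "F \<in> borel_measurable (lebesgue_pow d)"
  shows "(\<integral>\<^sup>+x. F (aff d (-1) u x) \<partial>lebesgue_pow d) = (\<integral>\<^sup>+x. F x \<partial>lebesgue_pow d)"
  using nn_integral_affine[OF assms, of "-1" u] by simp

section \<open>Euclidean norm and distance in coordinates\<close>

abbreviation nrm :: "nat \<Rightarrow> (nat \<Rightarrow> real) \<Rightarrow> real" where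
  "nrm d x \<equiv> L2_set x {..<d}"

lemma eucl_dist_L2: "eucl_dist d x y = L2_set (\<lambda>k. x k - y k) {..<d}"
  by (simp add: eucl_dist_def L2_set_def)

lemma measurable_nrm [measurable]: "nrm d \<in> borel_measurable (lebesgue_pow d)"
  unfolding L2_set_def by measurable

lemma measurable_eucl_dist [measurable (raw)]:
  assumes "X \<in> measurable N (lebesgue_pow d)" "Y \<in> measurable N (lebesgue_pow d)"
  shows "(\<lambda>w. eucl_dist d (X w) (Y w)) \<in> borel_measurable N"
proof -
  have "(\<lambda>w. X w k) \<in> borel_measurable N" "(\<lambda>w. Y w k) \<in> borel_measurable N" if "k < d" for k
    using measurable_compose[OF assms(1) component_lebesgue_pow[OF that]]
      measurable_compose[OF assms(2) component_lebesgue_pow[OF that]] by auto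
  then show ?thesis
    unfolding eucl_dist_def by measurable
qed

lemma eucl_dist_commute: "eucl_dist d x y = eucl_dist d y x"
  by (simp add: eucl_dist_def power2_commute)

lemma eucl_dist_triangle: "eucl_dist d x z \<le> eucl_dist d x y + eucl_dist d y z"
proof -
  have "(\<lambda>k. x k - z k) = (\<lambda>k. (x k - y k) + (y k - z k))" by auto
  then show ?thesis
    unfolding eucl_dist_L2 using L2_set_triangle_ineq[of "\<lambda>k. x k - y k" "\<lambda>k. y k - z k" "{..<d}"] by simp
qed

lemma eucl_dist_nonneg [simp]: "0 \<le> eucl_dist d x y"
  by (simp add: eucl_dist_L2)

lemma nrm_aff_scale: "nrm d (aff d c (\<lambda>_. 0) x) = \<bar>c\<bar> * nrm d x"
proof -
  have "nrm d (aff d c (\<lambda>_. 0) x) = L2_set (\<lambda>k. c * x k) {..<d}"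
    by (rule L2_set_cong) auto
  also have "\<dots> = \<bar>c\<bar> * nrm d x"
    by (simp add: L2_set_def power_mult_distrib real_sqrt_mult flip: sum_distrib_left)
  finally show ?thesis .
qed

lemma eucl_dist_aff_scale:
  "eucl_dist d (aff d c (\<lambda>_. 0) x) (aff d c (\<lambda>_. 0) y) = \<bar>c\<bar> * eucl_dist d x y"
proof -
  have "eucl_dist d (aff d c (\<lambda>_. 0) x) (aff d c (\<lambda>_. 0) y) = sqrt (\<Sum>k<d. c^2 * (x k - y k)^2)"
    unfolding eucl_dist_def by (intro arg_cong[of _ _ sqrt] sum.cong) (auto simp: power2_eq_square algebra_simps)
  also have "\<dots> = \<bar>c\<bar> * eucl_dist d x y"
    by (simp add: eucl_dist_def real_sqrt_mult flip: sum_distrib_left)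
  finally show ?thesis .
qed

lemma ennreal_cancel_right:
  fixes a b c :: ennreal
  assumes "a * c = b * c" "0 < c" "c < \<infinity>"
  shows "a = b"
proof -
  have "c \<noteq> 0" "c \<noteq> top" using assms by auto
  then show ?thesis using assms(1) by (metis mult_divide_eq_ennreal)
qed

section \<open>Volumes of balls\<close>

definition ball_vol :: "nat \<Rightarrow> real \<Rightarrow> ennreal" where
  "ball_vol d \<rho> = emeasure (lebesgue_pow d) {x \<in> space (lebesgue_pow d). nrm d x \<le> \<rho>}"

lemma ball_vol_nn: "ball_vol d \<rho> = (\<integral>\<^sup>+x. indicator {x. nrm d x \<le> \<rho>} x \<partial>lebesgue_pow d)"
proof -
  have "ball_vol d \<rho> = (\<integral>\<^sup>+x. indicator {x \<in> space (lebesgue_pow d). nrm d x \<le> \<rho>} x \<partial>lebesgue_pow d)"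
    unfolding ball_vol_def by (rule nn_integral_indicator[symmetric]) measurable
  then show ?thesis by (simp add: indicator_def cong: nn_integral_cong)
qed

lemma ball_vol_scale:
  assumes "\<rho> > 0" shows "ball_vol d \<rho> = ennreal (\<rho> ^ d) * ball_vol d 1"
proof -
  have "ball_vol d \<rho> = ennreal (\<bar>\<rho>\<bar> ^ d) * (\<integral>\<^sup>+x. indicator {x. nrm d x \<le> \<rho>} (aff d \<rho> (\<lambda>_. 0) x) \<partial>lebesgue_pow d)"
    unfolding ball_vol_nn using assms by (intro nn_integral_affine) auto
  also have "(\<integral>\<^sup>+x. indicator {x. nrm d x \<le> \<rho>} (aff d \<rho> (\<lambda>_. 0) x) \<partial>lebesgue_pow d) = ball_vol d 1"
    unfolding ball_vol_nn using assms
    by (intro nn_integral_cong) (auto simp: indicator_def nrm_aff_scale)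
  finally show ?thesis using assms by simp
qed

lemma ball_vol_finite: "ball_vol d \<rho> < top"
proof -
  have "ball_vol d \<rho> \<le> emeasure (lebesgue_pow d) (Pi\<^sub>E {..<d} (\<lambda>_. {-\<rho>..\<rho>}))"
    unfolding ball_vol_def
  proof (rule emeasure_mono)
    show "{x \<in> space (lebesgue_pow d). nrm d x \<le> \<rho>} \<subseteq> Pi\<^sub>E {..<d} (\<lambda>_. {-\<rho>..\<rho>})"
    proof
      fix x assume x: "x \<in> {x \<in> space (lebesgue_pow d). nrm d x \<le> \<rho>}"
      have "\<bar>x k\<bar> \<le> \<rho>" if "k < d" for k
        using x member_le_L2_set[of "{..<d}" k "\<lambda>k. \<bar>x k\<bar>"] that by (auto simp: L2_set_def)
      then show "x \<in> Pi\<^sub>E {..<d} (\<lambda>_. {-\<rho>..\<rho>})"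
        using x by (force simp: space_lebesgue_pow PiE_iff abs_le_iff)
    qed
    show "Pi\<^sub>E {..<d} (\<lambda>_. {-\<rho>..\<rho>}) \<in> sets (lebesgue_pow d)"
      unfolding sets_lebesgue_pow by (intro sets_PiM_I_finite) auto
  qed
  also have "\<dots> < top"
    by (subst emeasure_lebesgue_pow_box) (auto simp: emeasure_lborel_Icc_eq ennreal_power[symmetric] power_less_top_ennreal)
  finally show ?thesis .
qed

lemma ball_vol_pos: assumes "\<rho> > 0" shows "ball_vol d \<rho> > 0"
proof -
  \<comment> \<open>A cube of this half-width fits into the ball, because the norm is at most the
    sum of the moduli of the coordinates; the \<open>+ 1\<close> also covers dimension 0.\<close>
  let ?s = "\<rho> / (real d + 1)"
  have s: "?s > 0" using assms by simp
  have "0 < (\<Prod>k<d. emeasure lborel {-?s..?s})"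
    using s by (auto simp: emeasure_lborel_Icc_eq ennreal_power zero_less_power add_pos_pos)
  also have "\<dots> = emeasure (lebesgue_pow d) (Pi\<^sub>E {..<d} (\<lambda>_. {-?s..?s}))"
    by (subst emeasure_lebesgue_pow_box) auto
  also have "\<dots> \<le> ball_vol d \<rho>"
    unfolding ball_vol_def
  proof (rule emeasure_mono)
    show "Pi\<^sub>E {..<d} (\<lambda>_. {-?s..?s}) \<subseteq> {x \<in> space (lebesgue_pow d). nrm d x \<le> \<rho>}"
    proof
      fix x assume x: "x \<in> Pi\<^sub>E {..<d} (\<lambda>_. {-?s..?s})"
      have "nrm d x \<le> (\<Sum>k<d. \<bar>x k\<bar>)" by (rule L2_set_le_sum_abs)
      also have "\<dots> \<le> (\<Sum>k<d. ?s)"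
        using x by (intro sum_mono) (auto simp: PiE_iff abs_le_iff minus_le_iff)
      also have "\<dots> \<le> \<rho>" using assms by (simp add: field_simps)
      finally show "x \<in> {x \<in> space (lebesgue_pow d). nrm d x \<le> \<rho>}"
        using x by (auto simp: space_lebesgue_pow)
    qed
    show "{x \<in> space (lebesgue_pow d). nrm d x \<le> \<rho>} \<in> sets (lebesgue_pow d)" by measurable
  qed
  finally show ?thesis .
qed

section \<open>Reflections and the lens between two balls\<close>

text \<open>The argument for uniqueness of Haar measure: by Fubini and invariance under translations, the integral
  of F (x) * G (x + H y) over all (x, y) can be evaluated in two ways, and G, the indicator of
  the unit ball, is invariant under H.\<close>

lemma isometric_involution_preserves:
  fixes H :: "(nat \<Rightarrow> real) \<Rightarrow> nat \<Rightarrow> real"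
  assumes [measurable]: "H \<in> measurable (lebesgue_pow d) (lebesgue_pow d)"
    and inv: "\<And>x. x \<in> space (lebesgue_pow d) \<Longrightarrow> H (H x) = x"
    and lin: "\<And>c x y. x \<in> space (lebesgue_pow d) \<Longrightarrow> y \<in> space (lebesgue_pow d) \<Longrightarrow>
       H (aff d c x y) = aff d c (H x) (H y)"
    and iso: "\<And>x. x \<in> space (lebesgue_pow d) \<Longrightarrow> nrm d (H x) = nrm d x"
    and F [measurable]: "F \<in> borel_measurable (lebesgue_pow d)"
  shows "(\<integral>\<^sup>+x. F (H x) \<partial>lebesgue_pow d) = (\<integral>\<^sup>+x. F x \<partial>lebesgue_pow d)"
proof -
  let ?L = "lebesgue_pow d"
  define G :: "(nat \<Rightarrow> real) \<Rightarrow> ennreal" where "G = indicator {x. nrm d x \<le> 1}"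
  have G [measurable]: "G \<in> borel_measurable ?L"
    unfolding G_def by measurable
  have Hs: "H x \<in> space ?L" if "x \<in> space ?L" for x
    using measurable_space[OF assms(1) that] .
  \<comment> \<open>By linearity and H (H x) = x, the vector x + H y equals H (H x + y), so
    translating y by H x makes x disappear.\<close>
  have 1: "(\<integral>\<^sup>+y. G (aff d 1 x (H y)) \<partial>?L) = (\<integral>\<^sup>+y. G (H y) \<partial>?L)" if x: "x \<in> space ?L" for x
  proof -
    have "(\<integral>\<^sup>+y. G (aff d 1 x (H y)) \<partial>?L) = (\<integral>\<^sup>+y. G (H (aff d 1 (H x) y)) \<partial>?L)"
      by (intro nn_integral_cong) (simp add: lin inv Hs x)
    also have "\<dots> = (\<integral>\<^sup>+y. G (H y) \<partial>?L)"
      by (rule nn_integral_translate) measurable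
    finally show ?thesis .
  qed
  have 2: "(\<integral>\<^sup>+y. F (aff d (-1) x (H y)) \<partial>?L) = (\<integral>\<^sup>+y. F (H y) \<partial>?L)" if x: "x \<in> space ?L" for x
  proof -
    have "(\<integral>\<^sup>+y. F (aff d (-1) x (H y)) \<partial>?L) = (\<integral>\<^sup>+y. F (H (aff d (-1) (H x) y)) \<partial>?L)"
      by (intro nn_integral_cong) (simp add: lin inv Hs x)
    also have "\<dots> = (\<integral>\<^sup>+y. F (H y) \<partial>?L)"
      by (rule nn_integral_reflect) measurable
    finally show ?thesis .
  qed
  \<comment> \<open>Replacing x by x + H y moves the shift from F to G; after this exchange the
    integral over y concerns F alone.\<close>
  have 3: "(\<integral>\<^sup>+x. F x * G (aff d 1 x (H y)) \<partial>?L) = (\<integral>\<^sup>+x. F (aff d (-1) x (H y)) * G x \<partial>?L)"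
    if y: "y \<in> space ?L" for y
  proof -
    have a: "aff d (-1) (aff d 1 (H y) x) (H y) = x" if "x \<in> space ?L" for x
      by (rule space_lebesgue_pow_eqI[where d = d]) (use that in simp_all)
    have b: "aff d 1 (H y) x = aff d 1 x (H y)" for x
      by (rule space_lebesgue_pow_eqI[where d = d]) simp_all
    have "(\<integral>\<^sup>+x. F (aff d (-1) x (H y)) * G x \<partial>?L) =
       (\<integral>\<^sup>+x. F (aff d (-1) (aff d 1 (H y) x) (H y)) * G (aff d 1 (H y) x) \<partial>?L)"
      using y Hs by (intro nn_integral_translate[symmetric]) measurable
    also have "\<dots> = (\<integral>\<^sup>+x. F x * G (aff d 1 x (H y)) \<partial>?L)"
      by (intro nn_integral_cong) (simp add: a b[symmetric])
    finally show ?thesis ..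
  qed
  have "(\<integral>\<^sup>+x. F x \<partial>?L) * (\<integral>\<^sup>+y. G (H y) \<partial>?L) = (\<integral>\<^sup>+x. (\<integral>\<^sup>+y. F x * G (aff d 1 x (H y)) \<partial>?L) \<partial>?L)"
    by (simp add: nn_integral_cmult 1 nn_integral_multc cong: nn_integral_cong)
  also have "\<dots> = (\<integral>\<^sup>+y. (\<integral>\<^sup>+x. F x * G (aff d 1 x (H y)) \<partial>?L) \<partial>?L)"
    by (rule lp2.Fubini'[symmetric]) measurable
  also have "\<dots> = (\<integral>\<^sup>+y. (\<integral>\<^sup>+x. F (aff d (-1) x (H y)) * G x \<partial>?L) \<partial>?L)"
    by (intro nn_integral_cong 3)
  also have "\<dots> = (\<integral>\<^sup>+x. (\<integral>\<^sup>+y. F (aff d (-1) x (H y)) * G x \<partial>?L) \<partial>?L)"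
    by (rule lp2.Fubini') measurable
  also have "\<dots> = (\<integral>\<^sup>+y. F (H y) \<partial>?L) * (\<integral>\<^sup>+x. G x \<partial>?L)"
    by (simp add: nn_integral_multc 2 nn_integral_cmult cong: nn_integral_cong)
  finally have eq: "(\<integral>\<^sup>+x. F x \<partial>?L) * (\<integral>\<^sup>+y. G (H y) \<partial>?L) = (\<integral>\<^sup>+y. F (H y) \<partial>?L) * (\<integral>\<^sup>+x. G x \<partial>?L)" .
  have "(\<integral>\<^sup>+y. G (H y) \<partial>?L) = (\<integral>\<^sup>+x. G x \<partial>?L)"
    unfolding G_def by (intro nn_integral_cong) (simp add: iso indicator_def)
  moreover have "(\<integral>\<^sup>+x. G x \<partial>?L) = ball_vol d 1"
    by (simp add: ball_vol_nn G_def)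
  ultimately have "(\<integral>\<^sup>+x. F x \<partial>?L) * ball_vol d 1 = (\<integral>\<^sup>+y. F (H y) \<partial>?L) * ball_vol d 1"
    using eq by simp
  then show ?thesis
    by (rule ennreal_cancel_right[symmetric]) (simp_all add: ball_vol_pos ball_vol_finite)
qed

section \<open>Inner products and Householder reflections\<close>

definition ip :: "nat \<Rightarrow> (nat \<Rightarrow> real) \<Rightarrow> (nat \<Rightarrow> real) \<Rightarrow> real" where
  "ip d x y = (\<Sum>k<d. x k * y k)"

lemma nrm_sq: "(nrm d x)\<^sup>2 = ip d x x"
  by (simp add: L2_set_def ip_def power2_eq_square sum_nonneg)

lemma nrm_cong_ip: "ip d x x = ip d y y \<Longrightarrow> nrm d x = nrm d y"
  by (simp add: L2_set_def ip_def power2_eq_square)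

definition householder :: "nat \<Rightarrow> (nat \<Rightarrow> real) \<Rightarrow> (nat \<Rightarrow> real) \<Rightarrow> nat \<Rightarrow> real" where
  "householder d w x = (\<lambda>k\<in>{..<d}. x k - 2 * ip d w x / ip d w w * w k)"

lemma householder_apply [simp]:
  "k < d \<Longrightarrow> householder d w x k = x k - 2 * ip d w x / ip d w w * w k"
  by (simp add: householder_def)

lemma householder_in_space [simp]: "householder d w x \<in> space (lebesgue_pow d)"
  by (simp add: space_lebesgue_pow householder_def)

lemma ip_aff: "ip d w (aff d c x y) = ip d w x + c * ip d w y"
  by (simp add: ip_def sum.distrib sum_distrib_left algebra_simps)

lemma ip_householder: "ip d y (householder d w x) = ip d y x - 2 * ip d w x / ip d w w * ip d y w"
proof -
  define c where "c = 2 * ip d w x / ip d w w"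
  have "ip d y (householder d w x) = (\<Sum>k<d. y k * x k - c * (y k * w k))"
    unfolding ip_def[of d y "householder d w x"] by (intro sum.cong) (auto simp: c_def algebra_simps)
  also have "\<dots> = ip d y x - c * ip d y w"
    by (simp add: sum_subtractf ip_def sum_distrib_left)
  finally show ?thesis by (simp add: c_def)
qed

lemma ip_commute: "ip d x y = ip d y x"
  by (simp add: ip_def mult.commute)

lemma nn_integral_householder:
  assumes F: "F \<in> borel_measurable (lebesgue_pow d)" and w: "ip d w w \<noteq> 0"
  shows "(\<integral>\<^sup>+x. F (householder d w x) \<partial>lebesgue_pow d) = (\<integral>\<^sup>+x. F x \<partial>lebesgue_pow d)"
proof (rule isometric_involution_preserves[OF _ _ _ _ F])
  have "householder d w \<in> measurable (lebesgue_pow d) (Pi\<^sub>M {..<d} (\<lambda>_. borel))"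
    unfolding householder_def ip_def by (rule measurable_restrict) measurable
  then show "householder d w \<in> measurable (lebesgue_pow d) (lebesgue_pow d)"
    by (simp add: measurable_cong_sets[OF refl sets_lebesgue_pow])
next
  fix x assume x: "x \<in> space (lebesgue_pow d)"
  have *: "ip d w (householder d w x) = - ip d w x"
    using w by (simp add: ip_householder)
  show "householder d w (householder d w x) = x"
    by (rule space_lebesgue_pow_eqI[OF _ x]) (simp_all add: *)
  have "ip d (householder d w x) (householder d w x) = ip d x x"
    unfolding ip_householder[of d "householder d w x"] ip_commute[of d "householder d w x" w]
      ip_commute[of d "householder d w x" x] *
    by (subst ip_householder, simp add: ip_commute[of d x w])
  then show "nrm d (householder d w x) = nrm d x"
    by (rule nrm_cong_ip)
next
  fix c x y assume "x \<in> space (lebesgue_pow d)" "y \<in> space (lebesgue_pow d)"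
  show "householder d w (aff d c x y) = aff d c (householder d w x) (householder d w y)"
    by (rule space_lebesgue_pow_eqI[where d = d]) (simp_all add: ip_aff add_divide_distrib algebra_simps)
qed

lemma eucl_dist_sq: "(eucl_dist d x y)\<^sup>2 = ip d x x - 2 * ip d x y + ip d y y"
proof -
  have "(eucl_dist d x y)\<^sup>2 = (\<Sum>k<d. (x k - y k)\<^sup>2)"
    by (simp add: eucl_dist_def sum_nonneg)
  also have "\<dots> = ip d x x - 2 * ip d x y + ip d y y"
    by (simp add: ip_def power2_diff sum.distrib sum_subtractf sum_distrib_left power2_eq_square algebra_simps)
  finally show ?thesis .
qed

lemma eucl_dist_cong_ip:
  assumes "ip d x x - 2 * ip d x y + ip d y y = ip d x' x' - 2 * ip d x' y' + ip d y' y'"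
  shows "eucl_dist d x y = eucl_dist d x' y'"
  using assms by (metis eucl_dist_sq eucl_dist_nonneg power2_eq_iff_nonneg)

text \<open>The third vertices \<open>v\<close> for which the side from 0 to \<open>u\<close> is a
  longest side of the triangle 0, \<open>u\<close>, \<open>v\<close>. Geometrically, the
  intersection of the two balls of radius |u| around 0 and around \<open>u\<close>.\<close>

definition lens :: "nat \<Rightarrow> (nat \<Rightarrow> real) \<Rightarrow> ennreal" where
  "lens d u = (\<integral>\<^sup>+v. indicator {v. nrm d v \<le> nrm d u \<and> eucl_dist d u v \<le> nrm d u} v \<partial>lebesgue_pow d)"

text \<open>The reflection along w = u - u' exchanges \<open>u\<close> and \<open>u'\<close> when
  their norms agree and preserves inner products, so it carries one lens to the other. At distance 0
  the vector w vanishes, and the two points have the same distances to everything.\<close>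

lemma lens_rotate:
  assumes "nrm d u = nrm d u'"
  shows "lens d u = lens d u'"
proof (cases "eucl_dist d u u' = 0")
  case True
  have "eucl_dist d u v = eucl_dist d u' v" for v
    using eucl_dist_triangle[of d u v u'] eucl_dist_triangle[of d u' v u] True
    by (simp add: eucl_dist_commute)
  then show ?thesis using assms by (simp add: lens_def)
next
  case False
  define w where "w = aff d (-1) u u'"
  have uu: "ip d u u = ip d u' u'" using assms by (metis nrm_sq)
  have ipw: "ip d x w = ip d x u - ip d x u'" for x
    unfolding w_def by (simp add: ip_aff)
  have ww: "ip d w w = 2 * (ip d u u - ip d u u')"
    by (simp add: ipw ip_commute[of d w] uu ip_commute[of d u' u])
  have w0: "ip d w w \<noteq> 0"
    using False eucl_dist_sq[of d u u'] uu unfolding ww by auto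
  have "ip d w u = ip d u u - ip d u u'"
    using ipw[of u] by (simp add: ip_commute[of d w u])
  \<comment> \<open>This coefficient says that the reflection sends \<open>u\<close> to u - w =
    u'.\<close>
  then have 2: "2 * ip d w u / ip d w w = 1"
    using w0 ww by simp
  have i1: "ip d u (householder d w v) = ip d u' v" for v
  proof -
    have "ip d u (householder d w v) = ip d u v - (2 * ip d w u / ip d w w) * ip d w v"
      by (simp add: ip_householder ip_commute[of d u w])
    also have "\<dots> = ip d u v - ip d v w"
      unfolding 2 by (simp add: ip_commute[of d w v])
    finally show ?thesis by (simp add: ipw ip_commute[of d v])
  qed
  have i2: "ip d (householder d w v) (householder d w v) = ip d v v" for v
    using w0 by (simp add: ip_householder ip_commute[of d "householder d w v"] ip_commute[of d v w])
  have e: "eucl_dist d u (householder d w v) = eucl_dist d u' v" for v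
    by (rule eucl_dist_cong_ip) (simp only: i1 i2 uu)
  have e': "nrm d (householder d w v) = nrm d v" for v
    by (rule nrm_cong_ip[OF i2])
  \<comment> \<open>\<open>u\<close> is an arbitrary function, so the distance from it is shown
    measurable through its extensional restriction.\<close>
  have us: "restrict u {..<d} \<in> space (lebesgue_pow d)"
    by (simp add: space_lebesgue_pow)
  have "eucl_dist d u = eucl_dist d (restrict u {..<d})"
    by (rule ext) (simp add: eucl_dist_def)
  then have m: "eucl_dist d u \<in> borel_measurable (lebesgue_pow d)"
    using us by simp
  have "lens d u = (\<integral>\<^sup>+v. indicator {v. nrm d v \<le> nrm d u \<and> eucl_dist d u v \<le> nrm d u} (householder d w v) \<partial>lebesgue_pow d)"
    unfolding lens_def by (rule nn_integral_householder[symmetric, OF _ w0]) (use m in measurable)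
  also have "\<dots> = lens d u'"
    unfolding lens_def using assms by (intro nn_integral_cong) (simp add: e e' indicator_def)
  finally show ?thesis .
qed

lemma lens_scale:
  assumes "\<rho> > 0"
  shows "lens d (aff d \<rho> (\<lambda>_. 0) u) = ennreal (\<rho> ^ d) * lens d u"
proof -
  let ?s = "aff d \<rho> (\<lambda>_. 0)"
  have "lens d (?s u) = ennreal (\<bar>\<rho>\<bar> ^ d) *
    (\<integral>\<^sup>+v. indicator {v. nrm d v \<le> nrm d (?s u) \<and> eucl_dist d (?s u) v \<le> nrm d (?s u)} (?s v) \<partial>lebesgue_pow d)"
    unfolding lens_def using assms by (intro nn_integral_affine) auto
  also have "(\<integral>\<^sup>+v. indicator {v. nrm d v \<le> nrm d (?s u) \<and> eucl_dist d (?s u) v \<le> nrm d (?s u)} (?s v) \<partial>lebesgue_pow d) = lens d u"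
    unfolding lens_def using assms
    by (intro nn_integral_cong) (auto simp: indicator_def nrm_aff_scale eucl_dist_aff_scale)
  finally show ?thesis using assms by simp
qed

text \<open>The last axis is chosen because slicing \<open>lebesgue_pow (Suc m)\<close> splits off
  coordinate m.\<close>

definition last_unit :: "nat \<Rightarrow> nat \<Rightarrow> real" where
  "last_unit d = (\<lambda>k\<in>{..<d}. if Suc k = d then 1 else 0)"

lemma nrm_last_unit: "d \<ge> 1 \<Longrightarrow> nrm d (last_unit d) = 1"
  by (cases d) (auto simp: L2_set_def last_unit_def lessThan_Suc)

text \<open>Rotation onto a multiple of \<open>last_unit d\<close>, followed by scaling, separates
  the radial dependence from a single constant.\<close>

lemma lens_eq:
  assumes d: "d \<ge> 1" and u: "nrm d u > 0"
  shows "lens d u = ennreal (nrm d u ^ d) * lens d (last_unit d)"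
proof -
  have "nrm d u = nrm d (aff d (nrm d u) (\<lambda>_. 0) (last_unit d))"
    by (simp add: nrm_aff_scale nrm_last_unit[OF d])
  from lens_rotate[OF this] show ?thesis
    using lens_scale[OF u] by simp
qed

section \<open>Slicing along the last coordinate, and null sets\<close>

lemma nn_integral_lebesgue_pow_Suc:
  assumes "F \<in> borel_measurable (lebesgue_pow (Suc m))"
  shows "(\<integral>\<^sup>+x. F x \<partial>lebesgue_pow (Suc m)) =
         (\<integral>\<^sup>+t. (\<integral>\<^sup>+x. F (x(m := t)) \<partial>lebesgue_pow m) \<partial>lborel)"
  using lb.product_nn_integral_insert_rev[of "{..<m}" m F] assms
  unfolding lebesgue_pow_def lessThan_Suc by simp

lemma nn_integral_lebesgue_pow_Suc':
  assumes "F \<in> borel_measurable (lebesgue_pow (Suc m))"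
  shows "(\<integral>\<^sup>+x. F x \<partial>lebesgue_pow (Suc m)) =
         (\<integral>\<^sup>+x. (\<integral>\<^sup>+t. F (x(m := t)) \<partial>lborel) \<partial>lebesgue_pow m)"
  using lb.product_nn_integral_insert[of "{..<m}" m F] assms
  unfolding lebesgue_pow_def lessThan_Suc by simp

lemma nrm_upd: "nrm (Suc m) (x(m := t)) = sqrt ((nrm m x)\<^sup>2 + t\<^sup>2)"
  by (simp add: L2_set_def sum_nonneg)

lemma eucl_dist_last_unit_upd:
  "eucl_dist (Suc m) (last_unit (Suc m)) (x(m := t)) = sqrt ((nrm m x)\<^sup>2 + (1 - t)\<^sup>2)"
  by (simp add: eucl_dist_def L2_set_def sum_nonneg last_unit_def)

text \<open>A line parallel to the last axis meets a sphere in at most two points, so Fubini with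
  the last coordinate innermost gives measure zero. In dimension 0 the space is a single point of
  norm 0 and positive measure, which is why d >= 1 is required.\<close>

lemma AE_nrm_neq:
  assumes "d \<ge> 1"
  shows "AE x in lebesgue_pow d. nrm d x \<noteq> \<rho>"
proof -
  obtain m where m: "d = Suc m" using assms by (cases d) auto
  let ?F = "\<lambda>x. indicator {x. nrm d x = \<rho>} x :: ennreal"
  have "(\<integral>\<^sup>+x. ?F x \<partial>lebesgue_pow d) = (\<integral>\<^sup>+x. (\<integral>\<^sup>+t. ?F (x(m := t)) \<partial>lborel) \<partial>lebesgue_pow m)"
    unfolding m by (rule nn_integral_lebesgue_pow_Suc') measurable
  also have "\<dots> = (\<integral>\<^sup>+x. 0 \<partial>lebesgue_pow m)"
  proof (intro nn_integral_cong)
    fix x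
    let ?c = "\<rho>\<^sup>2 - (nrm m x)\<^sup>2"
    have "{t. nrm d (x(m := t)) = \<rho>} \<subseteq> {sqrt ?c, - sqrt ?c}"
    proof
      fix t assume "t \<in> {t. nrm d (x(m := t)) = \<rho>}"
      then have "sqrt ((nrm m x)\<^sup>2 + t\<^sup>2) = \<rho>" by (simp add: m nrm_upd)
      then have "t\<^sup>2 = ?c" by auto
      then have "\<bar>t\<bar> = sqrt ?c" by (metis real_sqrt_abs)
      then show "t \<in> {sqrt ?c, - sqrt ?c}" by auto
    qed
    then have "finite {t. nrm d (x(m := t)) = \<rho>}" by (rule finite_subset) simp
    then have "AE t in lborel. t \<notin> {t. nrm d (x(m := t)) = \<rho>}"
      by (intro AE_not_in finite_imp_null_set_lborel)
    then have "AE t in lborel. ?F (x(m := t)) = 0"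
      by eventually_elim (simp add: indicator_def)
    then show "(\<integral>\<^sup>+t. ?F (x(m := t)) \<partial>lborel) = 0"
      using nn_integral_cong_AE[of "\<lambda>t. ?F (x(m := t))" "\<lambda>_. 0" lborel] by simp
  qed
  finally have "AE x in lebesgue_pow d. ?F x = 0"
    using nn_integral_0_iff_AE[of ?F "lebesgue_pow d"] by simp
  then show ?thesis by eventually_elim (auto simp: indicator_def)
qed

definition tri_vol :: "nat \<Rightarrow> ennreal" where
  "tri_vol d = (\<integral>\<^sup>+u. (\<integral>\<^sup>+v. indicator {v. nrm d u \<le> 1 \<and> nrm d v \<le> 1 \<and> eucl_dist d u v \<le> 1} v
     \<partial>lebesgue_pow d) \<partial>lebesgue_pow d)"

lemma AE_eucl_dist_neq:
  assumes "d \<ge> 1" and u: "u \<in> space (lebesgue_pow d)"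
  shows "AE v in lebesgue_pow d. eucl_dist d u v \<noteq> \<rho>"
proof -
  let ?L = "lebesgue_pow d" and ?F = "\<lambda>v. indicator {v. nrm d v = \<rho>} v :: ennreal"
  have [simp]: "nrm d (aff d (-1) u v) = eucl_dist d u v" for v
    by (simp add: eucl_dist_def L2_set_def)
  have "(\<integral>\<^sup>+v. ?F (aff d (-1) u v) \<partial>?L) = (\<integral>\<^sup>+v. ?F v \<partial>?L)"
    by (rule nn_integral_reflect) measurable
  also have "\<dots> = (\<integral>\<^sup>+v. 0 \<partial>?L)"
    using AE_nrm_neq[OF assms(1), of \<rho>]
    by (intro nn_integral_cong_AE) (auto simp: indicator_def)
  finally have "AE v in ?L. ?F (aff d (-1) u v) = 0"
    using u by (subst nn_integral_0_iff_AE[symmetric]) auto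
  then show ?thesis by eventually_elim (auto simp: indicator_def)
qed

lemma AE_nrm_ne_nrm:
  assumes "d \<ge> 1"
  shows "AE u in lebesgue_pow d. AE v in lebesgue_pow d.
     nrm d u \<noteq> nrm d v \<and> nrm d u \<noteq> eucl_dist d u v \<and> nrm d v \<noteq> eucl_dist d u v"
proof -
  let ?L = "lebesgue_pow d"
  \<comment> \<open>For fixed u this tie confines v to a bisecting hyperplane, which the sphere
    lemmas do not cover. For fixed v it confines u to a sphere around v, so the order of the
    quantifiers is exchanged.\<close>
  have "AE v in ?L. AE u in ?L. nrm d v \<noteq> eucl_dist d u v"
  proof (rule AE_I2)
    fix v assume "v \<in> space ?L"
    from AE_eucl_dist_neq[OF assms this, of "nrm d v"]
    show "AE u in ?L. nrm d v \<noteq> eucl_dist d u v"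
      by eventually_elim (simp add: eucl_dist_commute)
  qed
  then have "AE u in ?L. AE v in ?L. nrm d v \<noteq> eucl_dist d u v"
    by (subst lp2.AE_commute) measurable
  then show ?thesis
    using AE_space
  proof eventually_elim
    case (elim u)
    from elim(1) AE_nrm_neq[OF assms, of "nrm d u"] AE_eucl_dist_neq[OF assms elim(2), of "nrm d u"]
    show ?case by eventually_elim auto
  qed
qed

text \<open>Any one of the three sides is equally likely to be the longest, and ties are negligible.\<close>

lemma tri_vol_longest:
  assumes "d \<ge> 1"
  shows "tri_vol d = 3 * (\<integral>\<^sup>+u. indicator {u. nrm d u \<le> 1} u * lens d u \<partial>lebesgue_pow d)"
proof -
  let ?L = "lebesgue_pow d"
  \<comment> \<open>\<open>E1\<close>, \<open>E2\<close> and \<open>E3\<close> mark the longest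
    side: from 0 to u, from 0 to v, and from u to v. Ties are counted more than once, so the
    decomposition holds only almost everywhere.\<close>
  define E1 where "E1 = (\<lambda>u v. (if nrm d u \<le> 1 \<and> nrm d v \<le> nrm d u \<and> eucl_dist d u v \<le> nrm d u then 1 else 0) :: ennreal)"
  define E2 where "E2 = (\<lambda>u v. E1 v u)"
  define E3 where "E3 = (\<lambda>u v. (if eucl_dist d u v \<le> 1 \<and> nrm d u \<le> eucl_dist d u v \<and> nrm d v \<le> eucl_dist d u v then 1 else 0) :: ennreal)"
  have m1 [measurable]: "case_prod E1 \<in> borel_measurable (?L \<Otimes>\<^sub>M ?L)"
    and m2 [measurable]: "case_prod E2 \<in> borel_measurable (?L \<Otimes>\<^sub>M ?L)"
    and m3 [measurable]: "case_prod E3 \<in> borel_measurable (?L \<Otimes>\<^sub>M ?L)"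
    unfolding E1_def E2_def E3_def by (simp_all add: split_beta')
  have eq2: "(\<integral>\<^sup>+u. (\<integral>\<^sup>+v. E2 u v \<partial>?L) \<partial>?L) = (\<integral>\<^sup>+u. (\<integral>\<^sup>+v. E1 u v \<partial>?L) \<partial>?L)"
    unfolding E2_def by (rule lp2.Fubini') measurable
  \<comment> \<open>The map from v to u - v is the point reflection in the midpoint of the side from
    0 to u. It exchanges the lengths |v| and |u - v| and so turns \<open>E3\<close> into
    \<open>E2\<close>.\<close>
  have eq3: "(\<integral>\<^sup>+u. (\<integral>\<^sup>+v. E3 u v \<partial>?L) \<partial>?L) = (\<integral>\<^sup>+u. (\<integral>\<^sup>+v. E1 u v \<partial>?L) \<partial>?L)"
  proof -
    have "(\<integral>\<^sup>+v. E3 u v \<partial>?L) = (\<integral>\<^sup>+v. E1 v u \<partial>?L)" if u: "u \<in> space ?L" for u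
    proof -
      have "(\<integral>\<^sup>+v. E3 u v \<partial>?L) = (\<integral>\<^sup>+v. E3 u (aff d (-1) u v) \<partial>?L)"
        using u by (intro nn_integral_reflect[symmetric]) measurable
      also have "\<dots> = (\<integral>\<^sup>+v. E1 v u \<partial>?L)"
      proof (intro nn_integral_cong)
        fix v
        have "eucl_dist d u (aff d (-1) u v) = nrm d v"
          by (simp add: eucl_dist_def L2_set_def)
        moreover have "nrm d (aff d (-1) u v) = eucl_dist d v u"
          by (simp add: eucl_dist_def L2_set_def power2_commute)
        ultimately show "E3 u (aff d (-1) u v) = E1 v u"
          by (auto simp: E1_def E3_def)
      qed
      finally show ?thesis .
    qed
    then have "(\<integral>\<^sup>+u. (\<integral>\<^sup>+v. E3 u v \<partial>?L) \<partial>?L) = (\<integral>\<^sup>+u. (\<integral>\<^sup>+v. E2 u v \<partial>?L) \<partial>?L)"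
      unfolding E2_def by (rule nn_integral_cong)
    then show ?thesis using eq2 by simp
  qed
  have "tri_vol d = (\<integral>\<^sup>+u. (\<integral>\<^sup>+v. E1 u v + E2 u v + E3 u v \<partial>?L) \<partial>?L)"
    unfolding tri_vol_def
  proof (rule nn_integral_cong_AE)
    show "AE u in ?L. (\<integral>\<^sup>+v. indicator {v. nrm d u \<le> 1 \<and> nrm d v \<le> 1 \<and> eucl_dist d u v \<le> 1} v \<partial>?L)
        = (\<integral>\<^sup>+v. E1 u v + E2 u v + E3 u v \<partial>?L)"
      using AE_nrm_ne_nrm[OF assms]
    proof eventually_elim
      case (elim u)
      show ?case
      proof (rule nn_integral_cong_AE)
        show "AE v in ?L. indicator {v. nrm d u \<le> 1 \<and> nrm d v \<le> 1 \<and> eucl_dist d u v \<le> 1} v = E1 u v + E2 u v + E3 u v"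
          using elim by eventually_elim
            (auto simp: E1_def E2_def E3_def indicator_def eucl_dist_commute)
      qed
    qed
  qed
  also have "\<dots> = (\<integral>\<^sup>+u. (\<integral>\<^sup>+v. E1 u v \<partial>?L) \<partial>?L) + (\<integral>\<^sup>+u. (\<integral>\<^sup>+v. E2 u v \<partial>?L) \<partial>?L) + (\<integral>\<^sup>+u. (\<integral>\<^sup>+v. E3 u v \<partial>?L) \<partial>?L)"
    by (simp add: nn_integral_add cong: nn_integral_cong)
  also have "\<dots> = 3 * (\<integral>\<^sup>+u. (\<integral>\<^sup>+v. E1 u v \<partial>?L) \<partial>?L)"
  proof -
    have "x + x + x = 3 * x" for x :: ennreal
    proof -
      have "(3::ennreal) = 1 + 1 + 1" by simp
      then show ?thesis by (simp only: distrib_right mult_1)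
    qed
    then show ?thesis unfolding eq2 eq3 .
  qed
  also have "(\<integral>\<^sup>+u. (\<integral>\<^sup>+v. E1 u v \<partial>?L) \<partial>?L) = (\<integral>\<^sup>+u. indicator {u. nrm d u \<le> 1} u * lens d u \<partial>?L)"
  proof (intro nn_integral_cong)
    fix u assume u: "u \<in> space ?L"
    have "(\<integral>\<^sup>+v. E1 u v \<partial>?L) = (\<integral>\<^sup>+v. indicator {u. nrm d u \<le> 1} u * indicator {v. nrm d v \<le> nrm d u \<and> eucl_dist d u v \<le> nrm d u} v \<partial>?L)"
      by (intro nn_integral_cong) (auto simp: E1_def indicator_def)
    also have "\<dots> = indicator {u. nrm d u \<le> 1} u * lens d u"
      unfolding lens_def using u by (intro nn_integral_cmult) measurable
    finally show "(\<integral>\<^sup>+v. E1 u v \<partial>?L) = indicator {u. nrm d u \<le> 1} u * lens d u" .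
  qed
  finally show ?thesis .
qed

text \<open>By \<open>ball_vol_scale\<close>, |u|^d times the volume V of the unit ball is the
  volume of the v with |v| <= |u|. So V times the integral measures the pairs with |v| <= |u| <= 1,
  which by symmetry are half of all pairs in the unit ball.\<close>

lemma nn_integral_nrm_power:
  assumes "d \<ge> 1"
  shows "2 * (\<integral>\<^sup>+u. indicator {u. nrm d u \<le> 1} u * ennreal (nrm d u ^ d) \<partial>lebesgue_pow d) = ball_vol d 1"
proof -
  let ?L = "lebesgue_pow d"
  define E where "E = (\<lambda>u v. (if nrm d u \<le> 1 \<and> nrm d v \<le> nrm d u then 1 else 0) :: ennreal)"
  have m [measurable]: "case_prod E \<in> borel_measurable (?L \<Otimes>\<^sub>M ?L)"
    unfolding E_def by (simp add: split_beta')
  let ?I = "(\<integral>\<^sup>+u. indicator {u. nrm d u \<le> 1} u * ennreal (nrm d u ^ d) \<partial>?L)"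
  have bv: "ball_vol d (nrm d u) = ennreal (nrm d u ^ d) * ball_vol d 1" if "nrm d u \<noteq> 0" for u
    using that by (intro ball_vol_scale) (simp add: less_le)
  have "(\<integral>\<^sup>+u. (\<integral>\<^sup>+v. E u v \<partial>?L) \<partial>?L) = (\<integral>\<^sup>+u. (indicator {u. nrm d u \<le> 1} u * ennreal (nrm d u ^ d)) * ball_vol d 1 \<partial>?L)"
  proof (rule nn_integral_cong_AE)
    show "AE u in ?L. (\<integral>\<^sup>+v. E u v \<partial>?L) = (indicator {u. nrm d u \<le> 1} u * ennreal (nrm d u ^ d)) * ball_vol d 1"
      using AE_nrm_neq[OF assms, of 0]
    proof eventually_elim
      case (elim u)
      have "(\<integral>\<^sup>+v. E u v \<partial>?L) = (\<integral>\<^sup>+v. indicator {u. nrm d u \<le> 1} u * indicator {v. nrm d v \<le> nrm d u} v \<partial>?L)"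
        by (intro nn_integral_cong) (auto simp: E_def indicator_def)
      also have "\<dots> = indicator {u. nrm d u \<le> 1} u * ball_vol d (nrm d u)"
        unfolding ball_vol_nn by (intro nn_integral_cmult) measurable
      finally show ?case by (simp add: bv[OF elim] mult.assoc)
    qed
  qed
  then have "(\<integral>\<^sup>+u. (\<integral>\<^sup>+v. E u v \<partial>?L) \<partial>?L) = ?I * ball_vol d 1"
    by (simp add: nn_integral_multc)
  moreover have "(\<integral>\<^sup>+u. (\<integral>\<^sup>+v. E v u \<partial>?L) \<partial>?L) = (\<integral>\<^sup>+u. (\<integral>\<^sup>+v. E u v \<partial>?L) \<partial>?L)"
    by (rule lp2.Fubini') measurable
  moreover have "(\<integral>\<^sup>+u. (\<integral>\<^sup>+v. E u v + E v u \<partial>?L) \<partial>?L) = ball_vol d 1 * ball_vol d 1"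
  proof -
    have "(\<integral>\<^sup>+u. (\<integral>\<^sup>+v. E u v + E v u \<partial>?L) \<partial>?L) =
       (\<integral>\<^sup>+u. (\<integral>\<^sup>+v. indicator {u. nrm d u \<le> 1} u * indicator {u. nrm d u \<le> 1} v \<partial>?L) \<partial>?L)"
    proof (rule nn_integral_cong_AE)
      show "AE u in ?L. (\<integral>\<^sup>+v. E u v + E v u \<partial>?L) =
       (\<integral>\<^sup>+v. indicator {u. nrm d u \<le> 1} u * indicator {u. nrm d u \<le> 1} v \<partial>?L)"
        using AE_nrm_ne_nrm[OF assms]
      proof eventually_elim
        case (elim u)
        show ?case
        proof (rule nn_integral_cong_AE)
          show "AE v in ?L. E u v + E v u = indicator {u. nrm d u \<le> 1} u * indicator {u. nrm d u \<le> 1} v"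
            using elim by eventually_elim (auto simp: E_def indicator_def)
        qed
      qed
    qed
    also have "\<dots> = ball_vol d 1 * ball_vol d 1"
      by (simp add: nn_integral_cmult nn_integral_multc flip: ball_vol_nn)
    finally show ?thesis .
  qed
  moreover have "(\<integral>\<^sup>+u. (\<integral>\<^sup>+v. E u v + E v u \<partial>?L) \<partial>?L) = (\<integral>\<^sup>+u. (\<integral>\<^sup>+v. E u v \<partial>?L) \<partial>?L) + (\<integral>\<^sup>+u. (\<integral>\<^sup>+v. E v u \<partial>?L) \<partial>?L)"
    by (simp add: nn_integral_add cong: nn_integral_cong)
  ultimately have "(2 * ?I) * ball_vol d 1 = ball_vol d 1 * ball_vol d 1"
    by (simp add: mult_2 algebra_simps)
  then show ?thesis
    by (rule ennreal_cancel_right) (simp_all add: ball_vol_pos ball_vol_finite)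
qed

text \<open>The 3 comes from the choice of the longest side. The 2 comes from the radial factor
  |u|^d of \<open>lens_eq\<close>, which integrates to half of the ball volume.\<close>

lemma tri_vol_lens:
  assumes "d \<ge> 1"
  shows "2 * tri_vol d = 3 * lens d (last_unit d) * ball_vol d 1"
proof -
  let ?L = "lebesgue_pow d"
  let ?I = "(\<integral>\<^sup>+u. indicator {u. nrm d u \<le> 1} u * ennreal (nrm d u ^ d) \<partial>?L)"
  have "(\<integral>\<^sup>+u. indicator {u. nrm d u \<le> 1} u * lens d u \<partial>?L) =
      (\<integral>\<^sup>+u. (indicator {u. nrm d u \<le> 1} u * ennreal (nrm d u ^ d)) * lens d (last_unit d) \<partial>?L)"
  proof (rule nn_integral_cong_AE)
    show "AE u in ?L. indicator {u. nrm d u \<le> 1} u * lens d u =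
       (indicator {u. nrm d u \<le> 1} u * ennreal (nrm d u ^ d)) * lens d (last_unit d)"
      using AE_nrm_neq[OF assms, of 0]
    proof eventually_elim
      case (elim u)
      then have "nrm d u > 0" by (simp add: less_le)
      from lens_eq[OF assms this] show ?case by (simp add: mult.assoc)
    qed
  qed
  also have "\<dots> = ?I * lens d (last_unit d)"
    by (rule nn_integral_multc) measurable
  finally have "2 * tri_vol d = 3 * lens d (last_unit d) * (2 * ?I)"
    unfolding tri_vol_longest[OF assms] by (simp add: algebra_simps)
  then show ?thesis by (simp add: nn_integral_nrm_power[OF assms])
qed

section \<open>The limiting clustering coefficient\<close>

text \<open>With m = d - 1, the integrand is the scale factor of the slice of the unit ball at
  height t, an m-ball of radius sqrt (1 - t^2). The height 1/2 is that of the hyperplane bisecting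
  the segment from 0 to the unit vector, the symmetry plane of the lens.\<close>

definition cap_far :: "nat \<Rightarrow> ennreal" where
  "cap_far m = (\<integral>\<^sup>+t. indicator {1/2..1} t * ennreal (sqrt (1 - t\<^sup>2) ^ m) \<partial>lborel)"

definition cap_near :: "nat \<Rightarrow> ennreal" where
  "cap_near m = (\<integral>\<^sup>+t. indicator {0..1/2} t * ennreal (sqrt (1 - t\<^sup>2) ^ m) \<partial>lborel)"

text \<open>Negative \<open>s\<close> must be separated: even powers of \<open>sqrt s\<close>, the
  power 0 included, are positive there although the set is empty.\<close>

lemma nn_integral_nrm_sq_le:
  shows "s > 0 \<Longrightarrow> (\<integral>\<^sup>+x. indicator {x. (nrm m x)\<^sup>2 \<le> s} x \<partial>lebesgue_pow m) = ennreal (sqrt s ^ m) * ball_vol m 1"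
    and "s < 0 \<Longrightarrow> (\<integral>\<^sup>+x. indicator {x. (nrm m x)\<^sup>2 \<le> s} x \<partial>lebesgue_pow m) = 0"
proof -
  assume s: "s > 0"
  have "(nrm m x)\<^sup>2 \<le> s \<longleftrightarrow> nrm m x \<le> sqrt s" for x
    using s by (metis L2_set_nonneg real_le_rsqrt real_sqrt_le_iff real_sqrt_abs abs_of_nonneg)
  then show "(\<integral>\<^sup>+x. indicator {x. (nrm m x)\<^sup>2 \<le> s} x \<partial>lebesgue_pow m) = ennreal (sqrt s ^ m) * ball_vol m 1"
    using ball_vol_scale[of "sqrt s" m] s by (simp add: ball_vol_nn)
next
  assume "s < 0"
  then have "\<not> (nrm m x)\<^sup>2 \<le> s" for x
    using zero_le_power2[of "nrm m x"] by linarith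
  then show "(\<integral>\<^sup>+x. indicator {x. (nrm m x)\<^sup>2 \<le> s} x \<partial>lebesgue_pow m) = 0"
    by (simp add: indicator_def)
qed

lemma AE_lborel_notin_finite: "finite S \<Longrightarrow> AE t in lborel. (t::real) \<notin> S"
  by (intro AE_not_in finite_imp_null_set_lborel)

lemma nn_integral_lborel_reflect:
  assumes "g \<in> borel_measurable borel"
  shows "(\<integral>\<^sup>+t. g (a - t) \<partial>lborel) = (\<integral>\<^sup>+t. g (t::real) \<partial>lborel)"
  using nn_integral_real_affine[OF assms, of "-1" a] by simp

text \<open>The slice at height t is an m-ball of squared radius min (1 - t^2) (1 - (1 - t)^2). The
  first term is the smaller one above 1/2, the second below, and replacing t by 1 - t exchanges the
  two halves.\<close>

lemma lens_cap: "lens (Suc m) (last_unit (Suc m)) = 2 * cap_far m * ball_vol m 1"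
proof -
  let ?e = "last_unit (Suc m)" and ?L = "lebesgue_pow m"
  have e: "?e \<in> space (lebesgue_pow (Suc m))" by (simp add: last_unit_def space_lebesgue_pow)
  let ?g = "\<lambda>t. indicator {1/2..1} t * ennreal (sqrt (1 - t\<^sup>2) ^ m)"
  have "lens (Suc m) ?e = (\<integral>\<^sup>+v. indicator {v. nrm (Suc m) v \<le> 1 \<and> eucl_dist (Suc m) ?e v \<le> 1} v \<partial>lebesgue_pow (Suc m))"
    by (simp add: lens_def nrm_last_unit)
  also have "\<dots> = (\<integral>\<^sup>+t. (\<integral>\<^sup>+x. indicator {v. nrm (Suc m) v \<le> 1 \<and> eucl_dist (Suc m) ?e v \<le> 1} (x(m := t)) \<partial>?L) \<partial>lborel)"
    by (rule nn_integral_lebesgue_pow_Suc) (use e in measurable)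
  also have "\<dots> = (\<integral>\<^sup>+t. (\<integral>\<^sup>+x. indicator {x. (nrm m x)\<^sup>2 \<le> min (1 - t\<^sup>2) (1 - (1 - t)\<^sup>2)} x \<partial>?L) \<partial>lborel)"
    by (intro nn_integral_cong) (auto simp: indicator_def nrm_upd eucl_dist_last_unit_upd algebra_simps)
  also have "\<dots> = (\<integral>\<^sup>+t. (?g t + ?g (1 - t)) * ball_vol m 1 \<partial>lborel)"
  proof (rule nn_integral_cong_AE)
    \<comment> \<open>At 1/2 both indicators equal 1, and at 0 and 1 the squared radius vanishes.
      These heights form a null set and are left out of the strict case analysis.\<close>
    have "AE t in lborel. (t::real) \<notin> {0, 1/2, 1}" by (rule AE_lborel_notin_finite) simp
    then show "AE t in lborel. (\<integral>\<^sup>+x. indicator {x. (nrm m x)\<^sup>2 \<le> min (1 - t\<^sup>2) (1 - (1 - t)\<^sup>2)} x \<partial>?L)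
        = (?g t + ?g (1 - t)) * ball_vol m 1"
    proof eventually_elim
      case (elim t)
      have f: "1 - t\<^sup>2 = (1 - t) * (1 + t)" "1 - (1 - t)\<^sup>2 = t * (2 - t)"
        "(1 - (1 - t)\<^sup>2) - (1 - t\<^sup>2) = 2 * t - 1"
        by (simp_all add: power2_eq_square algebra_simps)
      consider "t < 0" | "0 < t" "t < 1/2" | "1/2 < t" "t < 1" | "1 < t"
        using elim by fastforce
      then show ?case
      proof cases
        case 1
        then have "min (1 - t\<^sup>2) (1 - (1 - t)\<^sup>2) < 0"
          unfolding f by (simp add: min_less_iff_disj mult_neg_pos)
        with 1 show ?thesis by (simp add: nn_integral_nrm_sq_le(2) del: min_less_iff_conj min.bounded_iff)
      next
        case 2
        then have "min (1 - t\<^sup>2) (1 - (1 - t)\<^sup>2) = 1 - (1 - t)\<^sup>2" "1 - (1 - t)\<^sup>2 > 0"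
          using f(3) unfolding f(2) by (auto simp: min_def)
        with 2 show ?thesis by (simp add: nn_integral_nrm_sq_le(1))
      next
        case 3
        then have "min (1 - t\<^sup>2) (1 - (1 - t)\<^sup>2) = 1 - t\<^sup>2" "1 - t\<^sup>2 > 0"
          using f(3) unfolding f(1) by (auto simp: min_def)
        with 3 show ?thesis by (simp add: nn_integral_nrm_sq_le(1))
      next
        case 4
        then have "min (1 - t\<^sup>2) (1 - (1 - t)\<^sup>2) < 0"
          unfolding f by (simp add: min_less_iff_disj mult_neg_pos)
        with 4 show ?thesis by (simp add: nn_integral_nrm_sq_le(2) del: min_less_iff_conj min.bounded_iff)
      qed
    qed
  qed
  also have "\<dots> = ((\<integral>\<^sup>+t. ?g t \<partial>lborel) + (\<integral>\<^sup>+t. ?g (1 - t) \<partial>lborel)) * ball_vol m 1"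
    by (simp add: nn_integral_multc nn_integral_add)
  also have "(\<integral>\<^sup>+t. ?g (1 - t) \<partial>lborel) = (\<integral>\<^sup>+t. ?g t \<partial>lborel)"
    by (rule nn_integral_lborel_reflect) measurable
  finally show ?thesis by (simp add: cap_far_def mult_2)
qed

text \<open>Slices at t and -t agree. The upper half is cut at 1/2 to expose the integrals of
  \<open>lens_cap\<close>, with the same factor \<open>ball_vol m 1\<close>.\<close>

lemma ball_vol_cap: "ball_vol (Suc m) 1 = 2 * (cap_far m + cap_near m) * ball_vol m 1"
proof -
  let ?L = "lebesgue_pow m"
  let ?g = "\<lambda>t. indicator {1/2..1} t * ennreal (sqrt (1 - t\<^sup>2) ^ m) + indicator {0..1/2} t * ennreal (sqrt (1 - t\<^sup>2) ^ m)"
  have m2: "?g \<in> borel_measurable lborel" and m3: "(\<lambda>t. ?g (0 - t)) \<in> borel_measurable lborel"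
    by measurable
  then have m1: "(\<lambda>t. ?g t + ?g (0 - t)) \<in> borel_measurable lborel"
    by (rule borel_measurable_add)
  have "ball_vol (Suc m) 1 = (\<integral>\<^sup>+t. (\<integral>\<^sup>+x. indicator {v. nrm (Suc m) v \<le> 1} (x(m := t)) \<partial>?L) \<partial>lborel)"
    unfolding ball_vol_nn by (rule nn_integral_lebesgue_pow_Suc) measurable
  also have "\<dots> = (\<integral>\<^sup>+t. (\<integral>\<^sup>+x. indicator {x. (nrm m x)\<^sup>2 \<le> 1 - t\<^sup>2} x \<partial>?L) \<partial>lborel)"
    by (intro nn_integral_cong) (auto simp: indicator_def nrm_upd algebra_simps)
  also have "\<dots> = (\<integral>\<^sup>+t. (?g t + ?g (0 - t)) * ball_vol m 1 \<partial>lborel)"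
  proof (rule nn_integral_cong_AE)
    have "AE t in lborel. (t::real) \<notin> {0, 1/2, 1, -1/2, -1}" by (rule AE_lborel_notin_finite) simp
    then show "AE t in lborel. (\<integral>\<^sup>+x. indicator {x. (nrm m x)\<^sup>2 \<le> 1 - t\<^sup>2} x \<partial>?L)
        = (?g t + ?g (0 - t)) * ball_vol m 1"
    proof eventually_elim
      case (elim t)
      have f: "1 - t\<^sup>2 = (1 - t) * (1 + t)"
        by (simp_all add: power2_eq_square algebra_simps)
      consider "t < -1 \<or> 1 < t" | "-1 < t" "t < 1"
        using elim by fastforce
      then show ?case
      proof cases
        case 1
        then have "1 - t\<^sup>2 < 0"
          unfolding f by (auto simp: mult_less_0_iff)
        moreover have "?g t = 0" "?g (0 - t) = 0" using 1 by (auto simp: indicator_def)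
        ultimately show ?thesis by (simp add: nn_integral_nrm_sq_le(2))
      next
        case 2
        then have p: "1 - t\<^sup>2 > 0"
          unfolding f by auto
        have "?g t + ?g (0 - t) = ennreal (sqrt (1 - t\<^sup>2) ^ m)"
          using 2 elim by (auto simp: indicator_def)
        then show ?thesis by (simp only: nn_integral_nrm_sq_le(1)[OF p])
      qed
    qed
  qed
  also have "\<dots> = ((\<integral>\<^sup>+t. ?g t \<partial>lborel) + (\<integral>\<^sup>+t. ?g (0 - t) \<partial>lborel)) * ball_vol m 1"
    by (simp only: nn_integral_multc[OF m1] nn_integral_add[OF m2 m3])
  also have "(\<integral>\<^sup>+t. ?g (0 - t) \<partial>lborel) = (\<integral>\<^sup>+t. ?g t \<partial>lborel)"
    by (rule nn_integral_lborel_reflect) measurable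
  also have "(\<integral>\<^sup>+t. ?g t \<partial>lborel) = cap_far m + cap_near m"
    unfolding cap_far_def cap_near_def by (rule nn_integral_add) measurable
  finally show ?thesis by (simp add: mult_2 add_ac)
qed

lemma nn_integral_indicator_const_Icc:
  "a \<le> b \<Longrightarrow> (\<integral>\<^sup>+t. indicator {a..b} t * c \<partial>lborel) = ennreal (b - a) * c" for a b :: real
  by (simp add: nn_integral_multc)

lemma sqrt_power_le_1: "t \<in> {0..1} \<Longrightarrow> sqrt (1 - t\<^sup>2) ^ m \<le> 1" for t :: real
  by (intro power_le_one) (auto simp: power_le_one)

lemma cap_finite: "cap_far m < top" "cap_near m < top"
proof -
  have "cap_far m \<le> (\<integral>\<^sup>+t. indicator {1/2..1::real} t * 1 \<partial>lborel)"
    unfolding cap_far_def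
    by (intro nn_integral_mono) (auto simp: indicator_def intro!: sqrt_power_le_1)
  also have "\<dots> = ennreal (1/2) * 1"
    by (subst nn_integral_indicator_const_Icc) auto
  also have "\<dots> < top"
    by (simp only: mult_1_right ennreal_less_top)
  finally show "cap_far m < top" .
  have "cap_near m \<le> (\<integral>\<^sup>+t. indicator {0..1/2::real} t * 1 \<partial>lborel)"
    unfolding cap_near_def
    by (intro nn_integral_mono) (auto simp: indicator_def intro!: sqrt_power_le_1)
  also have "\<dots> = ennreal (1/2) * 1"
    by (subst nn_integral_indicator_const_Icc) auto
  also have "\<dots> < top"
    by (simp only: mult_1_right ennreal_less_top)
  finally show "cap_near m < top" .
qed

lemma cap_far_pos: "cap_far m > 0"
proof -
  \<comment> \<open>On [1/2, 3/4] the value 1 - t^2 is at least 1 - 9/16 = 7/16, so the integrand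
    stays away from 0.\<close>
  have "0 < ennreal (3/4 - 1/2) * ennreal (sqrt (7/16) ^ m)"
    by (simp add: ennreal_zero_less_mult_iff)
  also have "\<dots> = (\<integral>\<^sup>+t. indicator {1/2..3/4::real} t * ennreal (sqrt (7/16) ^ m) \<partial>lborel)"
    by (subst nn_integral_indicator_const_Icc) auto
  also have "\<dots> \<le> cap_far m"
    unfolding cap_far_def
  proof (intro nn_integral_mono)
    fix t :: real
    have "sqrt (7/16) ^ m \<le> sqrt (1 - t\<^sup>2) ^ m" if "t \<in> {1/2..3/4}"
    proof (intro power_mono)
      have "t\<^sup>2 \<le> (3/4)\<^sup>2" using that by (intro power_mono) auto
      then show "sqrt (7/16) \<le> sqrt (1 - t\<^sup>2)" by (simp add: power2_eq_square)
    qed simp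
    then show "indicator {1/2..3/4} t * ennreal (sqrt (7/16) ^ m) \<le> indicator {1/2..1} t * ennreal (sqrt (1 - t\<^sup>2) ^ m)"
      by (auto simp: indicator_def intro!: ennreal_leI)
  qed
  finally show ?thesis .
qed

lemma cap_far_Suc_le: "cap_far (Suc m) \<le> ennreal (sqrt (3/4)) * cap_far m"
proof -
  have "cap_far (Suc m) \<le> (\<integral>\<^sup>+t. ennreal (sqrt (3/4)) * (indicator {1/2..1} t * ennreal (sqrt (1 - t\<^sup>2) ^ m)) \<partial>lborel)"
    unfolding cap_far_def
  proof (intro nn_integral_mono)
    fix t :: real
    have "sqrt (1 - t\<^sup>2) ^ Suc m \<le> sqrt (3/4) * sqrt (1 - t\<^sup>2) ^ m" if "t \<in> {1/2..1}"
      unfolding power_Suc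
    proof (intro mult_right_mono)
      have "(1/2)\<^sup>2 \<le> t\<^sup>2" using that by (intro power_mono) auto
      then show "sqrt (1 - t\<^sup>2) \<le> sqrt (3/4)" by (simp add: power2_eq_square)
      have "t\<^sup>2 \<le> 1" using that by (intro power_le_one) auto
      then show "0 \<le> sqrt (1 - t\<^sup>2) ^ m" by simp
    qed
    then show "indicator {1/2..1} t * ennreal (sqrt (1 - t\<^sup>2) ^ Suc m)
       \<le> ennreal (sqrt (3/4)) * (indicator {1/2..1} t * ennreal (sqrt (1 - t\<^sup>2) ^ m))"
      by (auto simp: indicator_def ennreal_mult'[symmetric] intro!: ennreal_leI)
  qed
  also have "\<dots> = ennreal (sqrt (3/4)) * cap_far m"
    unfolding cap_far_def by (rule nn_integral_cmult) measurable
  finally show ?thesis .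
qed

text \<open>This is the strict one of the two one-step comparisons. With s = sqrt (3/4) and w = sqrt
  (1 - t^2), the gain w^(m + 1) - s * w^m = (w - s) * w^m is nonnegative on [0, 1/2] and at least a
  positive constant on [0, 1/4].\<close>

lemma cap_near_Suc_gt: "cap_near (Suc m) > ennreal (sqrt (3/4)) * cap_near m"
proof -
  let ?s = "sqrt (3/4) :: real"
  \<comment> \<open>A lower bound of (w - s) * w^m on [0, 1/4], where w^2 >= 1 - 1/16 = 15/16 and w
    >= s.\<close>
  let ?c = "(sqrt (15/16) - ?s) * ?s ^ m"
  have c: "?c > 0" by (intro mult_pos_pos) auto
  have "ennreal ?s * cap_near m < ennreal ?s * cap_near m + ennreal (1/4 - 0) * ennreal ?c"
  proof -
    have "ennreal ?s * cap_near m \<noteq> top"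
      using cap_finite(2)[of m] by (simp add: ennreal_mult_eq_top_iff)
    moreover have "0 < ennreal (1/4 - 0) * ennreal ?c"
      using c by (simp add: ennreal_zero_less_mult_iff)
    ultimately show ?thesis
      using ennreal_add_left_cancel_less[of "ennreal ?s * cap_near m" 0] by simp
  qed
  also have "\<dots> = (\<integral>\<^sup>+t. ennreal ?s * (indicator {0..1/2} t * ennreal (sqrt (1 - t\<^sup>2) ^ m)) \<partial>lborel)
       + (\<integral>\<^sup>+t. indicator {0..1/4::real} t * ennreal ?c \<partial>lborel)"
    unfolding cap_near_def
    by (rule arg_cong2[where f = "(+)"], rule nn_integral_cmult[symmetric], measurable,
        rule nn_integral_indicator_const_Icc[symmetric], simp)
  also have "\<dots> = (\<integral>\<^sup>+t. ennreal ?s * (indicator {0..1/2} t * ennreal (sqrt (1 - t\<^sup>2) ^ m))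
       + indicator {0..1/4} t * ennreal ?c \<partial>lborel)"
    by (rule nn_integral_add[symmetric]) measurable
  also have "\<dots> \<le> cap_near (Suc m)"
    unfolding cap_near_def
  proof (intro nn_integral_mono)
    fix t :: real
    show "ennreal ?s * (indicator {0..1/2} t * ennreal (sqrt (1 - t\<^sup>2) ^ m)) + indicator {0..1/4} t * ennreal ?c
      \<le> indicator {0..1/2} t * ennreal (sqrt (1 - t\<^sup>2) ^ Suc m)"
    proof (cases "t \<in> {0..1/2}")
      case True
      have "t\<^sup>2 \<le> (1/2)\<^sup>2" using True by (intro power_mono) auto
      then have s: "?s \<le> sqrt (1 - t\<^sup>2)" by (simp add: power2_eq_square)
      then have s0: "0 \<le> sqrt (1 - t\<^sup>2)" by (rule order_trans[rotated]) simp
      let ?w = "sqrt (1 - t\<^sup>2)"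
      have "?s * ?w ^ m + (if t \<le> 1/4 then ?c else 0) \<le> ?w ^ Suc m"
      proof (cases "t \<le> 1/4")
        case True
        have "t\<^sup>2 \<le> (1/4)\<^sup>2" using True \<open>t \<in> {0..1/2}\<close> by (intro power_mono) auto
        then have "sqrt (15/16) \<le> ?w" by (simp add: power2_eq_square)
        then have "?c \<le> (?w - ?s) * ?w ^ m"
          using s by (intro mult_mono power_mono) auto
        then show ?thesis using True by (simp add: algebra_simps)
      next
        case False
        then show ?thesis using s s0 by (simp add: mult_right_mono)
      qed
      then have "ennreal (?s * ?w ^ m + (if t \<le> 1/4 then ?c else 0)) \<le> ennreal (?w ^ Suc m)"
        by (rule ennreal_leI)
      moreover have "ennreal (?s * ?w ^ m + (if t \<le> 1/4 then ?c else 0)) =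
          ennreal ?s * ennreal (?w ^ m) + ennreal (if t \<le> 1/4 then ?c else 0)"
        using s0 c by (subst ennreal_plus) (auto simp: ennreal_mult')
      ultimately show ?thesis
        using True by (auto simp: indicator_def split: if_splits)
    qed (auto simp: indicator_def)
  qed
  finally show ?thesis .
qed

text \<open>The limiting proportion of wedges that close up to a triangle.\<close>

definition clustering :: "nat \<Rightarrow> real" where
  "clustering d = 3/2 * (enn2real (cap_far (d - 1)) / (enn2real (cap_far (d - 1)) + enn2real (cap_near (d - 1))))"

lemma clustering_nonneg: "0 \<le> clustering d"
  by (simp add: clustering_def)

text \<open>Cross-multiplied, the claim is n' * k < n * k'. The factor s = sqrt (3/4) separates the
  two sides: n' <= s * n and s * k < k'.\<close>

lemma clustering_Suc_less:
  assumes "d \<ge> 1"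
  shows "clustering (Suc d) < clustering d"
proof -
  obtain m where m: "d = Suc m" using assms by (cases d) auto
  define s where "s = sqrt (3/4 :: real)"
  have s: "s > 0" by (simp add: s_def)
  define n n' k k' where nk: "n = enn2real (cap_far m)" "n' = enn2real (cap_far (Suc m))"
    "k = enn2real (cap_near m)" "k' = enn2real (cap_near (Suc m))"
  have e: "cap_far m = ennreal n" "cap_far (Suc m) = ennreal n'" "cap_near m = ennreal k" "cap_near (Suc m) = ennreal k'"
    unfolding nk using cap_finite by auto
  have n: "n > 0" "n' > 0" "k \<ge> 0" "k' \<ge> 0"
    using cap_far_pos[of m] cap_far_pos[of "Suc m"] cap_finite unfolding nk
    by (auto simp: enn2real_positive_iff)
  have 1: "n' \<le> s * n"
    using cap_far_Suc_le[of m] n s unfolding e s_def[symmetric]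
    by (simp add: ennreal_mult'[symmetric])
  have 2: "s * k < k'"
    using cap_near_Suc_gt[of m] n s unfolding e s_def[symmetric]
    by (simp add: ennreal_mult'[symmetric] ennreal_less_iff)
  have "n' * k \<le> s * n * k" using 1 n by (intro mult_right_mono) auto
  also have "\<dots> < n * k'" using 2 n by (simp add: mult.assoc mult.left_commute)
  finally have "n' / (n' + k') < n / (n + k)"
    using n by (simp add: divide_simps algebra_simps add_pos_nonneg)
  then show ?thesis
    unfolding clustering_def m nk by (simp only: diff_Suc_1)
qed

text \<open>The lens and the d-ball share the factor \<open>ball_vol m 1\<close>, which drops out.
  Multiplying by 2 * (n + k), the quotient of the volumes of the d-ball and the m-ball, avoids a
  division in \<open>ennreal\<close>.\<close>

lemma tri_vol_eq_clustering:
  assumes "d \<ge> 1"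
  shows "tri_vol d = ennreal (clustering d) * (ball_vol d 1 * ball_vol d 1)"
proof -
  obtain m where m: "d = Suc m" using assms by (cases d) auto
  define n k where nk: "n = enn2real (cap_far m)" "k = enn2real (cap_near m)"
  have e: "cap_far m = ennreal n" "cap_near m = ennreal k"
    unfolding nk using cap_finite by auto
  have n: "n > 0" "k \<ge> 0"
    using cap_far_pos[of m] cap_finite unfolding nk
    by (auto simp: enn2real_positive_iff)
  have V: "ball_vol d 1 = ennreal (2 * (n + k)) * ball_vol m 1"
    using n unfolding m ball_vol_cap e by (simp add: ennreal_mult')
  have "(tri_vol d * ennreal (2 * (n + k))) = (2 * tri_vol d) * ennreal (n + k)"
    using n by (simp add: ennreal_mult' mult_ac)
  also have "\<dots> = 3 * (2 * ennreal n * ball_vol m 1) * ball_vol d 1 * ennreal (n + k)"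
    unfolding tri_vol_lens[OF assms] by (simp add: m lens_cap e)
  also have "\<dots> = 3 * ennreal n * (ennreal (2 * (n + k)) * ball_vol m 1) * ball_vol d 1"
    using n by (simp add: ennreal_mult' mult_ac)
  also have "\<dots> = ennreal (3 * n) * (ball_vol d 1 * ball_vol d 1)"
    using n unfolding V[symmetric] by (simp add: ennreal_mult' mult_ac)
  also have "3 * n = clustering d * (2 * (n + k))"
    using n unfolding clustering_def m by (simp add: nk[symmetric] field_simps)
  also have "ennreal (clustering d * (2 * (n + k))) = ennreal (clustering d) * ennreal (2 * (n + k))"
    by (rule ennreal_mult') (rule clustering_nonneg)
  finally have "tri_vol d * ennreal (2 * (n + k)) =
     (ennreal (clustering d) * (ball_vol d 1 * ball_vol d 1)) * ennreal (2 * (n + k))"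
    by (simp add: mult_ac)
  then show ?thesis by (rule ennreal_cancel_right) (use n in \<open>auto simp del: ennreal_plus\<close>)
qed

section \<open>Continuity of translations\<close>

abbreviation shift_diff :: "nat \<Rightarrow> ((nat \<Rightarrow> real) \<Rightarrow> real) \<Rightarrow> (nat \<Rightarrow> real) \<Rightarrow> ennreal" where
  "shift_diff d g u \<equiv> \<integral>\<^sup>+x. ennreal \<bar>g (aff d 1 u x) - g x\<bar> \<partial>lebesgue_pow d"

definition translation_continuous :: "nat \<Rightarrow> ((nat \<Rightarrow> real) \<Rightarrow> real) \<Rightarrow> bool" where
  "translation_continuous d g \<longleftrightarrow> (\<forall>\<eta>>0. \<exists>\<delta>>0. \<forall>u. nrm d u \<le> \<delta> \<longrightarrow>
     shift_diff d g u \<le> ennreal \<eta>)"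

text \<open>The difference g (x + u) - g x splits into (g - s) (x + u), s (x + u) - s x and (s - g)
  x. The outer two have equal L^1 norms, as translations preserve the measure.\<close>

lemma translation_continuous_approx:
  assumes [measurable]: "g \<in> borel_measurable (lebesgue_pow d)"
    and ap: "\<And>\<eta>. \<eta> > 0 \<Longrightarrow> \<exists>s. s \<in> borel_measurable (lebesgue_pow d) \<and> translation_continuous d s \<and>
       (\<integral>\<^sup>+x. ennreal \<bar>g x - s x\<bar> \<partial>lebesgue_pow d) \<le> ennreal \<eta>"
  shows "translation_continuous d g"
  unfolding translation_continuous_def
proof (intro allI impI)
  fix \<eta> :: real assume \<eta>: "\<eta> > 0"
  let ?L = "lebesgue_pow d"
  obtain s where s [measurable]: "s \<in> borel_measurable ?L" and ts: "translation_continuous d s"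
    and gs: "(\<integral>\<^sup>+x. ennreal \<bar>g x - s x\<bar> \<partial>?L) \<le> ennreal (\<eta>/3)"
    using ap[of "\<eta>/3"] \<eta> by auto
  obtain \<delta> where \<delta>: "\<delta> > 0" "\<And>u. nrm d u \<le> \<delta> \<Longrightarrow>
     shift_diff d s u \<le> ennreal (\<eta>/3)"
    using ts \<eta> unfolding translation_continuous_def by (metis divide_pos_pos zero_less_numeral)
  show "\<exists>\<delta>>0. \<forall>u. nrm d u \<le> \<delta> \<longrightarrow> shift_diff d g u \<le> ennreal \<eta>"
  proof (intro exI[of _ \<delta>] conjI allI impI \<delta>(1))
    fix u assume u: "nrm d u \<le> \<delta>"
    have "shift_diff d g u \<le>
      (\<integral>\<^sup>+x. ennreal \<bar>g (aff d 1 u x) - s (aff d 1 u x)\<bar> + ennreal \<bar>s (aff d 1 u x) - s x\<bar> + ennreal \<bar>g x - s x\<bar> \<partial>?L)"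
      by (intro nn_integral_mono) (auto simp: ennreal_plus[symmetric] simp del: ennreal_plus intro!: ennreal_leI)
    also have "\<dots> = (\<integral>\<^sup>+x. ennreal \<bar>g (aff d 1 u x) - s (aff d 1 u x)\<bar> \<partial>?L) +
      shift_diff d s u + (\<integral>\<^sup>+x. ennreal \<bar>g x - s x\<bar> \<partial>?L)"
      by (simp add: nn_integral_add)
    also have "(\<integral>\<^sup>+x. ennreal \<bar>g (aff d 1 u x) - s (aff d 1 u x)\<bar> \<partial>?L) = (\<integral>\<^sup>+x. ennreal \<bar>g x - s x\<bar> \<partial>?L)"
      by (rule nn_integral_translate[of "\<lambda>x. ennreal \<bar>g x - s x\<bar>"]) measurable
    also have "(\<integral>\<^sup>+x. ennreal \<bar>g x - s x\<bar> \<partial>?L) + shift_diff d s u + (\<integral>\<^sup>+x. ennreal \<bar>g x - s x\<bar> \<partial>?L)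
      \<le> ennreal (\<eta>/3) + ennreal (\<eta>/3) + ennreal (\<eta>/3)"
      by (intro add_mono gs \<delta>(2) u)
    also have "\<dots> = ennreal \<eta>"
      using \<eta> by (simp add: ennreal_plus[symmetric] del: ennreal_plus)
    finally show "shift_diff d g u \<le> ennreal \<eta>" .
  qed
qed

text \<open>Dominated convergence upgrades a pointwise limit to L^1 approximation. It serves three
  times: for disjoint unions, for exhaustion by cubes and for integrable functions.\<close>

lemma translation_continuous_lim:
  assumes [measurable]: "\<And>i::nat. s i \<in> borel_measurable (lebesgue_pow d)" "g \<in> borel_measurable (lebesgue_pow d)"
     "w \<in> borel_measurable (lebesgue_pow d)"
    and s: "\<And>i. translation_continuous d (s i)"
    and w: "(\<integral>\<^sup>+x. ennreal (w x) \<partial>lebesgue_pow d) < \<infinity>"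
    and le: "\<And>i x. x \<in> space (lebesgue_pow d) \<Longrightarrow> \<bar>s i x\<bar> \<le> w x"
    and lim: "\<And>x. x \<in> space (lebesgue_pow d) \<Longrightarrow> (\<lambda>i. s i x) \<longlonglongrightarrow> g x"
  shows "translation_continuous d g"
proof (rule translation_continuous_approx)
  fix \<eta> :: real assume \<eta>: "\<eta> > 0"
  let ?L = "lebesgue_pow d"
  have "(\<lambda>i. (\<integral>\<^sup>+x. norm (g x - s i x) \<partial>?L)) \<longlonglongrightarrow> 0"
    using w le lim by (intro nn_integral_dominated_convergence_norm[where w = w]) auto
  then have "eventually (\<lambda>i. (\<integral>\<^sup>+x. norm (g x - s i x) \<partial>?L) < ennreal \<eta>) sequentially"
    using \<eta> by (intro order_tendstoD) auto
  then obtain i where "(\<integral>\<^sup>+x. norm (g x - s i x) \<partial>?L) < ennreal \<eta>"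
    by (auto simp: eventually_sequentially)
  then show "\<exists>s. s \<in> borel_measurable ?L \<and> translation_continuous d s \<and>
       (\<integral>\<^sup>+x. ennreal \<bar>g x - s x\<bar> \<partial>?L) \<le> ennreal \<eta>"
    using s by (intro exI[of _ "s i"]) auto
qed (rule assms)

lemma translation_continuous_linear:
  assumes [measurable]: "g \<in> borel_measurable (lebesgue_pow d)" "h \<in> borel_measurable (lebesgue_pow d)"
    and g: "translation_continuous d g" and h: "translation_continuous d h"
  shows "translation_continuous d (\<lambda>x. a * g x + b * h x)"
  unfolding translation_continuous_def
proof (intro allI impI)
  fix \<eta> :: real assume \<eta>: "\<eta> > 0"
  let ?L = "lebesgue_pow d"
  \<comment> \<open>The \<open>+ 1\<close> keeps \<open>K\<close> positive when both coefficients
    are 0.\<close>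
  define K where "K = \<bar>a\<bar> + \<bar>b\<bar> + 1"
  have K: "K > 0" by (simp add: K_def)
  obtain \<delta>1 where \<delta>1: "\<delta>1 > 0" "\<And>u. nrm d u \<le> \<delta>1 \<Longrightarrow>
     shift_diff d g u \<le> ennreal (\<eta>/K)"
    using g \<eta> K unfolding translation_continuous_def by (metis divide_pos_pos)
  obtain \<delta>2 where \<delta>2: "\<delta>2 > 0" "\<And>u. nrm d u \<le> \<delta>2 \<Longrightarrow>
     shift_diff d h u \<le> ennreal (\<eta>/K)"
    using h \<eta> K unfolding translation_continuous_def by (metis divide_pos_pos)
  let ?k = "\<lambda>x. a * g x + b * h x"
  show "\<exists>\<delta>>0. \<forall>u. nrm d u \<le> \<delta> \<longrightarrow> shift_diff d ?k u \<le> ennreal \<eta>"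
  proof (intro exI[of _ "min \<delta>1 \<delta>2"] conjI allI impI)
    show "min \<delta>1 \<delta>2 > 0" using \<delta>1 \<delta>2 by simp
    fix u assume u: "nrm d u \<le> min \<delta>1 \<delta>2"
    have "\<bar>?k y - ?k x\<bar> \<le> \<bar>a\<bar> * \<bar>g y - g x\<bar> + \<bar>b\<bar> * \<bar>h y - h x\<bar>" for x y
    proof -
      have "?k y - ?k x = a * (g y - g x) + b * (h y - h x)" by (simp add: algebra_simps)
      then show ?thesis using abs_triangle_ineq[of "a * (g y - g x)" "b * (h y - h x)"] by (simp add: abs_mult)
    qed
    then have "shift_diff d ?k u \<le>
      (\<integral>\<^sup>+x. ennreal \<bar>a\<bar> * ennreal \<bar>g (aff d 1 u x) - g x\<bar> + ennreal \<bar>b\<bar> * ennreal \<bar>h (aff d 1 u x) - h x\<bar> \<partial>?L)"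
      by (intro nn_integral_mono) (auto simp: ennreal_plus[symmetric] ennreal_mult'[symmetric] simp del: ennreal_plus intro!: ennreal_leI)
    also have "\<dots> = ennreal \<bar>a\<bar> * shift_diff d g u + ennreal \<bar>b\<bar> * shift_diff d h u"
      by (simp add: nn_integral_add nn_integral_cmult)
    also have "\<dots> \<le> ennreal \<bar>a\<bar> * ennreal (\<eta>/K) + ennreal \<bar>b\<bar> * ennreal (\<eta>/K)"
      using u by (intro add_mono mult_left_mono \<delta>1(2) \<delta>2(2)) auto
    also have "\<dots> = ennreal ((\<bar>a\<bar> + \<bar>b\<bar>) * (\<eta>/K))"
      using \<eta> K by (simp add: ennreal_plus[symmetric] ennreal_mult'[symmetric] distrib_right add_divide_distrib del: ennreal_plus)
    also have "\<dots> \<le> ennreal \<eta>"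
      using \<eta> K by (intro ennreal_leI) (simp add: K_def field_simps)
    finally show "shift_diff d ?k u \<le> ennreal \<eta>" .
  qed
qed

lemma box_in_sets [measurable]:
  "(\<And>k. k < d \<Longrightarrow> A k \<in> sets borel) \<Longrightarrow> Pi\<^sub>E {..<d} A \<in> sets (lebesgue_pow d)"
  unfolding sets_lebesgue_pow by (intro sets_PiM_I_finite) auto

lemma emeasure_Icc_box:
  "emeasure (lebesgue_pow d) (Pi\<^sub>E {..<d} (\<lambda>k. {a k..b k})) = ennreal (\<Prod>k<d. max 0 (b k - a k))"
proof -
  have "emeasure (lebesgue_pow d) (Pi\<^sub>E {..<d} (\<lambda>k. {a k..b k})) = (\<Prod>k<d. emeasure lborel {a k..b k})"
    by (rule emeasure_lebesgue_pow_box) auto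
  also have "\<dots> = (\<Prod>k<d. ennreal (max 0 (b k - a k)))"
    by (intro prod.cong) (auto simp: emeasure_lborel_Icc_eq max_def)
  also have "\<dots> = ennreal (\<Prod>k<d. max 0 (b k - a k))"
    by (rule prod_ennreal) auto
  finally show ?thesis .
qed

text \<open>If every coordinate of \<open>u\<close> is at most t in modulus, a point on which the
  box and its translate disagree lies in the box enlarged by t on all sides but not in the one
  shrunk by t. The volume of this shell tends to 0 with t.\<close>

lemma translation_continuous_box:
  "translation_continuous d (indicator (Pi\<^sub>E {..<d} (\<lambda>k. {a k..b k})))"
  unfolding translation_continuous_def
proof (intro allI impI)
  fix \<eta> :: real assume \<eta>: "\<eta> > 0"
  let ?L = "lebesgue_pow d"
  \<comment> \<open>The volume of the box enlarged by t on each side, or shrunk when t is negative;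
    \<open>max 0\<close> keeps the formula correct and continuous when the box becomes
    empty.\<close>
  define \<phi> where "\<phi> t = (\<Prod>k<d. max 0 (b k - a k + 2 * t))" for t
  have "((\<lambda>t. \<phi> t - \<phi> (- t)) \<longlongrightarrow> \<phi> 0 - \<phi> (- 0)) (at_right 0)"
    unfolding \<phi>_def by (intro tendsto_intros)
  then have "eventually (\<lambda>t. \<phi> t - \<phi> (- t) < \<eta>) (at_right 0)"
    using \<eta> by (intro order_tendstoD(2)) auto
  then obtain \<delta>' where \<delta>': "\<delta>' > 0" "\<And>t. 0 < t \<Longrightarrow> t < \<delta>' \<Longrightarrow> \<phi> t - \<phi> (- t) < \<eta>"
    unfolding eventually_at_right_field by auto
  define t where "t = \<delta>' / 2"
  have t: "t > 0" "\<phi> t - \<phi> (- t) < \<eta>" using \<delta>' by (auto simp: t_def)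
  let ?B = "Pi\<^sub>E {..<d} (\<lambda>k. {a k..b k})"
  let ?out = "Pi\<^sub>E {..<d} (\<lambda>k. {a k - t..b k + t})"
  let ?in = "Pi\<^sub>E {..<d} (\<lambda>k. {a k + t..b k - t})"
  have io: "?in \<subseteq> ?out" using t by (intro PiE_mono) auto
  have mo: "emeasure ?L ?out = ennreal (\<phi> t)"
    unfolding emeasure_Icc_box \<phi>_def by (simp add: algebra_simps)
  have mi: "emeasure ?L ?in = ennreal (\<phi> (-t))"
    unfolding emeasure_Icc_box \<phi>_def by (simp add: algebra_simps)
  show "\<exists>\<delta>>0. \<forall>u. nrm d u \<le> \<delta> \<longrightarrow>
     shift_diff d (indicator ?B) u \<le> ennreal \<eta>"
  proof (intro exI[of _ t] conjI allI impI t(1))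
    fix u assume u: "nrm d u \<le> t"
    have uk: "\<bar>u k\<bar> \<le> t" if "k < d" for k
      using u member_le_L2_set[of "{..<d}" k "\<lambda>k. \<bar>u k\<bar>"] that by (auto simp: L2_set_def)
    have "shift_diff d (indicator ?B) u \<le> (\<integral>\<^sup>+x. indicator (?out - ?in) x \<partial>?L)"
    proof (intro nn_integral_mono)
      fix x assume x: "x \<in> space ?L"
      have 1: "y \<in> ?B" if "x \<in> ?in" "y = x \<or> y = aff d 1 u x" for y
      proof (cases "y = x")
        case True
        show ?thesis unfolding True using that(1) t by (rule_tac subsetD[OF PiE_mono]) auto
      next
        case False
        then have y: "y = aff d 1 u x" using that by simp
        have "a k \<le> u k + x k \<and> u k + x k \<le> b k" if k: "k < d" for k
        proof -
          have "a k + t \<le> x k \<and> x k \<le> b k - t" using \<open>x \<in> ?in\<close> k by (auto simp: PiE_iff)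
          then show ?thesis using uk[OF k] by linarith
        qed
        then show ?thesis unfolding y by (auto simp: aff_def)
      qed
      have 2: "x \<in> ?out" if "y \<in> ?B" "y = x \<or> y = aff d 1 u x" for y
      proof -
        have "a k - t \<le> x k \<and> x k \<le> b k + t" if k: "k < d" for k
        proof -
          have "a k \<le> y k \<and> y k \<le> b k" using \<open>y \<in> ?B\<close> k by (auto simp: PiE_iff)
          moreover have "y k = x k \<or> y k = u k + x k" using \<open>y = x \<or> _\<close> k by auto
          ultimately show ?thesis using uk[OF k] t by linarith
        qed
        then show ?thesis using x by (auto simp: space_lebesgue_pow PiE_iff)
      qed
      show "ennreal \<bar>indicator ?B (aff d 1 u x) - indicator ?B x\<bar> \<le> indicator (?out - ?in) x"
        using 1 2 by (cases "x \<in> ?B"; cases "aff d 1 u x \<in> ?B") (auto simp: indicator_def)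
    qed
    also have "\<dots> = emeasure ?L (?out - ?in)"
      by (rule nn_integral_indicator) measurable
    also have "\<dots> = ennreal (\<phi> t) - ennreal (\<phi> (-t))"
      by (subst emeasure_Diff[OF _ _ _ io]) (auto simp: mo mi)
    also have "\<dots> = ennreal (\<phi> t - \<phi> (-t))"
      by (rule ennreal_minus) (auto simp: \<phi>_def intro!: prod_nonneg)
    also have "\<dots> \<le> ennreal \<eta>" using t by (intro ennreal_leI) simp
    finally show "shift_diff d (indicator ?B) u \<le> ennreal \<eta>" .
  qed
qed

text \<open>A generator suited to a Dynkin argument: orthants are closed under intersection, by
  taking minima of corners, and an orthant cut with a cube is a closed box.\<close>

lemma sets_lebesgue_pow_orthants:
  "sets (lebesgue_pow d) = sigma_sets (space (lebesgue_pow d))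
     (range (\<lambda>b. Pi\<^sub>E {..<d} (\<lambda>k. {..b k :: real})))"
proof -
  have "sets (lebesgue_pow d) = sets (\<Pi>\<^sub>M i\<in>{..<d}. sigma UNIV (range (atMost :: real \<Rightarrow> _)))"
    unfolding sets_lebesgue_pow borel_eq_atMost by simp
  also have "\<dots> = sets (sigma (\<Pi>\<^sub>E i\<in>{..<d}. UNIV)
     {{f\<in>(\<Pi>\<^sub>E i\<in>{..<d}. UNIV). \<forall>i\<in>j. f i \<in> A i} | A j. j \<in> {{..<d}} \<and> A \<in> Pi j (\<lambda>_. range atMost)})"
  proof (rule sets_PiM_sigma)
    fix i
    have "UNIV = (\<Union>n::nat. {..real n})" using real_arch_simple by auto
    then show "\<exists>S\<subseteq>range atMost. countable S \<and> (UNIV :: real set) = \<Union>S"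
      by (intro exI[of _ "range (\<lambda>n::nat. {..real n})"]) auto
  qed auto
  also have "{{f\<in>(\<Pi>\<^sub>E i\<in>{..<d}. UNIV). \<forall>i\<in>j. f i \<in> A i} | A j. j \<in> {{..<d}} \<and> A \<in> Pi j (\<lambda>_. range (atMost :: real \<Rightarrow> _))}
     = range (\<lambda>b. Pi\<^sub>E {..<d} (\<lambda>k. {..b k :: real}))" (is "?P = ?G")
  proof (intro equalityI subsetI)
    fix X assume "X \<in> ?P"
    then obtain A where A: "A \<in> Pi {..<d} (\<lambda>_. range atMost)"
      and X: "X = {f\<in>(\<Pi>\<^sub>E i\<in>{..<d}. UNIV). \<forall>i\<in>{..<d}. f i \<in> A i}" by auto
    from A have "\<forall>i\<in>{..<d}. \<exists>b. A i = {..b}" by auto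
    then obtain b where b: "\<And>i. i \<in> {..<d} \<Longrightarrow> A i = {..b i}" by metis
    have "X = Pi\<^sub>E {..<d} (\<lambda>k. {..b k})"
      unfolding X by (auto simp: PiE_iff extensional_def b)
    then show "X \<in> ?G" by auto
  next
    fix X assume "X \<in> ?G"
    then obtain b where X: "X = Pi\<^sub>E {..<d} (\<lambda>k. {..b k})" by auto
    have X': "X = {f\<in>(\<Pi>\<^sub>E i\<in>{..<d}. UNIV). \<forall>i\<in>{..<d}. f i \<in> {..b i}}"
      unfolding X by (auto simp: PiE_iff extensional_def)
    have b: "(\<lambda>k. {..b k}) \<in> Pi {..<d} (\<lambda>_. range atMost)" by auto
    show "X \<in> ?P"
      by (intro CollectI exI[of _ "\<lambda>k. {..b k}"] exI[of _ "{..<d}"] conjI X' b) simp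
  qed
  finally show ?thesis
    by (subst (asm) sets_measure_of) (auto simp: space_lebesgue_pow PiE_iff)
qed

text \<open>Dynkin's lemma, starting from boxes. The fixed cube keeps all measures finite: a
  complement becomes a difference of two indicators, and the indicator of the cube dominates the
  partial sums of a disjoint union.\<close>

lemma translation_continuous_bounded_set:
  assumes "A \<in> sets (lebesgue_pow d)"
  shows "translation_continuous d (indicator (A \<inter> Pi\<^sub>E {..<d} (\<lambda>_. {-N..N})))"
proof -
  let ?L = "lebesgue_pow d" and ?K = "Pi\<^sub>E {..<d} (\<lambda>_. {-N..N::real})"
  let ?G = "range (\<lambda>b. Pi\<^sub>E {..<d} (\<lambda>k. {..b k :: real}))"
  have K: "?K \<in> sets ?L" by measurable
  have Kf: "emeasure ?L ?K < \<infinity>" by (simp add: emeasure_Icc_box)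
  have st: "Int_stable ?G"
  proof (rule Int_stableI)
    fix X Y assume "X \<in> ?G" "Y \<in> ?G"
    then obtain a b where ab: "X = Pi\<^sub>E {..<d} (\<lambda>k. {..a k})" "Y = Pi\<^sub>E {..<d} (\<lambda>k. {..b k})" by auto
    have "X \<inter> Y = Pi\<^sub>E {..<d} (\<lambda>k. {..min (a k) (b k)})"
      unfolding ab PiE_Int by simp
    then show "X \<inter> Y \<in> ?G" by (rule range_eqI[where x = "\<lambda>k. min (a k) (b k)"])
  qed
  have sub: "?G \<subseteq> Pow (space ?L)" by (auto simp: space_lebesgue_pow PiE_iff)
  from assms have "A \<in> sigma_sets (space ?L) ?G" by (simp add: sets_lebesgue_pow_orthants)
  from st sub this show ?thesis
  proof (induction A rule: sigma_sets_induct_disjoint)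
    case (basic A)
    then obtain b where b: "A = Pi\<^sub>E {..<d} (\<lambda>k. {..b k})" by auto
    have "A \<inter> ?K = Pi\<^sub>E {..<d} (\<lambda>k. {-N..min (b k) N})"
      unfolding b PiE_Int by (intro PiE_cong) auto
    then show ?case using translation_continuous_box by simp
  next
    case empty
    then show ?case by (simp add: translation_continuous_def)
  next
    case (compl A)
    then have A: "A \<in> sets ?L" by (simp add: sets_lebesgue_pow_orthants)
    have "translation_continuous d (\<lambda>x. 1 * indicator ?K x + (-1) * indicator (A \<inter> ?K) x)"
      using A K by (intro translation_continuous_linear translation_continuous_box compl) auto
    also have "(\<lambda>x. 1 * indicator ?K x + (-1) * indicator (A \<inter> ?K) x :: real) = indicator ((space ?L - A) \<inter> ?K)"
      by (auto simp: indicator_def fun_eq_iff space_lebesgue_pow)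
    finally show ?case .
  next
    case (union A)
    then have A: "A i \<in> sets ?L" for i by (auto simp: sets_lebesgue_pow_orthants)
    have fin: "translation_continuous d (\<lambda>x. \<Sum>i<n. indicator (A i \<inter> ?K) x)" for n
    proof (induction n)
      case 0
      then show ?case by (simp add: translation_continuous_def)
    next
      case (Suc n)
      have "translation_continuous d (\<lambda>x. 1 * (\<Sum>i<n. indicator (A i \<inter> ?K) x) + 1 * indicator (A n \<inter> ?K) x)"
        using A K Suc union by (intro translation_continuous_linear) auto
      then show ?case by simp
    qed
    have dis: "disjoint_family (\<lambda>i. A i \<inter> ?K)"
      using union(1) by (auto simp: disjoint_family_on_def)
    have eq: "(\<Sum>i<n. indicator (A i \<inter> ?K) x) = (indicator (\<Union>i<n. A i \<inter> ?K) x :: real)" for n x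
      by (rule indicator_UN_disjoint[symmetric]) (use dis in \<open>auto simp: disjoint_family_on_def\<close>)
    show ?case
    proof (rule translation_continuous_lim[where w = "indicator ?K", OF _ _ _ fin])
      fix x
      have "(\<lambda>n. indicator (\<Union>i<n. A i \<inter> ?K) x :: real) \<longlonglongrightarrow> indicator (\<Union>i. A i \<inter> ?K) x"
        by (rule LIMSEQ_indicator_UN)
      then show "(\<lambda>n. \<Sum>i<n. indicator (A i \<inter> ?K) x) \<longlonglongrightarrow> (indicator ((\<Union>i. A i) \<inter> ?K) x :: real)"
        unfolding eq by (simp add: Int_UN_distrib2)
      show "\<bar>\<Sum>i<n. indicator (A i \<inter> ?K) x\<bar> \<le> (indicator ?K x :: real)" for n
        unfolding eq by (auto simp: indicator_def)
    qed (use A K Kf in \<open>auto simp: ennreal_indicator\<close>)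
  qed
qed

lemma translation_continuous_set:
  assumes A: "A \<in> sets (lebesgue_pow d)" "emeasure (lebesgue_pow d) A < \<infinity>"
  shows "translation_continuous d (indicator A)"
proof (rule translation_continuous_lim[where w = "indicator A"])
  let ?K = "\<lambda>N::nat. Pi\<^sub>E {..<d} (\<lambda>_. {-real N..real N})"
  have K: "?K N \<in> sets (lebesgue_pow d)" for N by measurable
  show "translation_continuous d (indicator (A \<inter> ?K N))" for N
    by (rule translation_continuous_bounded_set[OF A(1)])
  show "indicator (A \<inter> ?K N) \<in> borel_measurable (lebesgue_pow d)" for N
    using A K by auto
  show "(\<lambda>N. indicator (A \<inter> ?K N) x) \<longlonglongrightarrow> (indicator A x :: real)" if x: "x \<in> space (lebesgue_pow d)" for x
  proof (rule tendsto_eventually)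
    obtain N0 :: nat where N0: "(\<Sum>k<d. \<bar>x k\<bar>) \<le> real N0" using real_arch_simple by blast
    have "x \<in> ?K N" if "N \<ge> N0" for N
    proof -
      have "\<bar>x k\<bar> \<le> real N" if "k < d" for k
        using member_le_sum[of k "{..<d}" "\<lambda>k. \<bar>x k\<bar>"] that N0 \<open>N \<ge> N0\<close> by auto
      then show ?thesis using x by (force simp: space_lebesgue_pow PiE_iff abs_le_iff)
    qed
    then show "eventually (\<lambda>N. indicator (A \<inter> ?K N) x = (indicator A x :: real)) sequentially"
      unfolding eventually_sequentially by (intro exI[of _ N0]) (auto simp: indicator_def)
  qed
qed (use A in \<open>auto simp: ennreal_indicator indicator_def[of "_ \<inter> _"]\<close>)

lemma translation_continuous_integrable:
  assumes "integrable (lebesgue_pow d) g"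
  shows "translation_continuous d g"
  using assms
proof (induction rule: integrable_induct)
  case (base A c)
  then have "translation_continuous d (\<lambda>x. c * indicator A x + 0 * indicator A x)"
    by (intro translation_continuous_linear translation_continuous_set) auto
  then show ?case by (simp add: mult.commute)
next
  case (add f g)
  then have "translation_continuous d (\<lambda>x. 1 * f x + 1 * g x)"
    by (intro translation_continuous_linear) auto
  then show ?case by simp
next
  case (lim f s)
  show ?case
  proof (rule translation_continuous_lim[where w = "\<lambda>x. 2 * norm (f x)"])
    show "(\<integral>\<^sup>+x. ennreal (2 * norm (f x)) \<partial>lebesgue_pow d) < \<infinity>"
    proof -
      have [measurable]: "f \<in> borel_measurable (lebesgue_pow d)" using lim.hyps(4) by simp
      have "(\<integral>\<^sup>+x. ennreal (2 * norm (f x)) \<partial>lebesgue_pow d) = 2 * (\<integral>\<^sup>+x. ennreal (norm (f x)) \<partial>lebesgue_pow d)"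
        by (subst nn_integral_cmult[symmetric]) (auto simp: ennreal_mult')
      then show ?thesis
        using lim.hyps(4) by (simp add: integrable_iff_bounded ennreal_mult_less_top)
    qed
  next
    fix i x assume "x \<in> space (lebesgue_pow d)"
    then show "\<bar>s i x\<bar> \<le> 2 * norm (f x)" using lim.hyps(3) by simp
  next
    show "s i \<in> borel_measurable (lebesgue_pow d)" for i
      by (rule borel_measurable_integrable[OF lim.hyps(1)])
    show "f \<in> borel_measurable (lebesgue_pow d)"
      by (rule borel_measurable_integrable[OF lim.hyps(4)])
    then show "(\<lambda>x. 2 * norm (f x)) \<in> borel_measurable (lebesgue_pow d)" by measurable
  qed (use lim in auto)
qed

section \<open>Densities with finite fifth moment\<close>

lemma aff_1_commute: "aff d 1 u x = aff d 1 x u"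
  by (rule space_lebesgue_pow_eqI[where d = d]) simp_all

text \<open>With p = |b - a| and q = |c - a|, the difference expands into terms of size a^2 p, a^2 q
  and a p q. They are split into a small multiple of a^3 and large multiples of p^3 and q^3, and p^3
  <= |b^3 - a^3|. So L^1 control of cubes yields control of a product of three values.\<close>

lemma cube_perturbation:
  fixes a b c \<epsilon> :: real
  assumes a: "a \<ge> 0" and b: "b \<ge> 0" and c: "c \<ge> 0" and \<epsilon>: "0 < \<epsilon>" "\<epsilon> \<le> 1"
  shows "\<bar>a * b * c - a ^ 3\<bar> \<le> 3 * \<epsilon> * a ^ 3 + 2 / \<epsilon>\<^sup>2 * (\<bar>b ^ 3 - a ^ 3\<bar> + \<bar>c ^ 3 - a ^ 3\<bar>)"
proof -
  have cube: "\<bar>y - x\<bar> ^ 3 \<le> \<bar>y ^ 3 - x ^ 3\<bar>" if "x \<ge> 0" "y \<ge> 0" for x y :: real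
  proof -
    have *: "(y - x) ^ 3 \<le> y ^ 3 - x ^ 3" if "0 \<le> x" "x \<le> y" for x y :: real
    proof -
      have "y ^ 3 - x ^ 3 - (y - x) ^ 3 = 3 * x * y * (y - x)"
        by (simp add: power3_eq_cube algebra_simps)
      moreover have "\<dots> \<ge> 0" using that by simp
      ultimately show ?thesis by linarith
    qed
    show ?thesis
      using *[of x y] *[of y x] that power_mono[of x y 3] power_mono[of y x 3]
      by (cases "x \<le> y") (auto simp: abs_if)
  qed
  \<comment> \<open>Split at p = \<epsilon> * a: below it the term with a^3 dominates, above it a <
    p / \<epsilon> and the term with p^3 dominates.\<close>
  have young: "a\<^sup>2 * p \<le> \<epsilon> * a ^ 3 + p ^ 3 / \<epsilon>\<^sup>2" "a * p\<^sup>2 \<le> \<epsilon> * a ^ 3 + p ^ 3 / \<epsilon>\<^sup>2" if p: "p \<ge> 0" for p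
  proof -
    have "a\<^sup>2 * p \<le> \<epsilon> * a ^ 3 + p ^ 3 / \<epsilon>\<^sup>2 \<and> a * p\<^sup>2 \<le> \<epsilon> * a ^ 3 + p ^ 3 / \<epsilon>\<^sup>2"
    proof (cases "p \<le> \<epsilon> * a")
      case True
      have "a\<^sup>2 * p \<le> a\<^sup>2 * (\<epsilon> * a)" using True by (intro mult_left_mono) auto
      moreover have "a * p\<^sup>2 \<le> a * (\<epsilon> * a)\<^sup>2" using True a p by (intro mult_left_mono power_mono) auto
      moreover have "a * (\<epsilon> * a)\<^sup>2 \<le> \<epsilon> * a ^ 3"
      proof -
        have "\<epsilon> * (\<epsilon> * a ^ 3) \<le> 1 * (\<epsilon> * a ^ 3)" using \<epsilon> a by (intro mult_right_mono) auto
        then show ?thesis by (simp add: power2_eq_square power3_eq_cube algebra_simps)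
      qed
      moreover have "p ^ 3 / \<epsilon>\<^sup>2 \<ge> 0" using p by simp
      ultimately show ?thesis by (simp add: power2_eq_square power3_eq_cube algebra_simps)
    next
      case False
      then have ap: "a \<le> p / \<epsilon>" using \<epsilon> by (simp add: field_simps)
      have "a\<^sup>2 * p \<le> (p / \<epsilon>)\<^sup>2 * p" using ap a p by (intro mult_right_mono power_mono) auto
      also have "\<dots> = p ^ 3 / \<epsilon>\<^sup>2" by (simp add: power2_eq_square power3_eq_cube)
      finally have 1: "a\<^sup>2 * p \<le> p ^ 3 / \<epsilon>\<^sup>2" .
      have "p / \<epsilon> \<le> p / \<epsilon>\<^sup>2" using \<epsilon> p by (intro divide_left_mono) (auto simp: power2_eq_square mult_le_one)
      then have "a * p\<^sup>2 \<le> (p / \<epsilon>\<^sup>2) * p\<^sup>2" using ap by (intro mult_right_mono) auto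
      also have "\<dots> = p ^ 3 / \<epsilon>\<^sup>2" by (simp add: power2_eq_square power3_eq_cube)
      finally have "a * p\<^sup>2 \<le> p ^ 3 / \<epsilon>\<^sup>2" .
      moreover have "\<epsilon> * a ^ 3 \<ge> 0" using \<epsilon> a by simp
      ultimately show ?thesis using 1 by linarith
    qed
    then show "a\<^sup>2 * p \<le> \<epsilon> * a ^ 3 + p ^ 3 / \<epsilon>\<^sup>2" "a * p\<^sup>2 \<le> \<epsilon> * a ^ 3 + p ^ 3 / \<epsilon>\<^sup>2" by auto
  qed
  define p q where "p = \<bar>b - a\<bar>" and "q = \<bar>c - a\<bar>"
  have pq: "p \<ge> 0" "q \<ge> 0" by (auto simp: p_def q_def)
  have "a * b * c - a ^ 3 = a\<^sup>2 * (b - a) + a\<^sup>2 * (c - a) + a * ((b - a) * (c - a))"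
    by (simp add: power2_eq_square power3_eq_cube algebra_simps)
  also have "\<bar>\<dots>\<bar> \<le> a\<^sup>2 * p + a\<^sup>2 * q + a * (p * q)"
    using a unfolding p_def q_def
    by (intro order_trans[OF abs_triangle_ineq] add_mono order_trans[OF abs_triangle_ineq]) (auto simp: abs_mult)
  also have "a * (p * q) \<le> a * ((p\<^sup>2 + q\<^sup>2) / 2)"
  proof (intro mult_left_mono a)
    have "0 \<le> (p - q)\<^sup>2" by simp
    then show "p * q \<le> (p\<^sup>2 + q\<^sup>2) / 2" by (simp add: power2_eq_square algebra_simps)
  qed
  also have "a\<^sup>2 * p + a\<^sup>2 * q + a * ((p\<^sup>2 + q\<^sup>2) / 2) = a\<^sup>2 * p + a\<^sup>2 * q + (a * p\<^sup>2) / 2 + (a * q\<^sup>2) / 2"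
    by (simp add: algebra_simps add_divide_distrib)
  also have "\<dots> \<le> 3 * (\<epsilon> * a ^ 3) + 3/2 * (p ^ 3 / \<epsilon>\<^sup>2) + 3/2 * (q ^ 3 / \<epsilon>\<^sup>2)"
    using young[OF pq(1)] young[OF pq(2)] by linarith
  also have "\<dots> \<le> 3 * (\<epsilon> * a ^ 3) + 2 * (p ^ 3 / \<epsilon>\<^sup>2) + 2 * (q ^ 3 / \<epsilon>\<^sup>2)"
    using pq \<epsilon> a by (intro add_mono mult_right_mono) auto
  also have "\<dots> = 3 * \<epsilon> * a ^ 3 + 2 / \<epsilon>\<^sup>2 * (p ^ 3 + q ^ 3)"
    by (simp add: algebra_simps)
  also have "\<dots> \<le> 3 * \<epsilon> * a ^ 3 + 2 / \<epsilon>\<^sup>2 * (\<bar>b ^ 3 - a ^ 3\<bar> + \<bar>c ^ 3 - a ^ 3\<bar>)"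
    using cube[OF a b] cube[OF a c] \<epsilon> unfolding p_def q_def
    by (intro add_left_mono mult_left_mono add_mono) auto
  finally show ?thesis by simp
qed

locale fifth_power_density =
  fixes d :: nat and f :: "(nat \<Rightarrow> real) \<Rightarrow> real"
  assumes d: "d \<ge> 1"
    and f_meas [measurable]: "f \<in> borel_measurable (lebesgue_pow d)"
    and f_nonneg: "x \<in> space (lebesgue_pow d) \<Longrightarrow> 0 \<le> f x"
    and f_int: "(\<integral>\<^sup>+x. ennreal (f x) \<partial>lebesgue_pow d) = 1"
    and f5: "(\<integral>\<^sup>+x. ennreal (f x ^ 5) \<partial>lebesgue_pow d) < \<infinity>"
begin

abbreviation "L \<equiv> lebesgue_pow d"

text \<open>Interpolation between the first and the fifth moment, by t^3 <= t + t^5 for t >=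
  0.\<close>

lemma integrable_f3: "integrable L (\<lambda>x. f x ^ 3)"
proof (rule integrableI_bounded)
  have "(\<integral>\<^sup>+x. ennreal (norm (f x ^ 3)) \<partial>L) \<le> (\<integral>\<^sup>+x. ennreal (f x) + ennreal (f x ^ 5) \<partial>L)"
  proof (intro nn_integral_mono)
    fix x assume "x \<in> space L"
    then have f: "f x \<ge> 0" by (rule f_nonneg)
    have "f x ^ 3 \<le> f x + f x ^ 5"
    proof (cases "f x \<le> 1")
      case True
      then have "f x ^ 3 \<le> f x ^ 1" using f by (intro power_decreasing) auto
      then show ?thesis using zero_le_power[OF f, of 5] unfolding power_one_right by linarith
    next
      case False
      then have "f x ^ 3 \<le> f x ^ 5" by (intro power_increasing) auto
      then show ?thesis using f by simp
    qed
    then show "ennreal (norm (f x ^ 3)) \<le> ennreal (f x) + ennreal (f x ^ 5)"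
      using f by (simp add: ennreal_plus[symmetric] ennreal_leI del: ennreal_plus)
  qed
  also have "\<dots> = 1 + (\<integral>\<^sup>+x. ennreal (f x ^ 5) \<partial>L)"
    by (simp add: nn_integral_add f_int)
  also have "\<dots> < \<infinity>" using f5 by simp
  finally show "(\<integral>\<^sup>+x. ennreal (norm (f x ^ 3)) \<partial>L) < \<infinity>" .
qed measurable

definition cube_mass :: real where "cube_mass = (\<integral>x. f x ^ 3 \<partial>L)"

lemma nn_cube_mass: "(\<integral>\<^sup>+x. ennreal (f x ^ 3) \<partial>L) = ennreal cube_mass"
  unfolding cube_mass_def using integrable_f3 f_nonneg by (intro nn_integral_eq_integral) auto

lemma cube_mass_pos: "cube_mass > 0"
proof (rule ccontr)
  assume "\<not> 0 < cube_mass"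
  then have "(\<integral>\<^sup>+x. ennreal (f x ^ 3) \<partial>L) = 0" unfolding nn_cube_mass by (simp add: ennreal_neg)
  then have "AE x in L. ennreal (f x ^ 3) = 0" by (subst (asm) nn_integral_0_iff_AE) auto
  then have "AE x in L. ennreal (f x) = 0"
    using AE_space by eventually_elim (use f_nonneg in \<open>force simp: ennreal_eq_0_iff power_le_zero_eq\<close>)
  then have "(\<integral>\<^sup>+x. ennreal (f x) \<partial>L) = (\<integral>\<^sup>+x. 0 \<partial>L)" by (rule nn_integral_cong_AE)
  then show False using f_int by simp
qed

text \<open>The joint density at (u, v) of the displacements (Y - X, Z - X), for independent points
  X, Y, Z with density f.\<close>

definition three_point :: "(nat \<Rightarrow> real) \<Rightarrow> (nat \<Rightarrow> real) \<Rightarrow> ennreal" where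
  "three_point u v = (\<integral>\<^sup>+x. ennreal (f x) * ennreal (f (aff d 1 x u)) * ennreal (f (aff d 1 x v)) \<partial>L)"

text \<open>Only translation continuity of f^3 in L^1 is needed, by the pointwise bound
  cube_perturbation with a, b, c the values of f at the three points.\<close>

lemma three_point_limit:
  assumes \<eta>: "\<eta> > 0"
  shows "\<exists>\<delta>>0. \<forall>u v. nrm d u \<le> \<delta> \<longrightarrow> nrm d v \<le> \<delta> \<longrightarrow>
     three_point u v \<le> ennreal (cube_mass + \<eta>) \<and> ennreal cube_mass \<le> three_point u v + ennreal \<eta>"
proof -
  \<comment> \<open>Each of the two error terms of \<open>cube_perturbation\<close> gets half of
    \<eta>: \<epsilon> makes 3 * \<epsilon> * \<open>cube_mass\<close> small enough, and then \<tau>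
    solves 2 / \<epsilon>^2 * (2 * \<tau>) = \<eta> / 2.\<close>
  define \<epsilon> where "\<epsilon> = min 1 (\<eta> / (6 * cube_mass))"
  have \<epsilon>: "0 < \<epsilon>" "\<epsilon> \<le> 1" "3 * \<epsilon> * cube_mass \<le> \<eta> / 2"
    using \<eta> cube_mass_pos by (auto simp: \<epsilon>_def min_def field_simps)
  define \<tau> where "\<tau> = \<eta> * \<epsilon>\<^sup>2 / 8"
  have \<tau>: "\<tau> > 0" "2 / \<epsilon>\<^sup>2 * (\<tau> + \<tau>) = \<eta> / 2" using \<eta> \<epsilon> by (auto simp: \<tau>_def field_simps)
  obtain \<delta> where \<delta>: "\<delta> > 0" "\<And>u. nrm d u \<le> \<delta> \<Longrightarrow>
     (\<integral>\<^sup>+x. ennreal \<bar>f (aff d 1 u x) ^ 3 - f x ^ 3\<bar> \<partial>L) \<le> ennreal \<tau>"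
    using translation_continuous_integrable[OF integrable_f3] \<tau>(1) unfolding translation_continuous_def by meson
  show ?thesis
  proof (intro exI[of _ \<delta>] conjI[OF \<delta>(1)] allI impI)
    fix u v assume uv: "nrm d u \<le> \<delta>" "nrm d v \<le> \<delta>"
    let ?g = "\<lambda>x. f x * f (aff d 1 u x) * f (aff d 1 v x)"
    have g0: "?g x \<ge> 0" if "x \<in> space L" for x
      using f_nonneg[OF that] f_nonneg by simp
    have tp: "three_point u v = (\<integral>\<^sup>+x. ennreal (?g x) \<partial>L)"
      unfolding three_point_def
      by (intro nn_integral_cong) (simp add: f_nonneg ennreal_mult' aff_1_commute[of _ _ "x" for x] mult.assoc)
    let ?A = "\<lambda>u x. ennreal \<bar>f (aff d 1 u x) ^ 3 - f x ^ 3\<bar>"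
    have "(\<integral>\<^sup>+x. ennreal \<bar>?g x - f x ^ 3\<bar> \<partial>L) \<le>
      (\<integral>\<^sup>+x. ennreal (3 * \<epsilon>) * ennreal (f x ^ 3) + ennreal (2 / \<epsilon>\<^sup>2) * (?A u x + ?A v x) \<partial>L)"
    proof (intro nn_integral_mono)
      fix x assume x: "x \<in> space L"
      have "\<bar>?g x - f x ^ 3\<bar> \<le> 3 * \<epsilon> * f x ^ 3 + 2 / \<epsilon>\<^sup>2 * (\<bar>f (aff d 1 u x) ^ 3 - f x ^ 3\<bar> + \<bar>f (aff d 1 v x) ^ 3 - f x ^ 3\<bar>)"
        using x by (intro cube_perturbation \<epsilon> f_nonneg) auto
      then have "ennreal \<bar>?g x - f x ^ 3\<bar> \<le> ennreal (3 * \<epsilon> * f x ^ 3 + 2 / \<epsilon>\<^sup>2 * (\<bar>f (aff d 1 u x) ^ 3 - f x ^ 3\<bar> + \<bar>f (aff d 1 v x) ^ 3 - f x ^ 3\<bar>))"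
        by (rule ennreal_leI)
      also have "\<dots> = ennreal (3 * \<epsilon>) * ennreal (f x ^ 3) + ennreal (2 / \<epsilon>\<^sup>2) * (?A u x + ?A v x)"
        using \<epsilon> f_nonneg[OF x]
        by (subst ennreal_plus, simp, simp, subst ennreal_mult', simp, subst ennreal_mult'', simp) simp
      finally show "ennreal \<bar>?g x - f x ^ 3\<bar> \<le> ennreal (3 * \<epsilon>) * ennreal (f x ^ 3) + ennreal (2 / \<epsilon>\<^sup>2) * (?A u x + ?A v x)" .
    qed
    also have "\<dots> = ennreal (3 * \<epsilon>) * ennreal cube_mass + ennreal (2 / \<epsilon>\<^sup>2) * ((\<integral>\<^sup>+x. ?A u x \<partial>L) + (\<integral>\<^sup>+x. ?A v x \<partial>L))"
      by (simp add: nn_integral_add nn_integral_cmult nn_cube_mass)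
    also have "\<dots> \<le> ennreal (3 * \<epsilon>) * ennreal cube_mass + ennreal (2 / \<epsilon>\<^sup>2) * (ennreal \<tau> + ennreal \<tau>)"
      by (intro add_mono mult_left_mono \<delta>(2) uv) auto
    also have "\<dots> = ennreal (3 * \<epsilon> * cube_mass + 2 / \<epsilon>\<^sup>2 * (\<tau> + \<tau>))"
      using \<epsilon> \<tau> cube_mass_pos by (simp add: ennreal_plus[symmetric] ennreal_mult'[symmetric] del: ennreal_plus)
    also have "\<dots> \<le> ennreal \<eta>"
      using \<epsilon> \<tau> by (intro ennreal_leI) simp
    finally have diff: "(\<integral>\<^sup>+x. ennreal \<bar>?g x - f x ^ 3\<bar> \<partial>L) \<le> ennreal \<eta>" .
    have "three_point u v \<le> (\<integral>\<^sup>+x. ennreal (f x ^ 3) + ennreal \<bar>?g x - f x ^ 3\<bar> \<partial>L)"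
      unfolding tp
    proof (intro nn_integral_mono)
      fix x assume x: "x \<in> space L"
      show "ennreal (?g x) \<le> ennreal (f x ^ 3) + ennreal \<bar>?g x - f x ^ 3\<bar>"
        using f_nonneg[OF x] by (subst ennreal_plus[symmetric]) (auto intro!: ennreal_leI simp del: ennreal_plus)
    qed
    also have "\<dots> = ennreal cube_mass + (\<integral>\<^sup>+x. ennreal \<bar>?g x - f x ^ 3\<bar> \<partial>L)"
      by (simp add: nn_integral_add nn_cube_mass)
    also have "\<dots> \<le> ennreal cube_mass + ennreal \<eta>" by (intro add_left_mono diff)
    also have "\<dots> = ennreal (cube_mass + \<eta>)" using cube_mass_pos \<eta> by simp
    finally have upper: "three_point u v \<le> ennreal (cube_mass + \<eta>)" .
    have "ennreal cube_mass \<le> (\<integral>\<^sup>+x. ennreal (?g x) + ennreal \<bar>?g x - f x ^ 3\<bar> \<partial>L)"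
      unfolding nn_cube_mass[symmetric]
    proof (intro nn_integral_mono)
      fix x assume x: "x \<in> space L"
      show "ennreal (f x ^ 3) \<le> ennreal (?g x) + ennreal \<bar>?g x - f x ^ 3\<bar>"
        using g0[OF x] by (subst ennreal_plus[symmetric]) (auto intro!: ennreal_leI simp del: ennreal_plus)
    qed
    also have "\<dots> = three_point u v + (\<integral>\<^sup>+x. ennreal \<bar>?g x - f x ^ 3\<bar> \<partial>L)"
      by (simp add: nn_integral_add tp)
    also have "\<dots> \<le> three_point u v + ennreal \<eta>" by (intro add_left_mono diff)
    finally show "three_point u v \<le> ennreal (cube_mass + \<eta>) \<and> ennreal cube_mass \<le> three_point u v + ennreal \<eta>"
      using upper by simp
  qed
qed

definition three_mass :: "((nat \<Rightarrow> real) \<Rightarrow> (nat \<Rightarrow> real) \<Rightarrow> ennreal) \<Rightarrow> ennreal" where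
  "three_mass \<kappa> = (\<integral>\<^sup>+x. (\<integral>\<^sup>+y. (\<integral>\<^sup>+z. ennreal (f x) * ennreal (f y) * ennreal (f z) *
      \<kappa> (aff d (-1) y x) (aff d (-1) z x) \<partial>L) \<partial>L) \<partial>L)"

text \<open>Substituting y = x + u and z = x + v and integrating over x first collects all
  dependence on f in \<open>three_point\<close>, since the kernel sees displacements only.\<close>

lemma three_mass_eq:
  assumes \<kappa> [measurable]: "case_prod \<kappa> \<in> borel_measurable (L \<Otimes>\<^sub>M L)"
  shows "three_mass \<kappa> = (\<integral>\<^sup>+u. (\<integral>\<^sup>+v. three_point u v * \<kappa> u v \<partial>L) \<partial>L)"
proof -
  have diff: "aff d (-1) (aff d 1 x u) x = u" if "u \<in> space L" for x u
    by (rule space_lebesgue_pow_eqI[where d = d]) (use that in simp_all)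
  have [measurable (raw)]: "(\<lambda>w. \<kappa> (X w) (Y w)) \<in> borel_measurable N"
    if "X \<in> measurable N L" "Y \<in> measurable N L" for X Y and N :: "'b measure"
  proof -
    have "(\<lambda>w. (X w, Y w)) \<in> measurable N (L \<Otimes>\<^sub>M L)" using that by measurable
    from measurable_compose[OF this \<kappa>] show ?thesis by simp
  qed
  have [measurable (raw)]: "(\<lambda>w. f (X w)) \<in> borel_measurable N"
    if "X \<in> measurable N L" for X and N :: "'b measure"
    using measurable_compose[OF that f_meas] .
  let ?h = "\<lambda>x u v. ennreal (f x) * ennreal (f (aff d 1 x u)) * ennreal (f (aff d 1 x v)) * \<kappa> u v"
  have "three_mass \<kappa> = (\<integral>\<^sup>+x. (\<integral>\<^sup>+u. (\<integral>\<^sup>+v. ?h x u v \<partial>L) \<partial>L) \<partial>L)"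
    unfolding three_mass_def
  proof (rule nn_integral_cong)
    fix x assume x: "x \<in> space L"
    let ?k = "\<lambda>y z. ennreal (f x) * ennreal (f y) * ennreal (f z) * \<kappa> (aff d (-1) y x) (aff d (-1) z x)"
    have "(\<integral>\<^sup>+y. (\<integral>\<^sup>+z. ?k y z \<partial>L) \<partial>L) = (\<integral>\<^sup>+u. (\<integral>\<^sup>+z. ?k (aff d 1 x u) z \<partial>L) \<partial>L)"
      using x by (intro nn_integral_translate[symmetric]) measurable
    also have "\<dots> = (\<integral>\<^sup>+u. (\<integral>\<^sup>+v. ?k (aff d 1 x u) (aff d 1 x v) \<partial>L) \<partial>L)"
    proof (rule nn_integral_cong)
      fix u assume u: "u \<in> space L"
      show "(\<integral>\<^sup>+z. ?k (aff d 1 x u) z \<partial>L) = (\<integral>\<^sup>+v. ?k (aff d 1 x u) (aff d 1 x v) \<partial>L)"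
        using x u by (intro nn_integral_translate[symmetric]) measurable
    qed
    also have "\<dots> = (\<integral>\<^sup>+u. (\<integral>\<^sup>+v. ?h x u v \<partial>L) \<partial>L)"
      by (intro nn_integral_cong) (simp add: diff)
    finally show "(\<integral>\<^sup>+y. (\<integral>\<^sup>+z. ?k y z \<partial>L) \<partial>L) = (\<integral>\<^sup>+u. (\<integral>\<^sup>+v. ?h x u v \<partial>L) \<partial>L)" .
  qed
  also have "\<dots> = (\<integral>\<^sup>+u. (\<integral>\<^sup>+x. (\<integral>\<^sup>+v. ?h x u v \<partial>L) \<partial>L) \<partial>L)"
    by (rule lp2.Fubini') measurable
  also have "\<dots> = (\<integral>\<^sup>+u. (\<integral>\<^sup>+v. (\<integral>\<^sup>+x. ?h x u v \<partial>L) \<partial>L) \<partial>L)"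
  proof (rule nn_integral_cong)
    fix u assume u: "u \<in> space L"
    show "(\<integral>\<^sup>+x. (\<integral>\<^sup>+v. ?h x u v \<partial>L) \<partial>L) = (\<integral>\<^sup>+v. (\<integral>\<^sup>+x. ?h x u v \<partial>L) \<partial>L)"
      by (rule lp2.Fubini') (use u in measurable)
  qed
  also have "\<dots> = (\<integral>\<^sup>+u. (\<integral>\<^sup>+v. three_point u v * \<kappa> u v \<partial>L) \<partial>L)"
    unfolding three_point_def
    by (intro nn_integral_cong nn_integral_multc) measurable
  finally show ?thesis .
qed

lemma measurable_three_point [measurable]: "case_prod three_point \<in> borel_measurable (L \<Otimes>\<^sub>M L)"
proof -
  have [measurable (raw)]: "(\<lambda>w. f (X w)) \<in> borel_measurable N"
    if "X \<in> measurable N L" for X and N :: "'b measure"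
    using measurable_compose[OF that f_meas] .
  show ?thesis unfolding three_point_def split_beta' by measurable
qed

abbreviation pair_mass :: "((nat \<Rightarrow> real) \<Rightarrow> (nat \<Rightarrow> real) \<Rightarrow> ennreal) \<Rightarrow> ennreal" where
  "pair_mass \<kappa> \<equiv> (\<integral>\<^sup>+u. (\<integral>\<^sup>+v. \<kappa> u v \<partial>L) \<partial>L)"

text \<open>The number \<delta> depends on \<eta> but not on the kernel, so one choice serves all
  small radii. The lower bound is stated with a sum because subtraction in \<open>ennreal\<close> is
  truncated.\<close>

lemma three_mass_limit:
  assumes \<eta>: "\<eta> > 0"
  shows "\<exists>\<delta>>0. \<forall>\<kappa>. case_prod \<kappa> \<in> borel_measurable (L \<Otimes>\<^sub>M L) \<longrightarrow>
     (\<forall>u v. \<kappa> u v \<noteq> 0 \<longrightarrow> nrm d u \<le> \<delta> \<and> nrm d v \<le> \<delta>) \<longrightarrow>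
     three_mass \<kappa> \<le> ennreal (cube_mass + \<eta>) * pair_mass \<kappa> \<and>
     ennreal cube_mass * pair_mass \<kappa> \<le> three_mass \<kappa> + ennreal \<eta> * pair_mass \<kappa>"
proof -
  obtain \<delta> where \<delta>: "\<delta> > 0" "\<And>u v. nrm d u \<le> \<delta> \<Longrightarrow> nrm d v \<le> \<delta> \<Longrightarrow>
     three_point u v \<le> ennreal (cube_mass + \<eta>) \<and> ennreal cube_mass \<le> three_point u v + ennreal \<eta>"
    using three_point_limit[OF \<eta>] by metis
  show ?thesis
  proof (intro exI[of _ \<delta>] conjI[OF \<delta>(1)] allI impI)
    fix \<kappa> :: "(nat \<Rightarrow> real) \<Rightarrow> (nat \<Rightarrow> real) \<Rightarrow> ennreal"
    assume [measurable]: "case_prod \<kappa> \<in> borel_measurable (L \<Otimes>\<^sub>M L)"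
      and supp: "\<forall>u v. \<kappa> u v \<noteq> 0 \<longrightarrow> nrm d u \<le> \<delta> \<and> nrm d v \<le> \<delta>"
    let ?K = "pair_mass \<kappa>"
    have "three_mass \<kappa> \<le> (\<integral>\<^sup>+u. (\<integral>\<^sup>+v. ennreal (cube_mass + \<eta>) * \<kappa> u v \<partial>L) \<partial>L)"
      unfolding three_mass_eq[OF \<open>case_prod \<kappa> \<in> _\<close>]
    proof (intro nn_integral_mono)
      fix u v show "three_point u v * \<kappa> u v \<le> ennreal (cube_mass + \<eta>) * \<kappa> u v"
        using \<delta>(2)[of u v] supp by (cases "\<kappa> u v = 0") (auto intro!: mult_right_mono)
    qed
    also have "\<dots> = ennreal (cube_mass + \<eta>) * ?K"
      by (simp add: nn_integral_cmult cong: nn_integral_cong)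
    finally have upper: "three_mass \<kappa> \<le> ennreal (cube_mass + \<eta>) * ?K" .
    have "ennreal cube_mass * ?K = (\<integral>\<^sup>+u. (\<integral>\<^sup>+v. ennreal cube_mass * \<kappa> u v \<partial>L) \<partial>L)"
      by (simp add: nn_integral_cmult cong: nn_integral_cong)
    also have "\<dots> \<le> (\<integral>\<^sup>+u. (\<integral>\<^sup>+v. three_point u v * \<kappa> u v + ennreal \<eta> * \<kappa> u v \<partial>L) \<partial>L)"
    proof (intro nn_integral_mono)
      fix u v show "ennreal cube_mass * \<kappa> u v \<le> three_point u v * \<kappa> u v + ennreal \<eta> * \<kappa> u v"
        using \<delta>(2)[of u v] supp unfolding distrib_right[symmetric]
        by (cases "\<kappa> u v = 0") (auto intro!: mult_right_mono)
    qed
    also have "\<dots> = three_mass \<kappa> + ennreal \<eta> * ?K"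
      unfolding three_mass_eq[OF \<open>case_prod \<kappa> \<in> _\<close>]
      by (simp add: nn_integral_cmult nn_integral_add cong: nn_integral_cong)
    finally show "three_mass \<kappa> \<le> ennreal (cube_mass + \<eta>) * ?K \<and> ennreal cube_mass * ?K \<le> three_mass \<kappa> + ennreal \<eta> * ?K"
      using upper by simp
  qed
qed

end

section \<open>Wedge and triangle probabilities at a small radius\<close>

lemma nn_integral_tri_scale:
  assumes \<rho>: "\<rho> > 0"
  shows "(\<integral>\<^sup>+u. (\<integral>\<^sup>+v. indicator {v. nrm d u \<le> \<rho> \<and> nrm d v \<le> \<rho> \<and> eucl_dist d u v \<le> \<rho>} v \<partial>lebesgue_pow d) \<partial>lebesgue_pow d)
     = ennreal (\<rho> ^ (2 * d)) * tri_vol d"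
proof -
  let ?L = "lebesgue_pow d" and ?s = "aff d \<rho> (\<lambda>_. 0)"
  define E where "E = (\<lambda>\<rho> u v. (if nrm d u \<le> \<rho> \<and> nrm d v \<le> \<rho> \<and> eucl_dist d u v \<le> \<rho> then 1 else 0) :: ennreal)"
  have m [measurable]: "case_prod (E \<rho>) \<in> borel_measurable (?L \<Otimes>\<^sub>M ?L)" for \<rho>
    unfolding E_def by (simp add: split_beta')
  have s: "?s u \<in> space ?L" for u by simp
  have "(\<integral>\<^sup>+u. (\<integral>\<^sup>+v. E \<rho> u v \<partial>?L) \<partial>?L) = ennreal (\<bar>\<rho>\<bar> ^ d) * (\<integral>\<^sup>+u. (\<integral>\<^sup>+v. E \<rho> (?s u) v \<partial>?L) \<partial>?L)"
    using \<rho> by (intro nn_integral_affine) auto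
  also have "(\<integral>\<^sup>+u. (\<integral>\<^sup>+v. E \<rho> (?s u) v \<partial>?L) \<partial>?L) = (\<integral>\<^sup>+u. ennreal (\<bar>\<rho>\<bar> ^ d) * (\<integral>\<^sup>+v. E \<rho> (?s u) (?s v) \<partial>?L) \<partial>?L)"
    using \<rho> by (intro nn_integral_cong nn_integral_affine) auto
  also have "\<dots> = (\<integral>\<^sup>+u. ennreal (\<bar>\<rho>\<bar> ^ d) * (\<integral>\<^sup>+v. E 1 u v \<partial>?L) \<partial>?L)"
    using \<rho> by (intro nn_integral_cong arg_cong2[where f = "(*)"] refl)
      (auto simp: E_def nrm_aff_scale eucl_dist_aff_scale)
  also have "\<dots> = ennreal (\<bar>\<rho>\<bar> ^ d) * (\<integral>\<^sup>+u. (\<integral>\<^sup>+v. E 1 u v \<partial>?L) \<partial>?L)"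
    by (rule nn_integral_cmult) measurable
  also have "(\<integral>\<^sup>+u. (\<integral>\<^sup>+v. E 1 u v \<partial>?L) \<partial>?L) = tri_vol d"
    unfolding tri_vol_def by (intro nn_integral_cong) (auto simp: E_def indicator_def)
  also have "ennreal (\<bar>\<rho>\<bar> ^ d) * (ennreal (\<bar>\<rho>\<bar> ^ d) * tri_vol d) = ennreal (\<rho> ^ (2 * d)) * tri_vol d"
    using \<rho> by (simp add: mult.assoc[symmetric] ennreal_mult'[symmetric] mult_2 power_add)
  finally show ?thesis
    by (simp add: E_def indicator_def of_bool_def)
qed

lemma nn_integral_wedge_scale:
  assumes \<rho>: "\<rho> > 0"
  shows "(\<integral>\<^sup>+u. (\<integral>\<^sup>+v. indicator {v. nrm d u \<le> \<rho> \<and> nrm d v \<le> \<rho>} v \<partial>lebesgue_pow d) \<partial>lebesgue_pow d)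
     = ennreal (\<rho> ^ (2 * d)) * (ball_vol d 1 * ball_vol d 1)"
proof -
  let ?L = "lebesgue_pow d"
  have "(\<integral>\<^sup>+u. (\<integral>\<^sup>+v. indicator {v. nrm d u \<le> \<rho> \<and> nrm d v \<le> \<rho>} v \<partial>?L) \<partial>?L)
     = (\<integral>\<^sup>+u. (\<integral>\<^sup>+v. indicator {u. nrm d u \<le> \<rho>} u * indicator {u. nrm d u \<le> \<rho>} v \<partial>?L) \<partial>?L)"
    by (intro nn_integral_cong) (auto simp: indicator_def)
  also have "\<dots> = ball_vol d \<rho> * ball_vol d \<rho>"
    by (simp add: nn_integral_cmult nn_integral_multc flip: ball_vol_nn)
  also have "\<dots> = (ennreal (\<rho> ^ d) * ennreal (\<rho> ^ d)) * (ball_vol d 1 * ball_vol d 1)"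
    by (simp add: ball_vol_scale[OF \<rho>] mult_ac)
  also have "ennreal (\<rho> ^ d) * ennreal (\<rho> ^ d) = ennreal (\<rho> ^ (2 * d))"
    using \<rho> by (simp add: ennreal_mult'[symmetric] mult_2 power_add)
  finally show ?thesis .
qed

context fifth_power_density begin

definition M :: "(nat \<Rightarrow> real) measure" where "M = density L (\<lambda>x. ennreal (f x))"

lemma sets_M [measurable_cong, simp]: "sets M = sets L" by (simp add: M_def)
lemma space_M [simp]: "space M = space L" by (simp add: M_def)

lemma prob_space_M: "prob_space M"
  by (rule prob_spaceI) (simp add: M_def emeasure_density f_int cong: nn_integral_cong)

sublocale M: prob_space M by (rule prob_space_M)

lemma nn_integral_M: "g \<in> borel_measurable L \<Longrightarrow> (\<integral>\<^sup>+x. g x \<partial>M) = (\<integral>\<^sup>+x. ennreal (f x) * g x \<partial>L)"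
  unfolding M_def by (rule nn_integral_density) auto

abbreviation triple_int :: "((nat \<Rightarrow> real) \<Rightarrow> (nat \<Rightarrow> real) \<Rightarrow> (nat \<Rightarrow> real) \<Rightarrow> real) \<Rightarrow> ennreal" where
  "triple_int H \<equiv> (\<integral>\<^sup>+x. (\<integral>\<^sup>+y. (\<integral>\<^sup>+z. ennreal (H x y z) \<partial>M) \<partial>M) \<partial>M)"

definition wedge_ker :: "real \<Rightarrow> (nat \<Rightarrow> real) \<Rightarrow> (nat \<Rightarrow> real) \<Rightarrow> (nat \<Rightarrow> real) \<Rightarrow> real" where
  "wedge_ker \<rho> x y z = of_bool (eucl_dist d x y \<le> \<rho> \<and> eucl_dist d x z \<le> \<rho>)"

definition tri_ker :: "real \<Rightarrow> (nat \<Rightarrow> real) \<Rightarrow> (nat \<Rightarrow> real) \<Rightarrow> (nat \<Rightarrow> real) \<Rightarrow> real" where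
  "tri_ker \<rho> x y z = of_bool (eucl_dist d x y \<le> \<rho> \<and> eucl_dist d x z \<le> \<rho> \<and> eucl_dist d y z \<le> \<rho>)"

lemma measurable_kers [measurable]:
  "(\<lambda>(x, y, z). wedge_ker \<rho> x y z) \<in> borel_measurable (L \<Otimes>\<^sub>M L \<Otimes>\<^sub>M L)"
  "(\<lambda>(x, y, z). tri_ker \<rho> x y z) \<in> borel_measurable (L \<Otimes>\<^sub>M L \<Otimes>\<^sub>M L)"
  unfolding wedge_ker_def tri_ker_def split_beta' by measurable

lemma nn_integral_M3:
  fixes H :: "_ \<Rightarrow> _ \<Rightarrow> _ \<Rightarrow> real"
  assumes H: "(\<lambda>(x, y, z). H x y z) \<in> borel_measurable (L \<Otimes>\<^sub>M L \<Otimes>\<^sub>M L)"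
    and \<kappa>: "\<And>x y z. ennreal (H x y z) = \<kappa> (aff d (-1) y x) (aff d (-1) z x)"
  shows "triple_int H = three_mass \<kappa>"
proof -
  have [measurable (raw)]: "(\<lambda>w. H (X w) (Y w) (Z w)) \<in> borel_measurable N"
    if "X \<in> measurable N L" "Y \<in> measurable N L" "Z \<in> measurable N L" for X Y Z and N :: "'b measure"
  proof -
    have "(\<lambda>w. (X w, Y w, Z w)) \<in> measurable N (L \<Otimes>\<^sub>M L \<Otimes>\<^sub>M L)" using that by measurable
    from measurable_compose[OF this H] show ?thesis by simp
  qed
  have [measurable (raw)]: "(\<lambda>w. f (X w)) \<in> borel_measurable N"
    if "X \<in> measurable N L" for X and N :: "'b measure"
    using measurable_compose[OF that f_meas] .
  have "triple_int H =
     (\<integral>\<^sup>+x. ennreal (f x) * (\<integral>\<^sup>+y. ennreal (f y) * (\<integral>\<^sup>+z. ennreal (f z) * ennreal (H x y z) \<partial>L) \<partial>L) \<partial>L)"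
    by (simp add: nn_integral_M cong: nn_integral_cong)
  also have "\<dots> = three_mass \<kappa>"
    unfolding three_mass_def \<kappa>[symmetric]
    by (simp add: nn_integral_cmult[symmetric] mult.assoc cong: nn_integral_cong)
  finally show ?thesis .
qed

lemma eucl_dist_diff: "eucl_dist d (aff d (-1) y x) (aff d (-1) z x) = eucl_dist d y z"
  and nrm_diff: "nrm d (aff d (-1) y x) = eucl_dist d x y"
  by (simp_all add: eucl_dist_def L2_set_def power2_commute)

definition bvol :: real where "bvol = enn2real (ball_vol d 1)"

lemma bvol: "ball_vol d 1 = ennreal bvol" "bvol > 0"
  using ball_vol_pos[of 1 d] ball_vol_finite[of d 1] by (simp_all add: bvol_def enn2real_positive_iff)

text \<open>The common core of the wedge and triangle estimates; \<open>s\<close> is the volume of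
  the kernel at radius 1. Naming the expectation as a real \<open>p\<close> permits a two-sided
  error bound.\<close>

lemma three_mass_real_limit:
  fixes H :: "real \<Rightarrow> _ \<Rightarrow> _ \<Rightarrow> _ \<Rightarrow> real" and \<kappa> :: "real \<Rightarrow> _ \<Rightarrow> _ \<Rightarrow> ennreal"
  assumes H [measurable]: "\<And>\<rho>. (\<lambda>(x, y, z). H \<rho> x y z) \<in> borel_measurable (L \<Otimes>\<^sub>M L \<Otimes>\<^sub>M L)"
    and H\<kappa>: "\<And>\<rho> x y z. ennreal (H \<rho> x y z) = \<kappa> \<rho> (aff d (-1) y x) (aff d (-1) z x)"
    and \<kappa> [measurable]: "\<And>\<rho>. case_prod (\<kappa> \<rho>) \<in> borel_measurable (L \<Otimes>\<^sub>M L)"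
    and supp: "\<And>\<rho> u v. \<kappa> \<rho> u v \<noteq> 0 \<Longrightarrow> nrm d u \<le> \<rho> \<and> nrm d v \<le> \<rho>"
    and s: "s \<ge> 0" "\<And>\<rho>. \<rho> > 0 \<Longrightarrow> pair_mass (\<kappa> \<rho>) = ennreal (\<rho> ^ (2 * d)) * ennreal s"
    and \<eta>: "\<eta> > 0"
  shows "\<exists>\<delta>>0. \<forall>\<rho>. 0 < \<rho> \<longrightarrow> \<rho> \<le> \<delta> \<longrightarrow>
    (\<exists>p. triple_int (H \<rho>) = ennreal p \<and> p \<ge> 0 \<and>
      \<bar>p - cube_mass * s * \<rho> ^ (2 * d)\<bar> \<le> \<eta> * \<rho> ^ (2 * d))"
proof -
  \<comment> \<open>Dividing by s + 1 keeps the error times s below \<eta> and remains meaningful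
    for s = 0.\<close>
  let ?\<eta> = "\<eta> / (s + 1)"
  have \<eta>': "?\<eta> > 0" using \<eta> s(1) by simp
  obtain \<delta> where \<delta>: "\<delta> > 0" "\<And>\<kappa>. case_prod \<kappa> \<in> borel_measurable (L \<Otimes>\<^sub>M L) \<Longrightarrow>
     (\<forall>u v. \<kappa> u v \<noteq> 0 \<longrightarrow> nrm d u \<le> \<delta> \<and> nrm d v \<le> \<delta>) \<Longrightarrow>
     three_mass \<kappa> \<le> ennreal (cube_mass + ?\<eta>) * pair_mass \<kappa> \<and>
     ennreal cube_mass * pair_mass \<kappa> \<le> three_mass \<kappa> + ennreal ?\<eta> * pair_mass \<kappa>"
    using three_mass_limit[OF \<eta>'] by metis
  show ?thesis
  proof (rule exI[of _ \<delta>], intro conjI[OF \<delta>(1)] allI impI)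
    fix \<rho> :: real assume \<rho>: "0 < \<rho>" "\<rho> \<le> \<delta>"
    let ?k = "s * \<rho> ^ (2 * d)"
    have k0: "?k \<ge> 0" using s(1) \<rho> by simp
    have K: "pair_mass (\<kappa> \<rho>) = ennreal ?k"
      using s(2)[OF \<rho>(1)] s(1) \<rho> by (simp add: ennreal_mult'[symmetric] mult.commute)
    have "\<forall>u v. \<kappa> \<rho> u v \<noteq> 0 \<longrightarrow> nrm d u \<le> \<delta> \<and> nrm d v \<le> \<delta>"
      using supp[of \<rho>] \<rho>(2) by (meson order_trans)
    from \<delta>(2)[OF \<kappa> this] have
      ub: "three_mass (\<kappa> \<rho>) \<le> ennreal ((cube_mass + ?\<eta>) * ?k)" and
      lb: "ennreal (cube_mass * ?k) \<le> three_mass (\<kappa> \<rho>) + ennreal (?\<eta> * ?k)"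
      unfolding K using cube_mass_pos \<eta>' k0 by (simp_all add: ennreal_mult'[symmetric] ennreal_mult''[symmetric] del: ennreal_plus)
    define p where "p = enn2real (three_mass (\<kappa> \<rho>))"
    have p: "three_mass (\<kappa> \<rho>) = ennreal p" "p \<ge> 0"
      unfolding p_def using ub by (auto simp: ennreal_enn2real_if top_unique)
    have nn: "0 \<le> (cube_mass + ?\<eta>) * ?k" "0 \<le> ?\<eta> * ?k"
      by (rule mult_nonneg_nonneg[OF add_nonneg_nonneg[OF less_imp_le[OF cube_mass_pos] less_imp_le[OF \<eta>']] k0],
          rule mult_nonneg_nonneg[OF less_imp_le[OF \<eta>'] k0])
    have 1: "p \<le> (cube_mass + ?\<eta>) * ?k" using ub nn unfolding p by simp
    have 2: "cube_mass * ?k \<le> p + ?\<eta> * ?k"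
      using lb nn p(2) unfolding p by (simp add: ennreal_plus[symmetric] del: ennreal_plus)
    have "?\<eta> * ?k \<le> \<eta> * \<rho> ^ (2 * d)"
    proof -
      have "?\<eta> * s \<le> \<eta>" using \<eta> s(1) by (simp add: field_simps)
      then show ?thesis using \<rho> mult_right_mono[of "?\<eta> * s" \<eta> "\<rho> ^ (2 * d)"] by (simp add: mult.assoc)
    qed
    then have "\<bar>p - cube_mass * s * \<rho> ^ (2 * d)\<bar> \<le> \<eta> * \<rho> ^ (2 * d)"
      using 1 2 unfolding distrib_right mult.assoc abs_le_iff by linarith
    moreover have "triple_int (H \<rho>) = ennreal p"
      using nn_integral_M3[OF H H\<kappa>] p by simp
    ultimately show "\<exists>p. triple_int (H \<rho>) = ennreal p \<and> p \<ge> 0 \<and>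
      \<bar>p - cube_mass * s * \<rho> ^ (2 * d)\<bar> \<le> \<eta> * \<rho> ^ (2 * d)"
      using p(2) by blast
  qed
qed

lemma wedge_prob_limit:
  assumes \<eta>: "\<eta> > 0"
  shows "\<exists>\<delta>>0. \<forall>\<rho>. 0 < \<rho> \<longrightarrow> \<rho> \<le> \<delta> \<longrightarrow>
    (\<exists>p. triple_int (wedge_ker \<rho>) = ennreal p \<and> p \<ge> 0 \<and>
      \<bar>p - cube_mass * bvol\<^sup>2 * \<rho> ^ (2 * d)\<bar> \<le> \<eta> * \<rho> ^ (2 * d))"
proof (rule three_mass_real_limit[OF measurable_kers(1) _ _ _ _ _ \<eta>,
      where \<kappa> = "\<lambda>\<rho> u v. indicator {v. nrm d u \<le> \<rho> \<and> nrm d v \<le> \<rho>} v"])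
  fix \<rho> :: real and x y z
  show "ennreal (wedge_ker \<rho> x y z) = indicator {v. nrm d (aff d (-1) y x) \<le> \<rho> \<and> nrm d v \<le> \<rho>} (aff d (-1) z x)"
    by (simp add: wedge_ker_def nrm_diff indicator_def)
  show "(\<lambda>(u, v). indicator {v. nrm d u \<le> \<rho> \<and> nrm d v \<le> \<rho>} v :: ennreal) \<in> borel_measurable (L \<Otimes>\<^sub>M L)"
    unfolding indicator_def mem_Collect_eq split_beta' by measurable
  assume "\<rho> > 0"
  then show "(\<integral>\<^sup>+u. (\<integral>\<^sup>+v. indicator {v. nrm d u \<le> \<rho> \<and> nrm d v \<le> \<rho>} v \<partial>L) \<partial>L) = ennreal (\<rho> ^ (2 * d)) * ennreal (bvol\<^sup>2)"
    using nn_integral_wedge_scale[of \<rho> d] bvol by (simp add: ennreal_mult'[symmetric] power2_eq_square)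
qed (auto simp: indicator_def split: if_splits)

lemma tri_prob_limit:
  assumes \<eta>: "\<eta> > 0"
  shows "\<exists>\<delta>>0. \<forall>\<rho>. 0 < \<rho> \<longrightarrow> \<rho> \<le> \<delta> \<longrightarrow>
    (\<exists>p. triple_int (tri_ker \<rho>) = ennreal p \<and> p \<ge> 0 \<and>
      \<bar>p - cube_mass * (clustering d * bvol\<^sup>2) * \<rho> ^ (2 * d)\<bar> \<le> \<eta> * \<rho> ^ (2 * d))"
proof (rule three_mass_real_limit[OF measurable_kers(2) _ _ _ _ _ \<eta>,
      where \<kappa> = "\<lambda>\<rho> u v. indicator {v. nrm d u \<le> \<rho> \<and> nrm d v \<le> \<rho> \<and> eucl_dist d u v \<le> \<rho>} v"])
  fix \<rho> :: real and x y z
  show "ennreal (tri_ker \<rho> x y z) = indicator {v. nrm d (aff d (-1) y x) \<le> \<rho> \<and> nrm d v \<le> \<rho> \<and>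
      eucl_dist d (aff d (-1) y x) v \<le> \<rho>} (aff d (-1) z x)"
    by (simp add: tri_ker_def nrm_diff eucl_dist_diff indicator_def)
  show "(\<lambda>(u, v). indicator {v. nrm d u \<le> \<rho> \<and> nrm d v \<le> \<rho> \<and> eucl_dist d u v \<le> \<rho>} v :: ennreal) \<in> borel_measurable (L \<Otimes>\<^sub>M L)"
    unfolding indicator_def mem_Collect_eq split_beta' by measurable
  show "0 \<le> clustering d * bvol\<^sup>2" using clustering_nonneg by simp
  assume "\<rho> > 0"
  then show "(\<integral>\<^sup>+u. (\<integral>\<^sup>+v. indicator {v. nrm d u \<le> \<rho> \<and> nrm d v \<le> \<rho> \<and> eucl_dist d u v \<le> \<rho>} v \<partial>L) \<partial>L)
     = ennreal (\<rho> ^ (2 * d)) * ennreal (clustering d * bvol\<^sup>2)"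
    using nn_integral_tri_scale[of \<rho> d] bvol tri_vol_eq_clustering[OF d] clustering_nonneg[of d]
    by (simp add: ennreal_mult'[symmetric] ennreal_mult''[symmetric] power2_eq_square)
qed (auto simp: indicator_def split: if_splits)

text \<open>By convexity the graph of t^5 lies above its tangent at s. Integrated over a ball, with
  s the average of f there, this becomes Jensen's inequality.\<close>

lemma fifth_power_tangent: "5 * s ^ 4 * t \<le> t ^ 5 + 4 * s ^ 5" if "s \<ge> 0" "t \<ge> 0" for s t :: real
proof -
  have "t ^ 5 + 4 * s ^ 5 - 5 * s ^ 4 * t = (t - s)\<^sup>2 * (t ^ 3 + 2 * t\<^sup>2 * s + 3 * t * s\<^sup>2 + 4 * s ^ 3)"
    by (simp add: eval_nat_numeral algebra_simps)
  also have "\<dots> \<ge> 0" using that by (intro mult_nonneg_nonneg add_nonneg_nonneg) auto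
  finally show ?thesis by simp
qed

definition nbhd_mass :: "real \<Rightarrow> (nat \<Rightarrow> real) \<Rightarrow> ennreal" where
  "nbhd_mass \<rho> x = (\<integral>\<^sup>+y. indicator {y. eucl_dist d x y \<le> \<rho>} y \<partial>M)"

definition mass5 :: real where "mass5 = enn2real (\<integral>\<^sup>+x. ennreal (f x ^ 5) \<partial>L)"

lemma mass5: "(\<integral>\<^sup>+x. ennreal (f x ^ 5) \<partial>L) = ennreal mass5" "mass5 \<ge> 0"
  using f5 by (simp_all add: mass5_def)

lemma measurable_nbhd_mass [measurable]: "nbhd_mass \<rho> \<in> borel_measurable L"
proof -
  have "(\<lambda>x. \<integral>\<^sup>+y. indicator {y. eucl_dist d x y \<le> \<rho>} y \<partial>M) \<in> borel_measurable L"
    unfolding indicator_def mem_Collect_eq by measurable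
  then show ?thesis unfolding nbhd_mass_def[abs_def] .
qed

lemma ball_vol_center:
  assumes "x \<in> space L"
  shows "(\<integral>\<^sup>+y. indicator {y. eucl_dist d x y \<le> \<rho>} y \<partial>L) = ball_vol d \<rho>"
proof -
  have "(\<integral>\<^sup>+y. indicator {y. eucl_dist d x y \<le> \<rho>} y \<partial>L) = (\<integral>\<^sup>+u. indicator {y. eucl_dist d x y \<le> \<rho>} (aff d 1 x u) \<partial>L)"
    using assms by (intro nn_integral_translate[symmetric]) measurable
  also have "\<dots> = ball_vol d \<rho>"
    unfolding ball_vol_nn by (intro nn_integral_cong) (simp add: indicator_def eucl_dist_def L2_set_def)
  finally show ?thesis .
qed

text \<open>Let b x be the average of f over the ball around x. Jensen and Fubini bound the integral
  of b^5 by that of f^5, and pointwise f b^k <= f + f b^4 <= f + f^5 + b^5, hence the factor 1 + 2 *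
  \<open>mass5\<close>. The exponent k = 4 is what consumes the fifth moment.\<close>

lemma nbhd_mass_power:
  assumes \<rho>: "\<rho> > 0" and k: "k \<le> 4"
  shows "(\<integral>\<^sup>+x. nbhd_mass \<rho> x ^ k \<partial>M) \<le> ennreal ((\<rho> ^ d * bvol) ^ k * (1 + 2 * mass5))"
proof -
  define v where "v = \<rho> ^ d * bvol"
  have v: "v > 0" "ball_vol d \<rho> = ennreal v" using \<rho> bvol by (simp_all add: v_def ball_vol_scale[OF \<rho>] ennreal_mult')
  let ?I = "\<lambda>x y. indicator {y. eucl_dist d x y \<le> \<rho>} y :: ennreal"
  have mI [measurable]: "case_prod ?I \<in> borel_measurable (L \<Otimes>\<^sub>M L)"
    unfolding indicator_def mem_Collect_eq split_beta' by measurable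
  define b where "b x = enn2real (nbhd_mass \<rho> x) / v" for x
  have b: "nbhd_mass \<rho> x = ennreal (b x * v)" "b x \<ge> 0" for x
  proof -
    have "nbhd_mass \<rho> x \<le> (\<integral>\<^sup>+y. 1 \<partial>M)" unfolding nbhd_mass_def
      by (intro nn_integral_mono) (auto simp: indicator_def)
    then have "nbhd_mass \<rho> x < top" using M.emeasure_space_1 by (simp add: le_less_trans)
    then show "nbhd_mass \<rho> x = ennreal (b x * v)" "b x \<ge> 0" using v by (auto simp: b_def)
  qed
  have bm [measurable]: "b \<in> borel_measurable L" unfolding b_def by measurable
  let ?G = "\<lambda>x. \<integral>\<^sup>+y. ?I x y * ennreal (f y ^ 5) \<partial>L"
  \<comment> \<open>The tangent inequality at s = b x integrates over the ball to 5 b^5 v <= G + 4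
    b^5 v, and the finite term 4 b^5 v cancels.\<close>
  have G: "ennreal (b x ^ 5 * v) \<le> ?G x" if x: "x \<in> space L" for x
  proof -
    have mx [measurable]: "?I x \<in> borel_measurable L" using x by measurable
    have "(\<integral>\<^sup>+y. ennreal (5 * b x ^ 4) * (ennreal (f y) * ?I x y) \<partial>L) \<le> (\<integral>\<^sup>+y. ?I x y * ennreal (f y ^ 5) + ennreal (4 * b x ^ 5) * ?I x y \<partial>L)"
    proof (intro nn_integral_mono)
      fix y assume y: "y \<in> space L"
      have "ennreal (5 * b x ^ 4 * f y) \<le> ennreal (f y ^ 5 + 4 * b x ^ 5)"
        using fifth_power_tangent[OF b(2) f_nonneg[OF y], of x] by (rule ennreal_leI)
      then show "ennreal (5 * b x ^ 4) * (ennreal (f y) * ?I x y) \<le> ?I x y * ennreal (f y ^ 5) + ennreal (4 * b x ^ 5) * ?I x y"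
        using f_nonneg[OF y] b(2)[of x] by (auto simp: indicator_def ennreal_mult'[symmetric])
    qed
    also have "\<dots> = ?G x + ennreal (4 * b x ^ 5) * ennreal v"
      by (simp add: nn_integral_add nn_integral_cmult ball_vol_center[OF x] v(2))
    also have "(\<integral>\<^sup>+y. ennreal (5 * b x ^ 4) * (ennreal (f y) * ?I x y) \<partial>L) = ennreal (5 * b x ^ 4) * nbhd_mass \<rho> x"
      unfolding nbhd_mass_def by (subst nn_integral_M) (auto simp: nn_integral_cmult)
    finally have le: "ennreal (5 * b x ^ 4) * ennreal (b x * v) \<le> ?G x + ennreal (4 * b x ^ 5 * v)"
      unfolding b(1)[symmetric] using v b(2)[of x] by (simp add: ennreal_mult'')
    have "ennreal (4 * b x ^ 5 * v) + ennreal (b x ^ 5 * v) = ennreal (5 * b x ^ 4) * ennreal (b x * v)"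
      using v b(2)[of x] by (simp add: ennreal_plus[symmetric] ennreal_mult''[symmetric] eval_nat_numeral algebra_simps del: ennreal_plus)
    also note le
    finally show ?thesis
      by (subst (asm) add.commute[of "?G x"]) (simp only: ennreal_add_left_cancel_le, simp)
  qed
  have "(\<integral>\<^sup>+x. ennreal (b x ^ 5) \<partial>L) * ennreal v = (\<integral>\<^sup>+x. ennreal (b x ^ 5 * v) \<partial>L)"
    using v b(2) by (subst nn_integral_multc[symmetric]) (auto simp: ennreal_mult'')
  also have "\<dots> \<le> (\<integral>\<^sup>+x. ?G x \<partial>L)"
    by (intro nn_integral_mono G)
  also have "\<dots> = (\<integral>\<^sup>+y. (\<integral>\<^sup>+x. ?I x y * ennreal (f y ^ 5) \<partial>L) \<partial>L)"
    by (rule lp2.Fubini') measurable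
  also have "\<dots> = (\<integral>\<^sup>+y. ennreal v * ennreal (f y ^ 5) \<partial>L)"
  proof (rule nn_integral_cong)
    fix y assume y: "y \<in> space L"
    have [measurable]: "(\<lambda>x. ?I x y) \<in> borel_measurable L" using y by measurable
    have "(\<integral>\<^sup>+x. ?I x y * ennreal (f y ^ 5) \<partial>L) = (\<integral>\<^sup>+x. ?I x y \<partial>L) * ennreal (f y ^ 5)"
      by (rule nn_integral_multc) measurable
    also have "(\<integral>\<^sup>+x. ?I x y \<partial>L) = (\<integral>\<^sup>+x. ?I y x \<partial>L)"
      by (simp add: indicator_def eucl_dist_commute)
    also have "\<dots> = ennreal v" by (simp add: ball_vol_center[OF y] v)
    finally show "(\<integral>\<^sup>+x. ?I x y * ennreal (f y ^ 5) \<partial>L) = ennreal v * ennreal (f y ^ 5)" .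
  qed
  also have "\<dots> = ennreal mass5 * ennreal v"
    by (simp add: nn_integral_cmult mass5 mult.commute)
  finally have "ennreal v * (\<integral>\<^sup>+x. ennreal (b x ^ 5) \<partial>L) \<le> ennreal v * ennreal mass5"
    by (simp only: mult.commute[of "ennreal v"])
  then have b5: "(\<integral>\<^sup>+x. ennreal (b x ^ 5) \<partial>L) \<le> ennreal mass5"
    using v by (subst (asm) ennreal_mult_le_mult_iff) auto
  have "(\<integral>\<^sup>+x. nbhd_mass \<rho> x ^ k \<partial>M) = (\<integral>\<^sup>+x. ennreal (f x) * nbhd_mass \<rho> x ^ k \<partial>L)"
    by (rule nn_integral_M) measurable
  also have "\<dots> \<le> (\<integral>\<^sup>+x. ennreal (v ^ k) * (ennreal (f x) + (ennreal (f x ^ 5) + ennreal (b x ^ 5))) \<partial>L)"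
  proof (intro nn_integral_mono)
    fix x assume x: "x \<in> space L"
    have f0: "f x \<ge> 0" and b0: "b x \<ge> 0" using f_nonneg[OF x] b by auto
    have "b x ^ k \<le> 1 + b x ^ 4"
    proof (cases "b x \<le> 1")
      case True
      then have "b x ^ k \<le> 1" using b0 by (intro power_le_one)
      then show ?thesis using b0 by (simp add: add_increasing2)
    next
      case False
      then have "b x ^ k \<le> b x ^ 4" using k by (intro power_increasing) auto
      then show ?thesis by simp
    qed
    then have "f x * b x ^ k \<le> f x + f x * b x ^ 4"
      using mult_left_mono[OF _ f0, of "b x ^ k" "1 + b x ^ 4"] by (simp add: distrib_left)
    also have "f x * b x ^ 4 \<le> f x ^ 5 + b x ^ 5"
    proof (cases "f x \<le> b x")
      case True
      then have "f x * b x ^ 4 \<le> b x * b x ^ 4" using b0 by (intro mult_right_mono) auto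
      then show ?thesis using f0 by (simp add: eval_nat_numeral add_increasing)
    next
      case False
      then have "f x * b x ^ 4 \<le> f x * f x ^ 4" using b0 f0 by (intro mult_left_mono power_mono) auto
      then show ?thesis using b0 by (simp add: eval_nat_numeral add_increasing2)
    qed
    finally have "f x * b x ^ k * v ^ k \<le> (f x + (f x ^ 5 + b x ^ 5)) * v ^ k"
      using v by (intro mult_right_mono) auto
    then have "ennreal (f x * b x ^ k * v ^ k) \<le> ennreal (v ^ k * (f x + (f x ^ 5 + b x ^ 5)))"
      by (intro ennreal_leI) (simp add: mult.commute)
    then show "ennreal (f x) * nbhd_mass \<rho> x ^ k \<le> ennreal (v ^ k) * (ennreal (f x) + (ennreal (f x ^ 5) + ennreal (b x ^ 5)))"
      unfolding b(1) using f0 b0 v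
      by (simp add: ennreal_power ennreal_mult'[symmetric] ennreal_plus[symmetric] power_mult_distrib mult.assoc del: ennreal_plus)
  qed
  also have "\<dots> = ennreal (v ^ k) * (1 + (ennreal mass5 + (\<integral>\<^sup>+x. ennreal (b x ^ 5) \<partial>L)))"
    by (simp add: nn_integral_cmult nn_integral_add f_int mass5)
  also have "\<dots> \<le> ennreal (v ^ k) * (1 + (ennreal mass5 + ennreal mass5))"
    by (intro mult_left_mono add_left_mono b5) auto
  also have "\<dots> = ennreal (v ^ k * (1 + 2 * mass5))"
  proof -
    have "1 + (ennreal mass5 + ennreal mass5) = ennreal (1 + 2 * mass5)"
      using mass5(2) by (simp add: ennreal_mult' flip: mult_2)
    then show ?thesis using v mass5(2) by (simp add: ennreal_mult' del: ennreal_plus)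
  qed
  finally show ?thesis by (simp add: v_def)
qed

end

section \<open>Triangles and wedges in the sample\<close>

definition verts :: "nat \<times> nat \<times> nat \<Rightarrow> nat set" where
  "verts = (\<lambda>(i, j, k). {i, j, k})"

definition triples :: "nat \<Rightarrow> (nat \<times> nat \<times> nat) set" where
  "triples n = (SIGMA i:{..<n}. SIGMA j:{..<n} - {i}. {..<n} - {i, j})"

lemma triples_iff: "(i, j, k) \<in> triples n \<longleftrightarrow> i < n \<and> j < n \<and> k < n \<and> i \<noteq> j \<and> i \<noteq> k \<and> j \<noteq> k"
  by (auto simp: triples_def)

lemma finite_triples [simp]: "finite (triples n)"
  by (simp add: triples_def)

lemma card_triples: "card (triples n) = n * ((n - 1) * (n - 2))"
proof -
  have "card (triples n) = (\<Sum>i<n. card (SIGMA j:{..<n} - {i}. {..<n} - {i, j}))"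
    unfolding triples_def by (rule card_SigmaI) auto
  also have "\<dots> = (\<Sum>i<n. (n - 1) * (n - 2))"
  proof (intro sum.cong refl)
    fix i assume i: "i \<in> {..<n}"
    have "card (SIGMA j:{..<n} - {i}. {..<n} - {i, j}) = (\<Sum>j\<in>{..<n} - {i}. card ({..<n} - {i, j}))"
      by (rule card_SigmaI) auto
    also have "\<dots> = (\<Sum>j\<in>{..<n} - {i}. n - 2)"
      using i by (intro sum.cong refl) (auto simp: card_Diff_subset)
    finally show "card (SIGMA j:{..<n} - {i}. {..<n} - {i, j}) = (n - 1) * (n - 2)"
      using i by simp
  qed
  finally show ?thesis by simp
qed

lemma verts_triples: "\<tau> \<in> triples n \<Longrightarrow> verts \<tau> \<subseteq> {..<n}" "\<tau> \<in> triples n \<Longrightarrow> card (verts \<tau>) = 3"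
  by (cases \<tau>; auto simp: triples_iff verts_def)+

section \<open>Expectations of kernels under the product law\<close>

context fifth_power_density begin

sublocale PM: product_sigma_finite "\<lambda>_::nat. M"
  by unfold_locales

abbreviation "P n \<equiv> Pi\<^sub>M {..<n} (\<lambda>_::nat. M)"

lemma prob_space_PiM_M: "prob_space (Pi\<^sub>M I (\<lambda>_::nat. M))"
  by (rule prob_space_PiM) (rule prob_space_M)

lemma coord_P: "i < n \<Longrightarrow> (\<lambda>w. w i) \<in> measurable (P n) L"
proof -
  assume "i < n"
  then have "(\<lambda>w. w i) \<in> measurable (P n) M" by (intro measurable_component_singleton) simp
  then show ?thesis by (simp add: measurable_cong_sets[OF refl sets_M])
qed

text \<open>The three coordinates are split off one at a time; the remaining ones form a probability
  space and integrate to 1.\<close>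

lemma nn_integral_P_three:
  fixes H :: "_ \<Rightarrow> _ \<Rightarrow> _ \<Rightarrow> real"
  assumes H: "(\<lambda>(x, y, z). H x y z) \<in> borel_measurable (L \<Otimes>\<^sub>M L \<Otimes>\<^sub>M L)"
    and ijk: "i < n" "j < n" "k < n" "i \<noteq> j" "i \<noteq> k" "j \<noteq> k"
  shows "(\<integral>\<^sup>+w. ennreal (H (w i) (w j) (w k)) \<partial>P n) = triple_int H"
proof -
  define R where "R = {..<n} - {i, j, k}"
  have R: "finite R" "k \<notin> R" "j \<notin> insert k R" "i \<notin> insert j (insert k R)" "{..<n} = insert i (insert j (insert k R))"
    using ijk by (auto simp: R_def)
  have HM [measurable (raw)]: "(\<lambda>w. H (X w) (Y w) (Z w)) \<in> borel_measurable N"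
    if "X \<in> measurable N M" "Y \<in> measurable N M" "Z \<in> measurable N M" for X Y Z and N :: "'b measure"
  proof -
    have "X \<in> measurable N L" "Y \<in> measurable N L" "Z \<in> measurable N L"
      using that by (simp_all add: measurable_cong_sets[OF refl sets_M])
    then have "(\<lambda>w. (X w, Y w, Z w)) \<in> measurable N (L \<Otimes>\<^sub>M L \<Otimes>\<^sub>M L)" by measurable
    from measurable_compose[OF this H] show ?thesis by simp
  qed
  have "(\<integral>\<^sup>+w. ennreal (H (w i) (w j) (w k)) \<partial>P n) =
    (\<integral>\<^sup>+x. (\<integral>\<^sup>+w. ennreal (H ((w(i := x)) i) ((w(i := x)) j) ((w(i := x)) k)) \<partial>Pi\<^sub>M (insert j (insert k R)) (\<lambda>_. M)) \<partial>M)"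
    unfolding R(5) using R by (intro PM.product_nn_integral_insert_rev) (auto intro!: measurable_compose[OF _ measurable_ennreal] HM)
  also have "\<dots> = (\<integral>\<^sup>+x. (\<integral>\<^sup>+w. ennreal (H x (w j) (w k)) \<partial>Pi\<^sub>M (insert j (insert k R)) (\<lambda>_. M)) \<partial>M)"
    using ijk by simp
  also have "\<dots> = (\<integral>\<^sup>+x. (\<integral>\<^sup>+y. (\<integral>\<^sup>+w. ennreal (H x y (w k)) \<partial>Pi\<^sub>M (insert k R) (\<lambda>_. M)) \<partial>M) \<partial>M)"
  proof (rule nn_integral_cong)
    fix x assume x: "x \<in> space M"
    have "(\<integral>\<^sup>+w. ennreal (H x (w j) (w k)) \<partial>Pi\<^sub>M (insert j (insert k R)) (\<lambda>_. M)) =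
      (\<integral>\<^sup>+y. (\<integral>\<^sup>+w. ennreal (H x ((w(j := y)) j) ((w(j := y)) k)) \<partial>Pi\<^sub>M (insert k R) (\<lambda>_. M)) \<partial>M)"
      using R x by (intro PM.product_nn_integral_insert_rev) (auto intro!: measurable_compose[OF _ measurable_ennreal] HM)
    then show "(\<integral>\<^sup>+w. ennreal (H x (w j) (w k)) \<partial>Pi\<^sub>M (insert j (insert k R)) (\<lambda>_. M)) =
      (\<integral>\<^sup>+y. (\<integral>\<^sup>+w. ennreal (H x y (w k)) \<partial>Pi\<^sub>M (insert k R) (\<lambda>_. M)) \<partial>M)"
      using ijk by simp
  qed
  also have "\<dots> = triple_int H"
  proof (intro nn_integral_cong)
    fix x y assume xy: "x \<in> space M" "y \<in> space M"
    interpret PR: prob_space "Pi\<^sub>M R (\<lambda>_::nat. M)" by (rule prob_space_PiM_M)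
    have "(\<integral>\<^sup>+w. ennreal (H x y (w k)) \<partial>Pi\<^sub>M (insert k R) (\<lambda>_. M)) =
      (\<integral>\<^sup>+z. (\<integral>\<^sup>+w. ennreal (H x y ((w(k := z)) k)) \<partial>Pi\<^sub>M R (\<lambda>_. M)) \<partial>M)"
      using R xy by (intro PM.product_nn_integral_insert_rev) (auto intro!: measurable_compose[OF _ measurable_ennreal] HM)
    then show "(\<integral>\<^sup>+w. ennreal (H x y (w k)) \<partial>Pi\<^sub>M (insert k R) (\<lambda>_. M)) = (\<integral>\<^sup>+z. ennreal (H x y z) \<partial>M)"
      using PR.emeasure_space_1 by simp
  qed
  finally show ?thesis .
qed

text \<open>Given the centre \<open>w i\<close>, the other points of \<open>S\<close> fall near it
  independently, each with probability \<open>nbhd_mass \<rho> (w i)\<close>. The disjunct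
  \<open>k = i\<close> removes the centre from the conditions.\<close>

lemma star_prob:
  assumes S: "S \<subseteq> {..<n}" "i \<in> S"
  shows "(\<integral>\<^sup>+w. indicator {w. \<forall>k\<in>S. eucl_dist d (w i) (w k) \<le> \<rho> \<or> k = i} w \<partial>P n) = (\<integral>\<^sup>+x. nbhd_mass \<rho> x ^ (card S - 1) \<partial>M)"
proof -
  define I where "I = {..<n} - {i}"
  have I: "finite I" "i \<notin> I" "{..<n} = insert i I" "S - {i} \<subseteq> I" using S by (auto simp: I_def)
  have fS: "finite S" using S finite_subset by blast
  \<comment> \<open>The factor 1 outside \<open>S\<close> lets the product run over all coordinates
    other than i, as the product formula for integrals requires.\<close>
  define \<phi> where "\<phi> x k y = (if k \<in> S then indicator {y. eucl_dist d x y \<le> \<rho>} y else 1 :: ennreal)" for x k y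
  have ind: "indicator {w. \<forall>k\<in>S. eucl_dist d (w i) (w k) \<le> \<rho> \<or> k = i} w = (\<Prod>k\<in>I. \<phi> (w i) k (w k))" for w
  proof (cases "\<forall>k\<in>S. eucl_dist d (w i) (w k) \<le> \<rho> \<or> k = i")
    case True
    then have "\<phi> (w i) k (w k) = 1" if "k \<in> I" for k using that I by (auto simp: \<phi>_def)
    then show ?thesis using True by simp
  next
    case False
    then obtain k where k: "k \<in> S" "k \<noteq> i" "\<not> eucl_dist d (w i) (w k) \<le> \<rho>" by auto
    then have "k \<in> I" "\<phi> (w i) k (w k) = 0" using I by (auto simp: \<phi>_def)
    then have "(\<Prod>k\<in>I. \<phi> (w i) k (w k)) = 0" using I by (auto intro!: prod_zero)
    then show ?thesis using False by simp
  qed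
  have m\<phi>: "(\<lambda>w. \<phi> (w i) k (w k)) \<in> borel_measurable (P n)" if "k \<in> I" for k
  proof -
    have [measurable]: "(\<lambda>w. w i) \<in> measurable (P n) L" "(\<lambda>w. w k) \<in> measurable (P n) L"
      using coord_P that S by (auto simp: I_def)
    show ?thesis unfolding \<phi>_def indicator_def mem_Collect_eq by measurable
  qed
  have "(\<integral>\<^sup>+w. indicator {w. \<forall>k\<in>S. eucl_dist d (w i) (w k) \<le> \<rho> \<or> k = i} w \<partial>P n) = (\<integral>\<^sup>+w. (\<Prod>k\<in>I. \<phi> (w i) k (w k)) \<partial>P n)"
    by (simp add: ind)
  also have "\<dots> = (\<integral>\<^sup>+x. (\<integral>\<^sup>+w. (\<Prod>k\<in>I. \<phi> ((w(i := x)) i) k ((w(i := x)) k)) \<partial>Pi\<^sub>M I (\<lambda>_. M)) \<partial>M)"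
    unfolding I(3) by (intro PM.product_nn_integral_insert_rev I(1,2)) (use m\<phi> in \<open>simp add: I(3)\<close>)
  also have "\<dots> = (\<integral>\<^sup>+x. (\<integral>\<^sup>+w. (\<Prod>k\<in>I. \<phi> x k (w k)) \<partial>Pi\<^sub>M I (\<lambda>_. M)) \<partial>M)"
    using I by (intro nn_integral_cong prod.cong) auto
  also have "\<dots> = (\<integral>\<^sup>+x. (\<Prod>k\<in>I. \<integral>\<^sup>+y. \<phi> x k y \<partial>M) \<partial>M)"
  proof (rule nn_integral_cong)
    fix x assume "x \<in> space M"
    then have x: "x \<in> space L" by simp
    show "(\<integral>\<^sup>+w. (\<Prod>k\<in>I. \<phi> x k (w k)) \<partial>Pi\<^sub>M I (\<lambda>_. M)) = (\<Prod>k\<in>I. \<integral>\<^sup>+y. \<phi> x k y \<partial>M)"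
    proof (intro PM.product_nn_integral_prod I(1))
      fix k assume "k \<in> I"
      have "(\<lambda>y. indicator {y. eucl_dist d x y \<le> \<rho>} y :: ennreal) \<in> borel_measurable M"
        using x by measurable
      then show "\<phi> x k \<in> borel_measurable M"
        unfolding \<phi>_def by (cases "k \<in> S") auto
    qed
  qed
  also have "\<dots> = (\<integral>\<^sup>+x. nbhd_mass \<rho> x ^ (card S - 1) \<partial>M)"
  proof (rule nn_integral_cong)
    fix x
    have "(\<Prod>k\<in>I. \<integral>\<^sup>+y. \<phi> x k y \<partial>M) = (\<Prod>k\<in>I. if k \<in> S - {i} then nbhd_mass \<rho> x else 1)"
      using I M.emeasure_space_1 by (intro prod.cong) (auto simp: \<phi>_def nbhd_mass_def)
    also have "\<dots> = (\<Prod>k\<in>S - {i}. nbhd_mass \<rho> x)"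
      using I by (intro prod.mono_neutral_cong_right) auto
    also have "\<dots> = nbhd_mass \<rho> x ^ (card S - 1)"
      using S fS by simp
    finally show "(\<Prod>k\<in>I. \<integral>\<^sup>+y. \<phi> x k y \<partial>M) = nbhd_mass \<rho> x ^ (card S - 1)" .
  qed
  finally show ?thesis .
qed

definition kern :: "real \<Rightarrow> real \<Rightarrow> nat \<times> nat \<times> nat \<Rightarrow> (nat \<Rightarrow> nat \<Rightarrow> real) \<Rightarrow> real" where
  "kern c \<rho> = (\<lambda>(i, j, k) w. tri_ker \<rho> (w i) (w j) (w k) - c * wedge_ker \<rho> (w i) (w j) (w k))"

lemma measurable_kern:
  assumes "verts \<tau> \<subseteq> I"
  shows "kern c \<rho> \<tau> \<in> borel_measurable (Pi\<^sub>M I (\<lambda>_. M))"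
proof (cases \<tau>)
  case (fields i j k)
  have "(\<lambda>w. w l) \<in> measurable (Pi\<^sub>M I (\<lambda>_. M)) L" if "l \<in> {i, j, k}" for l
  proof -
    have "l \<in> I" using that assms by (auto simp: fields verts_def)
    then have "(\<lambda>w. w l) \<in> measurable (Pi\<^sub>M I (\<lambda>_. M)) M" by measurable
    then show ?thesis by (simp add: measurable_cong_sets[OF refl sets_M])
  qed
  then have [measurable]: "(\<lambda>w. w i) \<in> measurable (Pi\<^sub>M I (\<lambda>_. M)) L"
    "(\<lambda>w. w j) \<in> measurable (Pi\<^sub>M I (\<lambda>_. M)) L" "(\<lambda>w. w k) \<in> measurable (Pi\<^sub>M I (\<lambda>_. M)) L" by auto
  show ?thesis
    unfolding kern_def fields tri_ker_def wedge_ker_def case_prod_conv by measurable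
qed

lemma kern_bound: "\<bar>kern c \<rho> \<tau> w\<bar> \<le> 1 + \<bar>c\<bar>"
  by (cases \<tau>) (auto simp: kern_def tri_ker_def wedge_ker_def of_bool_def)

lemma kern_eq_0: "\<not> (eucl_dist d (w i) (w j) \<le> \<rho> \<and> eucl_dist d (w i) (w k) \<le> \<rho>) \<Longrightarrow> kern c \<rho> (i, j, k) w = 0"
  by (auto simp: kern_def tri_ker_def wedge_ker_def)

lemma integrable_bounded_PiM:
  assumes "g \<in> borel_measurable (Pi\<^sub>M I (\<lambda>_::nat. M))" "\<And>w. \<bar>g w\<bar> \<le> B"
  shows "integrable (Pi\<^sub>M I (\<lambda>_::nat. M)) (g :: _ \<Rightarrow> real)"
proof -
  interpret PI: prob_space "Pi\<^sub>M I (\<lambda>_::nat. M)" by (rule prob_space_PiM_M)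
  show ?thesis using assms by (intro PI.integrable_const_bound[where B = B]) auto
qed

text \<open>The coordinates split into \<open>verts \<tau>\<close> and the rest, and each of the two
  kernels reads only one block.\<close>

lemma expectation_kern_indep:
  assumes \<tau>: "verts \<tau> \<subseteq> {..<n}" and \<sigma>: "verts \<sigma> \<subseteq> {..<n}" and dis: "verts \<tau> \<inter> verts \<sigma> = {}"
  shows "(\<integral>w. kern c \<rho> \<tau> w * kern c \<rho> \<sigma> w \<partial>P n) = (\<integral>w. kern c \<rho> \<tau> w \<partial>P n) * (\<integral>w. kern c \<rho> \<sigma> w \<partial>P n)"
proof -
  define I where "I = verts \<tau>"
  define J where "J = {..<n} - verts \<tau>"
  have IJ: "I \<inter> J = {}" "finite I" "finite J" "I \<union> J = {..<n}"
    using \<tau> by (auto simp: I_def J_def verts_def split: prod.splits)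
  let ?PI = "Pi\<^sub>M I (\<lambda>_::nat. M)" and ?PJ = "Pi\<^sub>M J (\<lambda>_::nat. M)"
  interpret PI: prob_space ?PI by (rule prob_space_PiM_M)
  interpret PJ: prob_space ?PJ by (rule prob_space_PiM_M)
  have m\<tau>: "kern c \<rho> \<tau> (merge I J (x, y)) = kern c \<rho> \<tau> x" for x y
    by (cases \<tau>) (simp add: kern_def I_def verts_def merge_def)
  have m\<sigma>: "kern c \<rho> \<sigma> (merge I J (x, y)) = kern c \<rho> \<sigma> y" for x y
    using dis \<sigma> IJ(1) by (cases \<sigma>) (auto simp: kern_def I_def J_def verts_def merge_def)
  have fold: "(\<integral>w. g w \<partial>P n) = (\<integral>x. (\<integral>y. g (merge I J (x, y)) \<partial>?PJ) \<partial>?PI)"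
    if "integrable (P n) g" for g :: "_ \<Rightarrow> real"
    using PM.product_integral_fold[OF IJ(1-3), of g] that unfolding IJ(4) by simp
  have [measurable]: "kern c \<rho> \<tau> \<in> borel_measurable (P n)" "kern c \<rho> \<sigma> \<in> borel_measurable (P n)"
    using \<tau> \<sigma> by (auto intro: measurable_kern)
  have "(\<integral>w. kern c \<rho> \<tau> w \<partial>P n) = (\<integral>x. kern c \<rho> \<tau> x \<partial>?PI)"
    by (subst fold) (auto simp: m\<tau> PJ.prob_space intro!: integrable_bounded_PiM[where B = "1 + \<bar>c\<bar>"] kern_bound)
  moreover have "(\<integral>w. kern c \<rho> \<sigma> w \<partial>P n) = (\<integral>y. kern c \<rho> \<sigma> y \<partial>?PJ)"
    by (subst fold) (auto simp: m\<sigma> PI.prob_space intro!: integrable_bounded_PiM[where B = "1 + \<bar>c\<bar>"] kern_bound)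
  moreover have "(\<integral>w. kern c \<rho> \<tau> w * kern c \<rho> \<sigma> w \<partial>P n) = (\<integral>x. kern c \<rho> \<tau> x \<partial>?PI) * (\<integral>y. kern c \<rho> \<sigma> y \<partial>?PJ)"
    by (subst fold) (auto simp: m\<tau> m\<sigma> abs_mult
        intro!: integrable_bounded_PiM[where B = "(1 + \<bar>c\<bar>) * (1 + \<bar>c\<bar>)"] mult_mono kern_bound)
  ultimately show ?thesis by simp
qed

text \<open>The factor (1 + |c|)^2 bounds a product of two kernels. The radius is doubled because
  two leaves of a wedge may be 2 * \<rho> apart, and \<open>k\<close> counts the vertices other than
  a shared one.\<close>

definition overlap_bound :: "real \<Rightarrow> real \<Rightarrow> nat \<Rightarrow> real" where
  "overlap_bound c \<rho> k = (1 + \<bar>c\<bar>)\<^sup>2 * (((2 * \<rho>) ^ d * bvol) ^ k * (1 + 2 * mass5))"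

lemma overlap_bound_nonneg: "\<rho> > 0 \<Longrightarrow> 0 \<le> overlap_bound c \<rho> k"
  using bvol(2) mass5(2) by (simp add: overlap_bound_def)

text \<open>A nonzero product forces both triples to be wedges, so every vertex lies within 2 *
  \<rho> of a shared vertex s, whatever role s has in either triple. One star event therefore covers
  all overlap patterns, and at most 5 vertices leave at most 4 leaves, the range of
  \<open>nbhd_mass_power\<close>.\<close>

lemma expectation_kern_overlap:
  assumes \<rho>: "\<rho> > 0" and \<tau>: "verts \<tau> \<subseteq> {..<n}" and \<sigma>: "verts \<sigma> \<subseteq> {..<n}" and ov: "verts \<tau> \<inter> verts \<sigma> \<noteq> {}"
    and card: "card (verts \<tau> \<union> verts \<sigma>) \<le> 5"
  shows "(\<integral>w. kern c \<rho> \<tau> w * kern c \<rho> \<sigma> w \<partial>P n) \<le> overlap_bound c \<rho> (card (verts \<tau> \<union> verts \<sigma>) - 1)"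
proof -
  let ?S = "verts \<tau> \<union> verts \<sigma>"
  obtain s where s: "s \<in> verts \<tau>" "s \<in> verts \<sigma>" using ov by auto
  let ?star = "{w. \<forall>k\<in>?S. eucl_dist d (w s) (w k) \<le> 2 * \<rho> \<or> k = s}"
  have near: "eucl_dist d (w s) (w k) \<le> 2 * \<rho>"
    if "kern c \<rho> \<upsilon> w \<noteq> 0" "s \<in> verts \<upsilon>" "k \<in> verts \<upsilon>" for \<upsilon> w k
  proof (cases \<upsilon>)
    case (fields a b e)
    have ab: "eucl_dist d (w a) (w b) \<le> \<rho>" "eucl_dist d (w a) (w e) \<le> \<rho>"
      using that(1) kern_eq_0[of w a b \<rho> e c] unfolding fields by auto
    have aa: "eucl_dist d (w a) (w a) = 0" by (simp add: eucl_dist_def)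
    have c: "eucl_dist d (w a) (w s) \<le> \<rho>" "eucl_dist d (w a) (w k) \<le> \<rho>"
      using that(2,3) ab aa \<rho> by (auto simp: fields verts_def)
    then show ?thesis using eucl_dist_triangle[of d "w s" "w k" "w a"] by (simp add: eucl_dist_commute)
  qed
  have le: "ennreal (kern c \<rho> \<tau> w * kern c \<rho> \<sigma> w) \<le> ennreal ((1 + \<bar>c\<bar>)\<^sup>2) * indicator ?star w" for w
  proof (cases "kern c \<rho> \<tau> w * kern c \<rho> \<sigma> w = 0")
    case False
    then have "w \<in> ?star" using near[of \<tau> w] near[of \<sigma> w] s by auto
    moreover have "kern c \<rho> \<tau> w * kern c \<rho> \<sigma> w \<le> (1 + \<bar>c\<bar>)\<^sup>2"
    proof -
      have "kern c \<rho> \<tau> w * kern c \<rho> \<sigma> w \<le> \<bar>kern c \<rho> \<tau> w\<bar> * \<bar>kern c \<rho> \<sigma> w\<bar>"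
        by (metis abs_ge_self abs_mult)
      also have "\<dots> \<le> (1 + \<bar>c\<bar>) * (1 + \<bar>c\<bar>)" by (intro mult_mono kern_bound) auto
      finally show ?thesis by (simp add: power2_eq_square)
    qed
    ultimately show ?thesis by (simp add: ennreal_leI)
  qed auto
  have [measurable]: "kern c \<rho> \<tau> \<in> borel_measurable (P n)" "kern c \<rho> \<sigma> \<in> borel_measurable (P n)"
    using \<tau> \<sigma> by (auto intro: measurable_kern)
  have mstar: "?star \<inter> space (P n) \<in> sets (P n)"
  proof -
    have "{w \<in> space (P n). \<forall>k\<in>?S. eucl_dist d (w s) (w k) \<le> 2 * \<rho> \<or> k = s} \<in> sets (P n)"
    proof (rule sets.sets_Collect_finite_All)
      fix k assume "k \<in> ?S"
      then have [measurable]: "(\<lambda>w. w k) \<in> measurable (P n) L" "(\<lambda>w. w s) \<in> measurable (P n) L"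
        using \<tau> \<sigma> s by (auto intro!: coord_P)
      show "{w \<in> space (P n). eucl_dist d (w s) (w k) \<le> 2 * \<rho> \<or> k = s} \<in> sets (P n)"
        by measurable
    qed (auto simp: verts_def split: prod.splits)
    moreover have "{w \<in> space (P n). \<forall>k\<in>?S. eucl_dist d (w s) (w k) \<le> 2 * \<rho> \<or> k = s} = ?star \<inter> space (P n)" by auto
    ultimately show ?thesis by simp
  qed
  have ck: "card ?S - 1 \<le> 4" using card by simp
  have "(\<integral>\<^sup>+w. ennreal (kern c \<rho> \<tau> w * kern c \<rho> \<sigma> w) \<partial>P n) \<le> (\<integral>\<^sup>+w. ennreal ((1 + \<bar>c\<bar>)\<^sup>2) * indicator (?star \<inter> space (P n)) w \<partial>P n)"
    by (intro nn_integral_mono order_trans[OF le]) (auto simp: indicator_def)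
  also have "\<dots> = ennreal ((1 + \<bar>c\<bar>)\<^sup>2) * (\<integral>\<^sup>+w. indicator (?star \<inter> space (P n)) w \<partial>P n)"
    using mstar by (intro nn_integral_cmult) simp
  also have "(\<integral>\<^sup>+w. indicator (?star \<inter> space (P n)) w \<partial>P n) = (\<integral>\<^sup>+w. indicator ?star w \<partial>P n)"
    by (intro nn_integral_cong) (auto simp: indicator_def)
  also have "\<dots> = (\<integral>\<^sup>+x. nbhd_mass (2 * \<rho>) x ^ (card ?S - 1) \<partial>M)"
    using \<tau> \<sigma> s by (intro star_prob) auto
  also have "ennreal ((1 + \<bar>c\<bar>)\<^sup>2) * \<dots> \<le> ennreal ((1 + \<bar>c\<bar>)\<^sup>2) * ennreal (((2 * \<rho>) ^ d * bvol) ^ (card ?S - 1) * (1 + 2 * mass5))"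
    using \<rho> by (intro mult_left_mono nbhd_mass_power ck) auto
  also have "\<dots> = ennreal (overlap_bound c \<rho> (card ?S - 1))"
    by (simp add: overlap_bound_def ennreal_mult')
  finally have nn: "(\<integral>\<^sup>+w. ennreal (kern c \<rho> \<tau> w * kern c \<rho> \<sigma> w) \<partial>P n) \<le> ennreal (overlap_bound c \<rho> (card ?S - 1))" .
  have "integrable (P n) (\<lambda>w. kern c \<rho> \<tau> w * kern c \<rho> \<sigma> w)"
    by (rule integrable_bounded_PiM[where B = "(1 + \<bar>c\<bar>) * (1 + \<bar>c\<bar>)"]) (auto simp: abs_mult intro!: mult_mono kern_bound)
  then have "(\<integral>w. kern c \<rho> \<tau> w * kern c \<rho> \<sigma> w \<partial>P n) \<le> enn2real (\<integral>\<^sup>+w. ennreal (kern c \<rho> \<tau> w * kern c \<rho> \<sigma> w) \<partial>P n)"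
    by (simp add: real_lebesgue_integral_def)
  also have "\<dots> \<le> overlap_bound c \<rho> (card ?S - 1)"
    by (rule enn2real_leI[OF overlap_bound_nonneg[OF \<rho>] nn])
  finally show ?thesis .
qed

end

section \<open>Second moments and the estimator\<close>

text \<open>The union can be chosen in at most n^m ways, and then each of the six entries is one of
  its m elements.\<close>

lemma card_overlapping_triples:
  "card {(\<tau>, \<sigma>) \<in> triples n \<times> triples n. card (verts \<tau> \<union> verts \<sigma>) = m} \<le> n ^ m * m ^ 6"
proof -
  let ?Q = "{S. S \<subseteq> {..<n} \<and> card S = m}"
  let ?T = "\<lambda>S::nat set. (S \<times> S \<times> S) \<times> (S \<times> S \<times> S)"
  have fin: "finite ?Q" by (rule finite_subset[of _ "Pow {..<n}"]) auto
  have finS: "finite S" if "S \<in> ?Q" for S using that finite_subset by auto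
  have "{(\<tau>, \<sigma>) \<in> triples n \<times> triples n. card (verts \<tau> \<union> verts \<sigma>) = m} \<subseteq> (\<Union>S\<in>?Q. ?T S)"
  proof
    fix x assume x: "x \<in> {(\<tau>, \<sigma>) \<in> triples n \<times> triples n. card (verts \<tau> \<union> verts \<sigma>) = m}"
    obtain \<tau> \<sigma> where xe: "x = (\<tau>, \<sigma>)" by (cases x)
    have "verts \<tau> \<union> verts \<sigma> \<in> ?Q" using x verts_triples(1)[of \<tau> n] verts_triples(1)[of \<sigma> n] by (auto simp: xe)
    moreover have "x \<in> ?T (verts \<tau> \<union> verts \<sigma>)"
    proof -
      have "\<upsilon> \<in> S \<times> S \<times> S" if "verts \<upsilon> \<subseteq> S" for \<upsilon> S
        using that by (cases \<upsilon>) (simp add: verts_def)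
      then show ?thesis unfolding xe by (intro SigmaI) simp_all
    qed
    ultimately show "x \<in> (\<Union>S\<in>?Q. ?T S)" by (rule UN_I)
  qed
  moreover have "finite (\<Union>S\<in>?Q. ?T S)"
    by (intro finite_UN_I fin finite_cartesian_product finS)
  ultimately have "card {(\<tau>, \<sigma>) \<in> triples n \<times> triples n. card (verts \<tau> \<union> verts \<sigma>) = m} \<le> card (\<Union>S\<in>?Q. ?T S)"
    by (intro card_mono)
  also have "\<dots> \<le> (\<Sum>S\<in>?Q. card (?T S))" by (rule card_UN_le[OF fin])
  also have "\<dots> = (\<Sum>S\<in>?Q. m ^ 6)"
    by (intro sum.cong refl) (simp add: card_cartesian_product eval_nat_numeral mult.assoc)
  also have "\<dots> = (n choose m) * m ^ 6" using n_subsets[of "{..<n}" m] by simp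
  also have "n choose m \<le> n ^ m"
    by (cases "m \<le> n") (simp_all add: binomial_le_pow binomial_eq_0)
  then have "(n choose m) * m ^ 6 \<le> n ^ m * m ^ 6" by (rule mult_right_mono) simp
  finally show ?thesis .
qed

context fifth_power_density begin

definition signed_count :: "real \<Rightarrow> real \<Rightarrow> nat \<Rightarrow> (nat \<Rightarrow> nat \<Rightarrow> real) \<Rightarrow> real" where
  "signed_count c \<rho> n w = (\<Sum>\<tau>\<in>triples n. kern c \<rho> \<tau> w)"

lemma measurable_signed_count [measurable]: "signed_count c \<rho> n \<in> borel_measurable (P n)"
  unfolding signed_count_def by (intro borel_measurable_sum measurable_kern verts_triples(1))

lemma expectation_kern:
  assumes "\<tau> \<in> triples n"
    and pt: "triple_int (tri_ker \<rho>) = ennreal pt" "pt \<ge> 0"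
    and pw: "triple_int (wedge_ker \<rho>) = ennreal pw" "pw \<ge> 0"
  shows "(\<integral>w. kern c \<rho> \<tau> w \<partial>P n) = pt - c * pw"
proof (cases \<tau>)
  case (fields i j k)
  then have ijk: "i < n" "j < n" "k < n" "i \<noteq> j" "i \<noteq> k" "j \<noteq> k" using assms(1) by (auto simp: triples_iff)
  have [measurable]: "(\<lambda>w. w i) \<in> measurable (P n) L" "(\<lambda>w. w j) \<in> measurable (P n) L" "(\<lambda>w. w k) \<in> measurable (P n) L"
    using ijk by (auto intro: coord_P)
  have mt: "(\<lambda>w. tri_ker \<rho> (w i) (w j) (w k)) \<in> borel_measurable (P n)"
    and mw: "(\<lambda>w. wedge_ker \<rho> (w i) (w j) (w k)) \<in> borel_measurable (P n)"
    unfolding tri_ker_def wedge_ker_def by measurable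
  have it: "integrable (P n) (\<lambda>w. tri_ker \<rho> (w i) (w j) (w k))"
    and iw: "integrable (P n) (\<lambda>w. wedge_ker \<rho> (w i) (w j) (w k))"
    by (rule integrable_bounded_PiM[OF mt, of 1], simp add: tri_ker_def)
      (rule integrable_bounded_PiM[OF mw, of 1], simp add: wedge_ker_def)
  have "(\<integral>w. tri_ker \<rho> (w i) (w j) (w k) \<partial>P n) = pt"
    using nn_integral_P_three[OF measurable_kers(2) ijk, of \<rho>] pt mt
    by (subst integral_eq_nn_integral) (auto simp: tri_ker_def)
  moreover have "(\<integral>w. wedge_ker \<rho> (w i) (w j) (w k) \<partial>P n) = pw"
    using nn_integral_P_three[OF measurable_kers(1) ijk, of \<rho>] pw mw
    by (subst integral_eq_nn_integral) (auto simp: wedge_ker_def)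
  ultimately show ?thesis
    unfolding fields kern_def case_prod_conv using it iw by simp
qed

text \<open>One summand for each possible size m of the union of two overlapping triples: a bound on
  their number times a bound on their expectation. Size 6 belongs to disjoint, hence independent,
  triples.\<close>

definition variance_bound :: "real \<Rightarrow> real \<Rightarrow> nat \<Rightarrow> real" where
  "variance_bound c \<rho> n = (\<Sum>m\<in>{3, 4, 5}. real n ^ m * real m ^ 6 * overlap_bound c \<rho> (m - 1))"

text \<open>Disjoint pairs contribute exactly p^2. For overlapping pairs the nonnegative p^2 is
  added to the bound, so that the terms p^2 over all pairs sum to the squared mean.\<close>

lemma signed_count_second_moment:
  assumes \<rho>: "\<rho> > 0" and p: "\<And>\<tau>. \<tau> \<in> triples n \<Longrightarrow> (\<integral>w. kern c \<rho> \<tau> w \<partial>P n) = p"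
  shows "(\<integral>w. (signed_count c \<rho> n w)\<^sup>2 \<partial>P n) \<le> (real (card (triples n)) * p)\<^sup>2 + variance_bound c \<rho> n"
proof -
  let ?T = "triples n"
  let ?U = "\<lambda>\<tau> \<sigma>. verts \<tau> \<union> verts \<sigma>"
  let ?B = "\<lambda>\<tau> \<sigma>. \<Sum>m\<in>{3, 4, 5}. if card (?U \<tau> \<sigma>) = m then overlap_bound c \<rho> (m - 1) else 0"
  have int: "integrable (P n) (\<lambda>w. kern c \<rho> \<tau> w * kern c \<rho> \<sigma> w)" if "\<tau> \<in> ?T" "\<sigma> \<in> ?T" for \<tau> \<sigma>
  proof (rule integrable_bounded_PiM[where B = "(1 + \<bar>c\<bar>) * (1 + \<bar>c\<bar>)"])
    have [measurable]: "kern c \<rho> \<tau> \<in> borel_measurable (P n)" "kern c \<rho> \<sigma> \<in> borel_measurable (P n)"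
      by (rule measurable_kern[OF verts_triples(1)[OF that(1)]], rule measurable_kern[OF verts_triples(1)[OF that(2)]])
    show "(\<lambda>w. kern c \<rho> \<tau> w * kern c \<rho> \<sigma> w) \<in> borel_measurable (P n)" by measurable
  qed (auto simp: abs_mult intro!: mult_mono kern_bound)
  have one: "(\<integral>w. kern c \<rho> \<tau> w * kern c \<rho> \<sigma> w \<partial>P n) \<le> p\<^sup>2 + ?B \<tau> \<sigma>" if t: "\<tau> \<in> ?T" "\<sigma> \<in> ?T" for \<tau> \<sigma>
  proof (cases "verts \<tau> \<inter> verts \<sigma> = {}")
    case True
    then have "(\<integral>w. kern c \<rho> \<tau> w * kern c \<rho> \<sigma> w \<partial>P n) = p\<^sup>2"
      using expectation_kern_indep[OF verts_triples(1)[OF t(1)] verts_triples(1)[OF t(2)]] p t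
      by (simp add: power2_eq_square)
    moreover have "?B \<tau> \<sigma> \<ge> 0" using overlap_bound_nonneg[OF \<rho>] by (intro sum_nonneg) auto
    ultimately show ?thesis by simp
  next
    case False
    have f: "finite (verts \<tau>)" "finite (verts \<sigma>)" by (auto simp: verts_def split: prod.splits)
    \<comment> \<open>Inclusion and exclusion: 3 + 3 entries with at least one shared vertex leave a
      union of 3, 4 or 5 vertices.\<close>
    have "card (?U \<tau> \<sigma>) + card (verts \<tau> \<inter> verts \<sigma>) = 6"
      using card_Un_Int[OF f] verts_triples(2) t by simp
    moreover have "card (verts \<tau> \<inter> verts \<sigma>) > 0" using False f by (simp add: card_gt_0_iff)
    moreover have "card (verts \<tau>) \<le> card (?U \<tau> \<sigma>)" using f by (intro card_mono) auto
    ultimately have c: "card (?U \<tau> \<sigma>) \<le> 5" "card (?U \<tau> \<sigma>) \<in> {3, 4, 5}"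
      using verts_triples(2)[OF t(1)] by auto
    have "(\<integral>w. kern c \<rho> \<tau> w * kern c \<rho> \<sigma> w \<partial>P n) \<le> overlap_bound c \<rho> (card (?U \<tau> \<sigma>) - 1)"
      by (intro expectation_kern_overlap \<rho> False c verts_triples(1) t)
    also have "\<dots> = ?B \<tau> \<sigma>" using c(2) by auto
    finally show ?thesis using zero_le_power2[of p] by linarith
  qed
  have "(\<integral>w. (signed_count c \<rho> n w)\<^sup>2 \<partial>P n) = (\<integral>w. (\<Sum>\<tau>\<in>?T. \<Sum>\<sigma>\<in>?T. kern c \<rho> \<tau> w * kern c \<rho> \<sigma> w) \<partial>P n)"
    by (simp add: signed_count_def power2_eq_square sum_product)
  also have "\<dots> = (\<Sum>\<tau>\<in>?T. \<Sum>\<sigma>\<in>?T. (\<integral>w. kern c \<rho> \<tau> w * kern c \<rho> \<sigma> w \<partial>P n))"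
    using int by (simp add: Bochner_Integration.integral_sum)
  also have "\<dots> \<le> (\<Sum>\<tau>\<in>?T. \<Sum>\<sigma>\<in>?T. p\<^sup>2 + ?B \<tau> \<sigma>)"
    by (intro sum_mono one)
  also have "\<dots> = (real (card ?T) * p)\<^sup>2 + (\<Sum>\<tau>\<in>?T. \<Sum>\<sigma>\<in>?T. ?B \<tau> \<sigma>)"
    by (simp only: sum.distrib) (simp add: power2_eq_square algebra_simps)
  also have "(\<Sum>\<tau>\<in>?T. \<Sum>\<sigma>\<in>?T. ?B \<tau> \<sigma>) = (\<Sum>x\<in>?T \<times> ?T. ?B (fst x) (snd x))"
    by (subst sum.cartesian_product) (simp only: split_beta')
  also have "\<dots> = (\<Sum>m\<in>{3, 4, 5}. \<Sum>x\<in>?T \<times> ?T. if card (?U (fst x) (snd x)) = m then overlap_bound c \<rho> (m - 1) else 0)"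
    by (rule sum.swap)
  also have "\<dots> = (\<Sum>m\<in>{3, 4, 5}. real (card {(\<tau>, \<sigma>) \<in> ?T \<times> ?T. card (?U \<tau> \<sigma>) = m}) * overlap_bound c \<rho> (m - 1))"
  proof (intro sum.cong refl)
    fix m :: nat
    have "{(\<tau>, \<sigma>) \<in> ?T \<times> ?T. card (?U \<tau> \<sigma>) = m} = ?T \<times> ?T \<inter> {x. card (?U (fst x) (snd x)) = m}" by auto
    then show "(\<Sum>x\<in>?T \<times> ?T. if card (?U (fst x) (snd x)) = m then overlap_bound c \<rho> (m - 1) else 0)
       = real (card {(\<tau>, \<sigma>) \<in> ?T \<times> ?T. card (?U \<tau> \<sigma>) = m}) * overlap_bound c \<rho> (m - 1)"
      by (simp add: sum.If_cases)
  qed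
  also have "\<dots> \<le> variance_bound c \<rho> n"
    unfolding variance_bound_def
  proof (intro sum_mono mult_right_mono overlap_bound_nonneg \<rho>)
    fix m
    have "real (card {(\<tau>, \<sigma>) \<in> ?T \<times> ?T. card (?U \<tau> \<sigma>) = m}) \<le> real (n ^ m * m ^ 6)"
      by (rule of_nat_mono) (rule card_overlapping_triples)
    then show "real (card {(\<tau>, \<sigma>) \<in> ?T \<times> ?T. card (?U \<tau> \<sigma>) = m}) \<le> real n ^ m * real m ^ 6" by simp
  qed
  finally show ?thesis by simp
qed

text \<open>Chebyshev's inequality. With Z the signed count and N the number of triples, s * Z has
  mean N * s * p >= N * b, so s * Z <= 0 forces a deviation of at least N * b. The sign s = 1 or -1
  treats constants on both sides of \<open>clustering d\<close> at once.\<close>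

lemma signed_count_wrong_sign:
  assumes \<rho>: "\<rho> > 0" and p: "\<And>\<tau>. \<tau> \<in> triples n \<Longrightarrow> (\<integral>w. kern c \<rho> \<tau> w \<partial>P n) = p"
    and s: "\<bar>s\<bar> = 1" "s * p \<ge> b" "b > 0" and n: "n \<ge> 3"
  shows "measure (P n) {w \<in> space (P n). s * signed_count c \<rho> n w \<le> 0} \<le> variance_bound c \<rho> n / (real (card (triples n)) * b)\<^sup>2"
proof -
  interpret PP: prob_space "P n" by (rule prob_space_PiM_M)
  let ?N = "real (card (triples n))" and ?Z = "signed_count c \<rho> n"
  have N: "?N > 0" using n by (simp add: card_triples)
  have int1: "integrable (P n) (kern c \<rho> \<tau>)" if "\<tau> \<in> triples n" for \<tau>
    by (rule integrable_bounded_PiM[OF measurable_kern kern_bound]) (rule verts_triples(1)[OF that])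
  then have int: "integrable (P n) ?Z" unfolding signed_count_def by (intro Bochner_Integration.integrable_sum)
  have Zb: "\<bar>?Z w\<bar> \<le> ?N * (1 + \<bar>c\<bar>)" for w
  proof -
    have "\<bar>?Z w\<bar> \<le> (\<Sum>\<tau>\<in>triples n. \<bar>kern c \<rho> \<tau> w\<bar>)"
      unfolding signed_count_def by (rule sum_abs)
    also have "\<dots> \<le> (\<Sum>\<tau>\<in>triples n. 1 + \<bar>c\<bar>)" by (intro sum_mono kern_bound)
    finally show ?thesis by simp
  qed
  have int2: "integrable (P n) (\<lambda>w. (?Z w)\<^sup>2)"
  proof (rule integrable_bounded_PiM)
    show "\<bar>(?Z w)\<^sup>2\<bar> \<le> (?N * (1 + \<bar>c\<bar>))\<^sup>2" for w
      using power_mono[OF Zb[of w] abs_ge_zero, of 2] by simp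
  qed measurable
  have EZ: "PP.expectation ?Z = ?N * p"
    unfolding signed_count_def using int1 p by (simp add: Bochner_Integration.integral_sum)
  have var: "PP.variance ?Z \<le> variance_bound c \<rho> n"
    using signed_count_second_moment[OF \<rho> p] PP.variance_eq[OF int int2] unfolding EZ by linarith
  have "\<bar>p\<bar> = \<bar>s * p\<bar>" using s(1) by (simp add: abs_mult)
  then have bp: "b \<le> \<bar>p\<bar>" using s by linarith
  have "measure (P n) {w \<in> space (P n). s * ?Z w \<le> 0} \<le> measure (P n) {w \<in> space (P n). \<bar>?Z w - PP.expectation ?Z\<bar> \<ge> ?N * b}"
  proof (rule PP.finite_measure_mono)
    show "{w \<in> space (P n). s * ?Z w \<le> 0} \<subseteq> {w \<in> space (P n). \<bar>?Z w - PP.expectation ?Z\<bar> \<ge> ?N * b}"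
    proof (intro subsetI CollectI conjI)
      fix w assume w: "w \<in> {w \<in> space (P n). s * ?Z w \<le> 0}"
      have "?N * b \<le> ?N * (s * p)" using N s by (intro mult_left_mono) auto
      also have "\<dots> \<le> s * (?N * p - ?Z w)" using w by (simp add: algebra_simps)
      also have "\<dots> \<le> \<bar>s * (?N * p - ?Z w)\<bar>" by simp
      also have "\<dots> = \<bar>?Z w - PP.expectation ?Z\<bar>" using s(1) by (simp add: abs_mult EZ abs_minus_commute)
      finally show "?N * b \<le> \<bar>?Z w - PP.expectation ?Z\<bar>" .
    qed auto
  qed measurable
  also have "\<dots> \<le> PP.variance ?Z / (?N * b)\<^sup>2"
    using N s by (intro PP.Chebyshev_inequality int2) auto
  also have "\<dots> \<le> variance_bound c \<rho> n / (?N * b)\<^sup>2"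
    using var by (intro divide_right_mono) auto
  finally show ?thesis .
qed

text \<open>The constant does not depend on n or \<rho>. The factor \<open>5 ^ 6\<close> bounds m^6
  for m <= 5, and the base 1 + 2^d * bvol is at least 1, so its fourth power dominates all exponents
  up to 4.\<close>

lemma variance_bound_le:
  fixes c \<rho> :: real
  assumes \<rho>: "\<rho> > 0"
  defines "q \<equiv> \<rho> ^ d"
  defines "A \<equiv> 5 ^ 6 * ((1 + \<bar>c\<bar>)\<^sup>2 * ((1 + 2 ^ d * bvol) ^ 4 * (1 + 2 * mass5)))"
  shows "variance_bound c \<rho> n \<le> A * (real n ^ 3 * q ^ 2 + real n ^ 4 * q ^ 3 + real n ^ 5 * q ^ 4)"
proof -
  let ?C = "(1 + \<bar>c\<bar>)\<^sup>2 * ((1 + 2 ^ d * bvol) ^ 4 * (1 + 2 * mass5))"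
  have q: "q > 0" using \<rho> by (simp add: q_def)
  have C0: "?C \<ge> 0" using bvol(2) mass5(2) by simp
  have ob: "overlap_bound c \<rho> k \<le> ?C * q ^ k" if "k \<le> 4" for k
  proof -
    have "(2 ^ d * bvol) ^ k \<le> (1 + 2 ^ d * bvol) ^ k" using bvol(2) by (intro power_mono) auto
    also have "\<dots> \<le> (1 + 2 ^ d * bvol) ^ 4" using bvol(2) that by (intro power_increasing) auto
    finally have "(1 + \<bar>c\<bar>)\<^sup>2 * ((2 ^ d * bvol) ^ k * (1 + 2 * mass5)) * q ^ k \<le> ?C * q ^ k"
      using mass5(2) q by (intro mult_right_mono mult_left_mono) auto
    moreover have "overlap_bound c \<rho> k = (1 + \<bar>c\<bar>)\<^sup>2 * ((2 ^ d * bvol) ^ k * (1 + 2 * mass5)) * q ^ k"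
      by (simp add: overlap_bound_def q_def power_mult_distrib mult_ac)
    ultimately show ?thesis by simp
  qed
  have summand: "real n ^ m * real m ^ 6 * overlap_bound c \<rho> (m - 1) \<le> A * (real n ^ m * q ^ (m - 1))" if "m \<in> {3, 4, 5}" for m
  proof -
    have "real n ^ m * real m ^ 6 * overlap_bound c \<rho> (m - 1) \<le> real n ^ m * 5 ^ 6 * (?C * q ^ (m - 1))"
      using that by (intro mult_mono ob mult_left_mono power_mono overlap_bound_nonneg[OF \<rho>]) auto
    then show ?thesis by (simp add: A_def mult_ac)
  qed
  have "variance_bound c \<rho> n \<le> (\<Sum>m\<in>{3, 4, 5}. A * (real n ^ m * q ^ (m - 1)))"
    unfolding variance_bound_def by (intro sum_mono summand)
  also have "\<dots> = A * (real n ^ 3 * q ^ 2 + real n ^ 4 * q ^ 3 + real n ^ 5 * q ^ 4)"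
    by (simp add: algebra_simps)
  finally show ?thesis .
qed

text \<open>The mean per triple is \<open>cube_mass\<close> * bvol^2 * (clustering d - c) * q^2,
  with q = r^d, up to an error of at most half its size. Hence the variance is eventually negligible
  against the squared mean.\<close>

lemma signed_count_wrong_sign_tendsto:
  fixes r :: "nat \<Rightarrow> real"
  assumes c: "c \<noteq> clustering d"
    and r: "\<And>n. r n > 0" "r \<longlonglongrightarrow> 0" "filterlim (\<lambda>n. real n powr (3/2) * r n ^ d) at_top sequentially"
  shows "(\<lambda>n. measure (P n) {w \<in> space (P n). sgn (clustering d - c) * signed_count c (r n) n w \<le> 0}) \<longlonglongrightarrow> 0"
proof -
  define s where "s = sgn (clustering d - c)"
  define \<beta> where "\<beta> = cube_mass * bvol\<^sup>2 * \<bar>clustering d - c\<bar>"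
  have s1: "\<bar>s\<bar> = 1" using c by (simp add: s_def sgn_if)
  have \<beta>: "\<beta> > 0" using c cube_mass_pos bvol(2) by (simp add: \<beta>_def)
  \<comment> \<open>The errors of the triangle and wedge probabilities enter with weights 1 and |c|;
    this choice makes their total half of the main term \<beta> * q^2.\<close>
  define \<eta> where "\<eta> = \<beta> / (2 * (1 + \<bar>c\<bar>))"
  have \<eta>: "\<eta> > 0" "\<eta> * (1 + \<bar>c\<bar>) = \<beta> / 2" using \<beta> by (simp_all add: \<eta>_def field_simps)
  obtain \<delta>1 where \<delta>1: "\<delta>1 > 0" "\<And>\<rho>. 0 < \<rho> \<Longrightarrow> \<rho> \<le> \<delta>1 \<Longrightarrow>
    (\<exists>p. triple_int (tri_ker \<rho>) = ennreal p \<and> p \<ge> 0 \<and>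
      \<bar>p - cube_mass * (clustering d * bvol\<^sup>2) * \<rho> ^ (2 * d)\<bar> \<le> \<eta> * \<rho> ^ (2 * d))"
    using tri_prob_limit[OF \<eta>(1)] by meson
  obtain \<delta>2 where \<delta>2: "\<delta>2 > 0" "\<And>\<rho>. 0 < \<rho> \<Longrightarrow> \<rho> \<le> \<delta>2 \<Longrightarrow>
    (\<exists>p. triple_int (wedge_ker \<rho>) = ennreal p \<and> p \<ge> 0 \<and>
      \<bar>p - cube_mass * bvol\<^sup>2 * \<rho> ^ (2 * d)\<bar> \<le> \<eta> * \<rho> ^ (2 * d))"
    using wedge_prob_limit[OF \<eta>(1)] by meson
  define A where "A = 5 ^ 6 * ((1 + \<bar>c\<bar>)\<^sup>2 * ((1 + 2 ^ d * bvol) ^ 4 * (1 + 2 * mass5)))"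
  have A: "A \<ge> 0" using bvol(2) mass5(2) by (simp add: A_def)
  \<comment> \<open>Here 16 = 8 * 2, with 8 from the lower bound n^3 / 8 on the number of triples
    and 2 from the halved main term.\<close>
  define K where "K = A * (16 / \<beta>)\<^sup>2"
  define a where "a n = real n powr (3/2) * r n ^ d" for n
  have bound: "measure (P n) {w \<in> space (P n). s * signed_count c (r n) n w \<le> 0} \<le> K * ((inverse (a n))\<^sup>2 + inverse (a n) + inverse (real n))"
    if small: "r n < min \<delta>1 \<delta>2" and n: "n \<ge> 4" for n
  proof -
    define q where "q = r n ^ d"
    have q: "q > 0" using r(1)[of n] by (simp add: q_def)
    have a_eq: "a n = real n powr (3/2) * q" by (simp add: a_def q_def)
    have q2: "r n ^ (2 * d) = q\<^sup>2" unfolding q_def by (metis power_mult mult.commute)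
    obtain pt where pt: "triple_int (tri_ker (r n)) = ennreal pt" "pt \<ge> 0"
      "\<bar>pt - cube_mass * (clustering d * bvol\<^sup>2) * q\<^sup>2\<bar> \<le> \<eta> * q\<^sup>2"
      using \<delta>1(2)[OF r(1)[of n]] small unfolding q2 by auto
    obtain pw where pw: "triple_int (wedge_ker (r n)) = ennreal pw" "pw \<ge> 0"
      "\<bar>pw - cube_mass * bvol\<^sup>2 * q\<^sup>2\<bar> \<le> \<eta> * q\<^sup>2"
      using \<delta>2(2)[OF r(1)[of n]] small unfolding q2 by auto
    define p where "p = pt - c * pw"
    have Ep: "(\<integral>w. kern c (r n) \<tau> w \<partial>P n) = p" if "\<tau> \<in> triples n" for \<tau>
      unfolding p_def by (rule expectation_kern[OF that pt(1,2) pw(1,2)])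
    have "p - cube_mass * bvol\<^sup>2 * (clustering d - c) * q\<^sup>2 =
       (pt - cube_mass * (clustering d * bvol\<^sup>2) * q\<^sup>2) - c * (pw - cube_mass * bvol\<^sup>2 * q\<^sup>2)"
      by (simp add: p_def algebra_simps)
    also have "\<bar>\<dots>\<bar> \<le> \<bar>pt - cube_mass * (clustering d * bvol\<^sup>2) * q\<^sup>2\<bar> + \<bar>c * (pw - cube_mass * bvol\<^sup>2 * q\<^sup>2)\<bar>"
      by (rule abs_triangle_ineq4)
    also have "\<dots> \<le> \<eta> * q\<^sup>2 + \<bar>c\<bar> * (\<eta> * q\<^sup>2)"
      unfolding abs_mult[of c] by (intro add_mono pt(3) mult_left_mono pw(3)) simp
    also have "\<dots> = \<eta> * (1 + \<bar>c\<bar>) * q\<^sup>2" by (simp add: algebra_simps)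
    also have "\<dots> = \<beta> / 2 * q\<^sup>2" unfolding \<eta>(2) ..
    finally have "\<bar>s * (p - cube_mass * bvol\<^sup>2 * (clustering d - c) * q\<^sup>2)\<bar> \<le> \<beta> / 2 * q\<^sup>2"
      using s1 by (simp add: abs_mult)
    moreover have "s * (p - cube_mass * bvol\<^sup>2 * (clustering d - c) * q\<^sup>2) = s * p - \<beta> * q\<^sup>2"
    proof -
      have "s * (clustering d - c) = \<bar>clustering d - c\<bar>" by (simp add: s_def mult.commute abs_sgn)
      then show ?thesis by (simp add: \<beta>_def right_diff_distrib mult.left_commute mult_ac)
    qed
    ultimately have sp: "s * p \<ge> \<beta> / 2 * q\<^sup>2" by linarith
    have "\<beta> / 2 * q\<^sup>2 > 0" using \<beta> q by simp
    then have "measure (P n) {w \<in> space (P n). s * signed_count c (r n) n w \<le> 0}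
       \<le> variance_bound c (r n) n / (real (card (triples n)) * (\<beta> / 2 * q\<^sup>2))\<^sup>2"
      using n by (intro signed_count_wrong_sign[where p = p] r(1) Ep s1 sp) auto
    also have "\<dots> \<le> A * (real n ^ 3 * q ^ 2 + real n ^ 4 * q ^ 3 + real n ^ 5 * q ^ 4) / (real n ^ 3 / 8 * (\<beta> / 2 * q\<^sup>2))\<^sup>2"
    proof (intro frac_le)
      show "variance_bound c (r n) n \<le> A * (real n ^ 3 * q ^ 2 + real n ^ 4 * q ^ 3 + real n ^ 5 * q ^ 4)"
        unfolding A_def q_def by (rule variance_bound_le[OF r(1)])
      \<comment> \<open>For n >= 4 both n - 1 and n - 2 are at least n / 2, which gives even n^3 /
        4.\<close>
      have "real n ^ 3 / 8 \<le> real (card (triples n))"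
      proof -
        have "real n / 2 \<le> real (n - 1)" "real n / 2 \<le> real (n - 2)" using n by auto
        then have "real n * (real n / 2 * (real n / 2)) \<le> real n * (real (n - 1) * real (n - 2))"
          by (intro mult_left_mono mult_mono) auto
        moreover have "real n * (real n / 2 * (real n / 2)) = real n ^ 3 / 4" by (simp add: power3_eq_cube)
        moreover have "real (card (triples n)) = real n * (real (n - 1) * real (n - 2))"
          by (simp add: card_triples)
        ultimately show ?thesis using zero_le_power[of "real n" 3] by linarith
      qed
      then show "(real n ^ 3 / 8 * (\<beta> / 2 * q\<^sup>2))\<^sup>2 \<le> (real (card (triples n)) * (\<beta> / 2 * q\<^sup>2))\<^sup>2"
        using \<beta> q by (intro power_mono mult_right_mono) auto
      show "0 < (real n ^ 3 / 8 * (\<beta> / 2 * q\<^sup>2))\<^sup>2" using n \<beta> q by simp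
      show "0 \<le> A * (real n ^ 3 * q ^ 2 + real n ^ 4 * q ^ 3 + real n ^ 5 * q ^ 4)" using A q by simp
    qed
    also have "\<dots> = K * (inverse (real n ^ 3 * q\<^sup>2) + inverse (real n ^ 2 * q) + inverse (real n))"
      using n \<beta> q by (simp add: K_def field_simps eval_nat_numeral)
    also have "\<dots> \<le> K * ((inverse (a n))\<^sup>2 + inverse (a n) + inverse (real n))"
    proof -
      have an: "a n > 0" using n q by (simp add: a_eq)
      \<comment> \<open>The exponent 3/2 enters here: the term for m = 3 is exactly the inverse
        square of \<open>a n\<close>. The term for m = 4 is at most the inverse of
        \<open>a n\<close>, since n^(3/2) <= n^2.\<close>
      have "(real n powr (3/2))\<^sup>2 = real n ^ 3"
        using n by (simp add: powr_power powr_numeral)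
      then have 1: "inverse (real n ^ 3 * q\<^sup>2) = (inverse (a n))\<^sup>2"
        by (simp add: a_eq power_mult_distrib power_inverse)
      have "real n powr (3/2) \<le> real n powr 2" using n by (intro powr_mono) auto
      then have "a n \<le> real n ^ 2 * q" using n q by (simp add: a_eq powr_numeral)
      then have "inverse (real n ^ 2 * q) \<le> inverse (a n)" using an by (rule le_imp_inverse_le)
      then show ?thesis using 1 A by (intro mult_left_mono add_mono) (auto simp: K_def)
    qed
    finally show ?thesis .
  qed
  have "(\<lambda>n. inverse (a n)) \<longlonglongrightarrow> 0"
    using r(3) unfolding a_def by (rule tendsto_inverse_0_at_top)
  then have "(\<lambda>n. K * ((inverse (a n))\<^sup>2 + inverse (a n) + inverse (real n))) \<longlonglongrightarrow> K * (0\<^sup>2 + 0 + 0)"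
    by (intro tendsto_add tendsto_mult tendsto_power tendsto_const lim_inverse_n)
  then have lim: "(\<lambda>n. K * ((inverse (a n))\<^sup>2 + inverse (a n) + inverse (real n))) \<longlonglongrightarrow> 0" by simp
  have "eventually (\<lambda>n. r n < min \<delta>1 \<delta>2) sequentially"
    using r(2) \<delta>1(1) \<delta>2(1) by (intro order_tendstoD) auto
  then have "eventually (\<lambda>n. measure (P n) {w \<in> space (P n). s * signed_count c (r n) n w \<le> 0} \<le> K * ((inverse (a n))\<^sup>2 + inverse (a n) + inverse (real n))) sequentially"
    using eventually_ge_at_top[of 4] by eventually_elim (rule bound)
  then show ?thesis
    unfolding s_def[symmetric] by (rule tendsto_sandwich[OF _ _ tendsto_const lim, rotated]) auto
qed

end

section \<open>The estimator as a function of the graph\<close>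

definition wedge_count :: "nat \<Rightarrow> (nat \<Rightarrow> nat \<Rightarrow> bool) \<Rightarrow> nat" where
  "wedge_count n A = card {(i, j, k) \<in> triples n. A i j \<and> A i k}"

text \<open>Ordered triples count each triangle six times and each wedge, centred at the first
  entry, twice. The quotient of the counts is thus three times triangles over wedges, the usual
  global clustering coefficient.\<close>

definition tri_count :: "nat \<Rightarrow> (nat \<Rightarrow> nat \<Rightarrow> bool) \<Rightarrow> nat" where
  "tri_count n A = card {(i, j, k) \<in> triples n. A i j \<and> A i k \<and> A j k}"

definition threshold :: "nat \<Rightarrow> real" where
  "threshold e = (clustering e + clustering (Suc e)) / 2"

text \<open>LEAST is unspecified when no threshold lies below the ratio, as happens without
  wedges, where the ratio is 0 / 0 = 0.\<close>

definition dim_estimator :: "nat \<Rightarrow> (nat \<Rightarrow> nat \<Rightarrow> bool) \<Rightarrow> real" where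
  "dim_estimator n A = real (LEAST e. 1 \<le> e \<and> threshold e < real (tri_count n A) / real (wedge_count n A))"

lemma threshold_antimono:
  assumes "1 \<le> e" "e \<le> e'"
  shows "threshold e' \<le> threshold e"
  using assms(2)
proof (induction rule: dec_induct)
  case (step m)
  then have "threshold (Suc m) \<le> threshold m"
    using clustering_Suc_less[of m] clustering_Suc_less[of "Suc m"] assms(1) by (simp add: threshold_def)
  then show ?case using step.IH by simp
qed simp

lemma tri_count_le_wedge_count: "tri_count n A \<le> wedge_count n A"
  unfolding tri_count_def wedge_count_def by (rule card_mono) (auto intro: finite_subset[OF _ finite_triples])

text \<open>The cleared denominators match the signs of \<open>signed_count\<close>. The strict
  lower inequality with a nonnegative threshold forces a triangle, hence a wedge, so the ratio is
  meaningful. For e = 1 there is no upper condition because the search starts at 1.\<close>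

lemma dim_estimator_eq:
  assumes e: "1 \<le> e"
    and lower: "threshold e * real (wedge_count n A) < real (tri_count n A)"
    and upper: "e \<noteq> 1 \<Longrightarrow> real (tri_count n A) < threshold (e - 1) * real (wedge_count n A)"
  shows "dim_estimator n A = real e"
proof -
  let ?t = "real (tri_count n A)" and ?w = "real (wedge_count n A)"
  have "threshold e \<ge> 0" using clustering_nonneg by (simp add: threshold_def)
  then have "0 \<le> threshold e * ?w" by simp
  then have "?t > 0" using lower by linarith
  then have w: "?w > 0" using tri_count_le_wedge_count[of n A] by simp
  have "(LEAST e. 1 \<le> e \<and> threshold e < ?t / ?w) = e"
  proof (rule Least_equality)
    show "1 \<le> e \<and> threshold e < ?t / ?w" using e lower w by (simp add: field_simps)
    fix y assume y: "1 \<le> y \<and> threshold y < ?t / ?w"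
    show "e \<le> y"
    proof (rule ccontr)
      assume "\<not> e \<le> y"
      then have "e \<noteq> 1" "y \<le> e - 1" using y by auto
      then have "?t / ?w < threshold (e - 1)" "threshold (e - 1) \<le> threshold y"
        using upper w threshold_antimono[of y "e - 1"] y by (auto simp: field_simps)
      then show False using y by simp
    qed
  qed
  then show ?thesis by (simp add: dim_estimator_def)
qed

context fifth_power_density begin

text \<open>Indices in \<open>triples n\<close> are distinct and below n, so the side conditions in
  \<open>rgg_adj\<close> hold, and a sum defined from the points becomes a function of the graph
  alone.\<close>

lemma signed_count_rgg:
  "signed_count c \<rho> n w = real (tri_count n (rgg_adj d \<rho> n w)) - c * real (wedge_count n (rgg_adj d \<rho> n w))"
proof -
  let ?A = "rgg_adj d \<rho> n w"
  let ?t = "\<lambda>(i, j, k). ?A i j \<and> ?A i k \<and> ?A j k" and ?v = "\<lambda>(i, j, k). ?A i j \<and> ?A i k"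
  have "signed_count c \<rho> n w = (\<Sum>\<tau>\<in>triples n. of_bool (?t \<tau>) - c * of_bool (?v \<tau>))"
    unfolding signed_count_def
    by (intro sum.cong refl) (auto simp: kern_def tri_ker_def wedge_ker_def rgg_adj_def triples_iff)
  also have "\<dots> = (\<Sum>\<tau>\<in>triples n. of_bool (?t \<tau>)) - c * (\<Sum>\<tau>\<in>triples n. of_bool (?v \<tau>))"
    by (simp add: sum_subtractf sum_distrib_left)
  also have "(\<Sum>\<tau>\<in>triples n. of_bool (?t \<tau>) :: real) = real (card {\<tau> \<in> triples n. ?t \<tau>})"
    by (simp add: of_bool_def sum.If_cases Int_def)
  also have "(\<Sum>\<tau>\<in>triples n. of_bool (?v \<tau>) :: real) = real (card {\<tau> \<in> triples n. ?v \<tau>})"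
    by (simp add: of_bool_def sum.If_cases Int_def)
  also have "{\<tau> \<in> triples n. ?t \<tau>} = {(i, j, k) \<in> triples n. ?A i j \<and> ?A i k \<and> ?A j k}" by auto
  also have "{\<tau> \<in> triples n. ?v \<tau>} = {(i, j, k) \<in> triples n. ?A i j \<and> ?A i k}" by auto
  finally show ?thesis by (simp add: tri_count_def wedge_count_def)
qed

text \<open>Only finitely many graphs are possible, so the event is a finite union of events that
  prescribe all edges; this handles an arbitrary predicate \<open>Q\<close>.\<close>

lemma rgg_event_in_sets: "{w \<in> space (P n). Q (rgg_adj d \<rho> n w)} \<in> sets (P n)"
proof -
  let ?E = "{..<n} \<times> {..<n}"
  let ?rel = "\<lambda>S i j. (i, j) \<in> S"
  have eq: "{w \<in> space (P n). Q (rgg_adj d \<rho> n w)} =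
    (\<Union>S\<in>{S \<in> Pow ?E. Q (?rel S)}. {w \<in> space (P n). \<forall>x\<in>?E. rgg_adj d \<rho> n w (fst x) (snd x) \<longleftrightarrow> x \<in> S})" (is "?l = ?r")
  proof (intro equalityI subsetI)
    fix w assume w: "w \<in> ?l"
    let ?S = "{x. rgg_adj d \<rho> n w (fst x) (snd x)}"
    have "?S \<subseteq> ?E" by (auto simp: rgg_adj_def)
    moreover have "?rel ?S = rgg_adj d \<rho> n w" by simp
    ultimately show "w \<in> ?r" using w by (intro UN_I[of ?S]) auto
  next
    fix w assume "w \<in> ?r"
    then obtain S where S: "S \<subseteq> ?E" "Q (?rel S)" "w \<in> space (P n)"
      "\<forall>x\<in>?E. rgg_adj d \<rho> n w (fst x) (snd x) \<longleftrightarrow> x \<in> S" by auto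
    have "rgg_adj d \<rho> n w = ?rel S"
    proof (intro ext)
      fix i j show "rgg_adj d \<rho> n w i j = ((i, j) \<in> S)"
      proof (cases "(i, j) \<in> ?E")
        case True
        with S(4) show ?thesis by fastforce
      next
        case False
        then show ?thesis using S(1) by (auto simp: rgg_adj_def)
      qed
    qed
    then show "w \<in> ?l" using S by simp
  qed
  show ?thesis
    unfolding eq
  proof (rule sets.finite_UN)
    fix S
    show "{w \<in> space (P n). \<forall>x\<in>?E. rgg_adj d \<rho> n w (fst x) (snd x) \<longleftrightarrow> x \<in> S} \<in> sets (P n)"
    proof (rule sets.sets_Collect_finite_All)
      fix x assume "x \<in> ?E"
      then have [measurable]: "(\<lambda>w. w (fst x)) \<in> measurable (P n) L" "(\<lambda>w. w (snd x)) \<in> measurable (P n) L"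
        by (auto intro!: coord_P)
      show "{w \<in> space (P n). rgg_adj d \<rho> n w (fst x) (snd x) \<longleftrightarrow> x \<in> S} \<in> sets (P n)"
        unfolding rgg_adj_def by measurable
    qed simp
  qed auto
qed

text \<open>Outside two wrong-sign events the estimator equals d exactly, so the same bound serves
  every \<epsilon> > 0.\<close>

lemma dim_estimator_consistent:
  fixes r :: "nat \<Rightarrow> real"
  assumes r: "\<And>n. r n > 0" "r \<longlonglongrightarrow> 0" "filterlim (\<lambda>n. real n powr (3/2) * r n ^ d) at_top sequentially"
    and \<epsilon>: "\<epsilon> > 0"
  shows "(\<lambda>n. measure (P n) {w \<in> space (P n). \<bar>dim_estimator n (rgg_adj d (r n) n w) - real d\<bar> > \<epsilon>}) \<longlonglongrightarrow> 0"
proof -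
  let ?bad = "\<lambda>c n. {w \<in> space (P n). sgn (clustering d - c) * signed_count c (r n) n w \<le> 0}"
  \<comment> \<open>For d = 1 there is no smaller dimension to exclude; repeating
    \<open>threshold d\<close> makes the second event a copy of the first.\<close>
  let ?c' = "if d = 1 then threshold d else threshold (d - 1)"
  have c: "threshold d < clustering d" using clustering_Suc_less[OF d] by (simp add: threshold_def)
  have c': "clustering d < threshold (d - 1)" if "d \<noteq> 1"
    using clustering_Suc_less[of "d - 1"] that d by (simp add: threshold_def)
  have "(\<lambda>n. measure (P n) (?bad (threshold d) n) + measure (P n) (?bad ?c' n)) \<longlonglongrightarrow> 0 + 0"
    using c c' by (intro tendsto_add signed_count_wrong_sign_tendsto r) auto
  then have lim: "(\<lambda>n. measure (P n) (?bad (threshold d) n) + measure (P n) (?bad ?c' n)) \<longlonglongrightarrow> 0" by simp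
  have le: "measure (P n) {w \<in> space (P n). \<bar>dim_estimator n (rgg_adj d (r n) n w) - real d\<bar> > \<epsilon>}
     \<le> measure (P n) (?bad (threshold d) n) + measure (P n) (?bad ?c' n)" for n
  proof -
    interpret PP: prob_space "P n" by (rule prob_space_PiM_M)
    have m: "?bad c n \<in> sets (P n)" for c by measurable
    have "{w \<in> space (P n). \<bar>dim_estimator n (rgg_adj d (r n) n w) - real d\<bar> > \<epsilon>} \<subseteq> ?bad (threshold d) n \<union> ?bad ?c' n"
    proof
      fix w assume w: "w \<in> {w \<in> space (P n). \<bar>dim_estimator n (rgg_adj d (r n) n w) - real d\<bar> > \<epsilon>}"
      let ?A = "rgg_adj d (r n) n w"
      have "dim_estimator n ?A = real d" if "w \<notin> ?bad (threshold d) n" "w \<notin> ?bad ?c' n"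
      proof (rule dim_estimator_eq[OF d])
        show "threshold d * real (wedge_count n ?A) < real (tri_count n ?A)"
          using that(1) w c by (simp add: signed_count_rgg)
        assume "d \<noteq> 1"
        then show "real (tri_count n ?A) < threshold (d - 1) * real (wedge_count n ?A)"
          using that(2) w c' by (simp add: signed_count_rgg)
      qed
      moreover have "dim_estimator n ?A \<noteq> real d" using w \<epsilon> by auto
      ultimately show "w \<in> ?bad (threshold d) n \<union> ?bad ?c' n" by blast
    qed
    then have "measure (P n) {w \<in> space (P n). \<bar>dim_estimator n (rgg_adj d (r n) n w) - real d\<bar> > \<epsilon>}
       \<le> measure (P n) (?bad (threshold d) n \<union> ?bad ?c' n)"
      using m by (intro PP.finite_measure_mono) auto
    also have "\<dots> \<le> measure (P n) (?bad (threshold d) n) + measure (P n) (?bad ?c' n)"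
      using m by (intro measure_Un_le) auto
    finally show ?thesis .
  qed
  show ?thesis
  proof (rule tendsto_sandwich[OF _ _ tendsto_const lim])
    show "\<forall>\<^sub>F n in sequentially. measure (P n) {w \<in> space (P n). \<bar>dim_estimator n (rgg_adj d (r n) n w) - real d\<bar> > \<epsilon>}
       \<le> measure (P n) (?bad (threshold d) n) + measure (P n) (?bad ?c' n)"
      by (intro always_eventually allI le)
  qed simp
qed

lemma sample_space_eq: "sample_space d f n = P n"
  by (simp add: sample_space_def M_def)

end

theorem theorem1:
  shows "\<exists>\<Delta> :: nat \<Rightarrow> (nat \<Rightarrow> nat \<Rightarrow> bool) \<Rightarrow> real.
    \<forall>(d::nat) (f::(nat \<Rightarrow> real) \<Rightarrow> real) (r::nat \<Rightarrow> real).
      d \<ge> 1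
      \<and> f \<in> borel_measurable (lebesgue_pow d)
      \<and> (\<forall>x\<in>space (lebesgue_pow d). f x \<ge> 0)
      \<and> (\<integral>\<^sup>+ x. ennreal (f x) \<partial>lebesgue_pow d) = 1
      \<and> (\<integral>\<^sup>+ x. ennreal (f x ^ 5) \<partial>lebesgue_pow d) < \<infinity>
      \<and> (\<forall>n. r n > 0)
      \<and> r \<longlonglongrightarrow> 0
      \<and> filterlim (\<lambda>n. real n powr (3/2) * r n ^ d) at_top sequentially
      \<longrightarrow> (\<forall>\<epsilon>>0.
            (\<forall>n. {w \<in> space (sample_space d f n).
                   \<bar>\<Delta> n (rgg_adj d (r n) n w) - real d\<bar> > \<epsilon>} \<in> sets (sample_space d f n))
          \<and> (\<lambda>n. measure (sample_space d f n)
                 {w \<in> space (sample_space d f n).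
                   \<bar>\<Delta> n (rgg_adj d (r n) n w) - real d\<bar> > \<epsilon>}) \<longlonglongrightarrow> 0)"
proof (rule exI[of _ dim_estimator], intro allI impI, (erule conjE)+)
  fix d :: nat and f :: "(nat \<Rightarrow> real) \<Rightarrow> real" and r :: "nat \<Rightarrow> real" and \<epsilon> :: real
  assume "1 \<le> d" "f \<in> borel_measurable (lebesgue_pow d)" "\<forall>x\<in>space (lebesgue_pow d). 0 \<le> f x"
    "(\<integral>\<^sup>+ x. ennreal (f x) \<partial>lebesgue_pow d) = 1" "(\<integral>\<^sup>+ x. ennreal (f x ^ 5) \<partial>lebesgue_pow d) < \<infinity>"
  then interpret fifth_power_density d f by unfold_locales auto
  assume r: "\<forall>n. 0 < r n" "r \<longlonglongrightarrow> 0" "filterlim (\<lambda>n. real n powr (3/2) * r n ^ d) at_top sequentially"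
    and \<epsilon>: "0 < \<epsilon>"
  show "(\<forall>n. {w \<in> space (sample_space d f n). \<epsilon> < \<bar>dim_estimator n (rgg_adj d (r n) n w) - real d\<bar>} \<in> sets (sample_space d f n))
      \<and> (\<lambda>n. measure (sample_space d f n)
           {w \<in> space (sample_space d f n). \<epsilon> < \<bar>dim_estimator n (rgg_adj d (r n) n w) - real d\<bar>}) \<longlonglongrightarrow> 0"
    unfolding sample_space_eq
    using rgg_event_in_sets[where Q = "\<lambda>A. \<epsilon> < \<bar>dim_estimator _ A - real d\<bar>"] dim_estimator_consistent[OF _ r(2,3) \<epsilon>] r(1)
    by blast
qed

end
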